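(* There is a nondeterministic logarithmic-space Turing machine which, given the canonical encoding of a finite ordered graph $(G,<)$ and (indices of) two vertices $v,w$ of $G$, accepts if and only if $v\prec_B w$.
   Context: A finite ordered graph $(G,<)$ is a finite undirected graph with a linear order on its vertices; its canonical encoding is the standard string encoding relative to $<$. The canonical breadth-first order $\prec_B$: for vertices $v,w$ let $v_0,w_0$ be the $<$-least vertices of the connected components of $v$ and $w$ respectively. Let $<^\star$ be the order on finite sequences of vertices comparing first by length and then lexicographically with respect to $<$. Let $\vec v$ denote the $<^\star$-least path from $v_0$ to $v$ (and similarly $\vec w$). Then: if $v_0\ne w_0$, $v\prec_B w$ iff $v_0<w_0$; if $v_0=w_0$, $v\prec_B w$ iff $\vec v<^\star\vec w$. *)

theory Defs
  imports Main "HOL-Library.Log_Nat"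
begin

text \<open>A finite ordered graph with n vertices is represented, up to order-isomorphism,
  by the vertex set {0..<n} ordered by the natural order on nat, together with
  a symmetric irreflexive adjacency relation E on {0..<n}.\<close>

definition ord_graph :: "nat \<Rightarrow> (nat \<Rightarrow> nat \<Rightarrow> bool) \<Rightarrow> bool" where
  "ord_graph n E \<longleftrightarrow>
     (\<forall>u v. E u v \<longrightarrow> u < n \<and> v < n) \<and>
     (\<forall>u v. E u v \<longrightarrow> E v u) \<and>
     (\<forall>u. \<not> E u u)"

definition is_path :: "nat \<Rightarrow> (nat \<Rightarrow> nat \<Rightarrow> bool) \<Rightarrow> nat list \<Rightarrow> nat \<Rightarrow> nat \<Rightarrow> bool" where
  "is_path n E p u v \<longleftrightarrow>
     p \<noteq> [] \<and> hd p = u \<and> last p = v \<and> set p \<subseteq> {..<n} \<and>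
     (\<forall>i. Suc i < length p \<longrightarrow> E (p ! i) (p ! Suc i))"

definition comp_min :: "nat \<Rightarrow> (nat \<Rightarrow> nat \<Rightarrow> bool) \<Rightarrow> nat \<Rightarrow> nat" where
  "comp_min n E v = Min {u. u < n \<and> (\<exists>p. is_path n E p u v)}"

definition less_star :: "nat list \<Rightarrow> nat list \<Rightarrow> bool" where
  "less_star p q \<longleftrightarrow> (p, q) \<in> lenlex {(a, b). a < b}"

definition least_path :: "nat \<Rightarrow> (nat \<Rightarrow> nat \<Rightarrow> bool) \<Rightarrow> nat \<Rightarrow> nat list" where
  "least_path n E v =
     (THE p. is_path n E p (comp_min n E v) v \<and>
             (\<forall>q. is_path n E q (comp_min n E v) v \<longrightarrow> q = p \<or> less_star p q))"

definition precB :: "nat \<Rightarrow> (nat \<Rightarrow> nat \<Rightarrow> bool) \<Rightarrow> nat \<Rightarrow> nat \<Rightarrow> bool" where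
  "precB n E v w \<longleftrightarrow>
     (if comp_min n E v \<noteq> comp_min n E w then comp_min n E v < comp_min n E w
      else less_star (least_path n E v) (least_path n E w))"

datatype sym = Zero | One | Sep

definition enc_graph :: "nat \<Rightarrow> (nat \<Rightarrow> nat \<Rightarrow> bool) \<Rightarrow> sym list" where
  "enc_graph n E = concat (map (\<lambda>i. map (\<lambda>j. if E i j then One else Zero) [0..<n]) [0..<n])"

function bin :: "nat \<Rightarrow> sym list" where
  "bin k = (if k < 2 then [if k = 0 then Zero else One]
            else bin (k div 2) @ [if even k then Zero else One])"
  by auto
termination by (relation "measure id") auto

definition enc_input :: "nat \<Rightarrow> (nat \<Rightarrow> nat \<Rightarrow> bool) \<Rightarrow> nat \<Rightarrow> nat \<Rightarrow> sym list" where
  "enc_input n E v w = enc_graph n E @ [Sep] @ bin v @ [Sep] @ bin w"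

text \<open>Transitions: (state, input symbol read (None = end marker), work symbol read,
  new state, work symbol written, input head move, work head move).
  Work symbol 0 is the blank.\<close>
record ntm =
  states :: "nat set"
  start :: nat
  accepting :: "nat set"
  walph :: "nat set"
  delta :: "(nat \<times> sym option \<times> nat \<times> nat \<times> nat \<times> int \<times> int) set"

definition ntm_wf :: "ntm \<Rightarrow> bool" where
  "ntm_wf M \<longleftrightarrow> finite (states M) \<and> finite (walph M) \<and> 0 \<in> walph M \<and>
     start M \<in> states M \<and> accepting M \<subseteq> states M \<and>
     (\<forall>(q, a, b, q', b', di, dj) \<in> delta M.
        q \<in> states M \<and> b \<in> walph M \<and> q' \<in> states M \<and> b' \<in> walph M \<and>
        di \<in> {-1, 0, 1} \<and> dj \<in> {-1, 0, 1})"

text \<open>Input tape with end markers at positions 0 and length x + 1.\<close>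
definition inp :: "sym list \<Rightarrow> nat \<Rightarrow> sym option" where
  "inp x i = (if 1 \<le> i \<and> i \<le> length x then Some (x ! (i - 1)) else None)"

text \<open>Configuration: (state, input head position, work tape contents, work head position).\<close>
type_synonym conf = "nat \<times> nat \<times> (nat \<Rightarrow> nat) \<times> nat"

definition step :: "ntm \<Rightarrow> sym list \<Rightarrow> conf \<Rightarrow> conf \<Rightarrow> bool" where
  "step M x c c' \<longleftrightarrow>
     (\<exists>q i t j q' b' di dj.
        c = (q, i, t, j) \<and> (q, inp x i, t j, q', b', di, dj) \<in> delta M \<and>
        0 \<le> int i + di \<and> int i + di \<le> int (length x) + 1 \<and> 0 \<le> int j + dj \<and>
        c' = (q', nat (int i + di), t(j := b'), nat (int j + dj)))"

definition init_conf :: "ntm \<Rightarrow> conf" where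
  "init_conf M = (start M, 0, \<lambda>_. 0, 0)"

definition reachable :: "ntm \<Rightarrow> sym list \<Rightarrow> conf \<Rightarrow> bool" where
  "reachable M x c \<longleftrightarrow> (step M x)\<^sup>*\<^sup>* (init_conf M) c"

definition accepts :: "ntm \<Rightarrow> sym list \<Rightarrow> bool" where
  "accepts M x \<longleftrightarrow> (\<exists>q i t j. reachable M x (q, i, t, j) \<and> q \<in> accepting M)"

definition logspace :: "ntm \<Rightarrow> bool" where
  "logspace M \<longleftrightarrow> (\<exists>C::nat. \<forall>x q i t j. reachable M x (q, i, t, j) \<longrightarrow>
      j \<le> C * (floorlog 2 (length x) + 1))"

end

theory Submission
  imports Defs "HOL-Library.Countable" "HOL-Library.Nat_Bijection"
begin

text \<open>A logarithmic-space machine is programmed through regular programs over finitely many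
  registers with values polynomial in the input length; the registers are kept in binary on
  parallel tracks of the work tape. The predicates decided by such programs are closed under
  conjunction, disjunction, bounded quantification and transitive closure, hence (counting along
  a transitive closure) under ``at least \<open>c\<close> elements below \<open>b\<close> satisfy \<open>Q\<close>''. Negation is needed
  only for ``there is a walk of length \<open>r\<close> from \<open>a\<close> to \<open>b\<close>'' and comes from inductive
  counting. The least path to \<open>v\<close> is the greedy one, so two least paths of equal length are
  compared by following their common
  prefix, which is again a transitive closure.\<close>

section \<open>Register programs\<close>

text \<open>Acceptance is existential, so a program can only confirm facts; a failed branch proves
  nothing. Yet the breadth-first order contains three minimality claims: the least vertex of a
  component, the length of a shortest path, and the least next vertex on a path. All three need
  negative information about walks. Predicates are therefore built from positive atoms, and a
  negated atom occurs only where it has a certificate of its own. For non-adjacency this is the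
  symbol \<open>Zero\<close> of the matrix, for inequality of numbers a disjunction of strict
  comparisons.

  The second obstacle is the space bound: it covers every branch on every input, also on strings
  that encode no graph. Hence the machine measures its input and lays out the tape before the
  program starts, and later sweeps turn round at the first blank. This fixes one range for all
  registers, \<open>cap x\<close>, the least power of two above \<open>length x + 1\<close>;
  vertices, tape positions and the walk lengths that matter lie below it.\<close>

datatype act = Guess nat | Test nat nat bool | MoveL | MoveR | Sym "sym option"
datatype prog = Act act | Seq prog prog | Alt prog prog | Star prog

type_synonym env = "nat \<Rightarrow> nat"

text \<open>The number of values that \<open>floorlog 2 (length x + 1)\<close> binary digits can
  hold. It exceeds \<open>length x + 1\<close>, so every head position is a possible register
  value.\<close>

definition cap :: "sym list \<Rightarrow> nat" where
  "cap x = 2 ^ floorlog 2 (length x + 1)"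

text \<open>There is no assignment: a value is guessed and then tested against another register, for
  equality if \<open>c\<close> is \<open>False\<close> and for being the successor if it is
  \<open>True\<close>. Both tests fit one sweep with a carry bit.\<close>

fun exec :: "sym list \<Rightarrow> act \<Rightarrow> nat \<times> env \<Rightarrow> nat \<times> env \<Rightarrow> bool" where
  "exec x (Guess r) (i, \<rho>) s' \<longleftrightarrow> (\<exists>a<cap x. s' = (i, \<rho>(r := a)))"
| "exec x (Test r s c) (i, \<rho>) s' \<longleftrightarrow> s' = (i, \<rho>) \<and> \<rho> r = \<rho> s + of_bool c"
| "exec x MoveL (i, \<rho>) s' \<longleftrightarrow> 0 < i \<and> s' = (i - 1, \<rho>)"
| "exec x MoveR (i, \<rho>) s' \<longleftrightarrow> i \<le> length x \<and> s' = (i + 1, \<rho>)"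
| "exec x (Sym a) (i, \<rho>) s' \<longleftrightarrow> s' = (i, \<rho>) \<and> inp x i = a"

fun sem :: "sym list \<Rightarrow> prog \<Rightarrow> nat \<times> env \<Rightarrow> nat \<times> env \<Rightarrow> bool" where
  "sem x (Act a) = exec x a"
| "sem x (Seq p q) = sem x p OO sem x q"
| "sem x (Alt p q) = sup (sem x p) (sem x q)"
| "sem x (Star p) = (sem x p)\<^sup>*\<^sup>*"

text \<open>Programs run with an explicit continuation, the list of programs still to be executed. Only
  finitely many continuations occur, so they can serve as control states of a machine.\<close>

inductive ctl :: "prog list \<Rightarrow> prog list \<Rightarrow> bool" where
  "ctl (Seq p q # l) (p # q # l)"
| "ctl (Alt p q # l) (p # l)"
| "ctl (Alt p q # l) (q # l)"
| "ctl (Star p # l) l"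
| "ctl (Star p # l) (p # Star p # l)"

inductive sstep :: "sym list \<Rightarrow> prog list \<times> nat \<times> env \<Rightarrow> prog list \<times> nat \<times> env \<Rightarrow> bool" for x where
  sstep_ctl: "ctl l l' \<Longrightarrow> sstep x (l, s) (l', s)"
| sstep_act: "exec x a s s' \<Longrightarrow> sstep x (Act a # l, s) (l, s')"

fun sem_list :: "sym list \<Rightarrow> prog list \<Rightarrow> nat \<times> env \<Rightarrow> nat \<times> env \<Rightarrow> bool" where
  "sem_list x [] = (=)"
| "sem_list x (p # l) = sem x p OO sem_list x l"

lemma sstep_sem_list:
  assumes "sstep x (l, s) (l', s')" "sem_list x l' s' t"
  shows "sem_list x l s t"
  using assms
proof cases
  case sstep_ctl
  have star: "(sem x p)\<^sup>*\<^sup>* u w" if "sem x p u v" "(sem x p)\<^sup>*\<^sup>* v w" for p u v w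
    using that by (rule converse_rtranclp_into_rtranclp)
  from sstep_ctl(2) show ?thesis using assms(2) sstep_ctl(1)
  proof cases
    case (5 p l'')
    with assms(2) sstep_ctl(1) show ?thesis by (auto simp: OO_def simp del: split_paired_Ex) (metis star)
  qed (auto simp: OO_def simp del: split_paired_Ex)
qed (use assms in auto)

lemma sstep_imp_sem_list:
  assumes "(sstep x)\<^sup>*\<^sup>* (l, s) ([], t)"
  shows "sem_list x l s t"
  using assms
proof (induction "(l, s)" arbitrary: l s rule: converse_rtranclp_induct)
  case (step y)
  then show ?case by (cases y) (auto intro: sstep_sem_list)
qed auto

text \<open>The rest \<open>l\<close> must be arbitrary in the induction, because the parts of
  \<open>Seq\<close> and the body of \<open>Star\<close> run in front of longer lists than the whole
  program does.\<close>

lemma sem_imp_sstep: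
  "sem x p s t \<Longrightarrow> (sstep x)\<^sup>*\<^sup>* (p # l, s) (l, t)"
proof (induction p arbitrary: s t l)
  case (Act a)
  then show ?case by (auto intro: sstep_act)
next
  case (Seq p q)
  then obtain u where u: "sem x p s u" "sem x q u t" by auto
  have "sstep x (Seq p q # l, s) (p # q # l, s)" by (auto intro: sstep_ctl ctl.intros)
  with Seq.IH(1)[OF u(1), of "q # l"] Seq.IH(2)[OF u(2), of l] show ?case
    by (meson converse_rtranclp_into_rtranclp rtranclp_trans)
next
  case (Alt p q)
  have "sstep x (Alt p q # l, s) (p # l, s)" "sstep x (Alt p q # l, s) (q # l, s)"
    by (auto intro: sstep_ctl ctl.intros)
  moreover have "(sstep x)\<^sup>*\<^sup>* (p # l, s) (l, t) \<or> (sstep x)\<^sup>*\<^sup>* (q # l, s) (l, t)"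
    using Alt.IH(1)[of s t l] Alt.IH(2)[of s t l] Alt.prems by (simp del: split_paired_All) blast
  ultimately show ?case by (meson converse_rtranclp_into_rtranclp)
next
  case (Star p)
  from Star.prems have "(sem x p)\<^sup>*\<^sup>* s t" by simp
  then show ?case
  proof (induction rule: converse_rtranclp_induct)
    case base
    show ?case by (auto intro: sstep_ctl ctl.intros)
  next
    case (step y z)
    have "sstep x (Star p # l, y) (p # Star p # l, y)" by (auto intro: sstep_ctl ctl.intros)
    with Star.IH[OF step(1), of "Star p # l"] step(3) show ?case
      by (meson converse_rtranclp_into_rtranclp rtranclp_trans)
  qed
qed

lemma sem_iff_sstep: "sem x p s t \<longleftrightarrow> (sstep x)\<^sup>*\<^sup>* ([p], s) ([], t)"
  using sem_imp_sstep[of x p s t "[]"] sstep_imp_sem_list[of x "[p]" s t] by auto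

text \<open>A bound on the lists met while \<open>p\<close> runs in front of \<open>l\<close>, the
  final \<open>l\<close> aside. It is finite because a loop body returns to the very list
  \<open>Star p # l\<close> from which it was entered, so iterations pile up nothing.\<close>

fun conts :: "prog \<Rightarrow> prog list \<Rightarrow> prog list set" where
  "conts (Act a) l = {Act a # l}"
| "conts (Seq p q) l = insert (Seq p q # l) (conts p (q # l) \<union> conts q l)"
| "conts (Alt p q) l = insert (Alt p q # l) (conts p l \<union> conts q l)"
| "conts (Star p) l = insert (Star p # l) (conts p (Star p # l))"

lemma finite_conts: "finite (conts p l)"
  by (induction p arbitrary: l) auto

lemma conts_self: "p # l \<in> conts p l"
  by (cases p) auto

inductive_cases ctl_cases:
  "ctl (Act a # l) u" "ctl (Seq p q # l) u" "ctl (Alt p q # l) u" "ctl (Star p # l) u"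

lemma conts_ctl:
  "u \<in> conts p l \<Longrightarrow> ctl u u' \<Longrightarrow> u' \<in> insert l (conts p l)"
proof (induction p arbitrary: l)
  case (Act a)
  then show ?case by (auto elim: ctl_cases)
next
  case (Seq p q)
  from Seq.prems(1) consider "u = Seq p q # l" | "u \<in> conts p (q # l)" | "u \<in> conts q l" by auto
  then show ?case
  proof cases
    case 1
    with Seq.prems(2) show ?thesis by (auto elim: ctl_cases simp: conts_self)
  next
    case 2
    from Seq.IH(1)[OF this Seq.prems(2)] conts_self[of q l] show ?thesis by auto
  next
    case 3
    from Seq.IH(2)[OF this Seq.prems(2)] show ?thesis by auto
  qed
next
  case (Alt p q)
  from Alt.prems(1) consider "u = Alt p q # l" | "u \<in> conts p l" | "u \<in> conts q l" by auto
  then show ?case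
  proof cases
    case 1
    with Alt.prems(2) show ?thesis by (auto elim: ctl_cases simp: conts_self)
  next
    case 2
    from Alt.IH(1)[OF this Alt.prems(2)] show ?thesis by auto
  next
    case 3
    from Alt.IH(2)[OF this Alt.prems(2)] show ?thesis by auto
  qed
next
  case (Star p)
  from Star.prems(1) consider "u = Star p # l" | "u \<in> conts p (Star p # l)" by auto
  then show ?case
  proof cases
    case 1
    with Star.prems(2) show ?thesis by (auto elim: ctl_cases simp: conts_self)
  next
    case 2
    from Star.IH[OF this Star.prems(2)] show ?thesis by auto
  qed
qed

lemma conts_act: "Act a # u \<in> conts p l \<Longrightarrow> u \<in> insert l (conts p l)"
proof (induction p arbitrary: l)
  case (Seq p q)
  from Seq.IH(1)[of "q # l"] Seq.IH(2)[of l] Seq.prems conts_self[of q l] show ?case by auto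
next
  case (Alt p q)
  from Alt.IH(1)[of l] Alt.IH(2)[of l] Alt.prems show ?case by auto
next
  case (Star p)
  from Star.IH[of "Star p # l"] Star.prems show ?case by auto
qed auto

fun act_regs :: "act \<Rightarrow> nat set" where
  "act_regs (Guess r) = {r}"
| "act_regs (Test r s c) = {r, s}"
| "act_regs _ = {}"

fun regs :: "prog \<Rightarrow> nat set" where
  "regs (Act a) = act_regs a"
| "regs (Seq p q) = regs p \<union> regs q"
| "regs (Alt p q) = regs p \<union> regs q"
| "regs (Star p) = regs p"

lemma finite_regs: "finite (regs p)"
proof (induction p)
  case (Act a)
  then show ?case by (cases a) auto
qed auto

lemma regs_conts:
  "u \<in> conts p l \<Longrightarrow> q \<in> set u \<Longrightarrow> regs q \<subseteq> regs p \<union> (\<Union>q\<in>set l. regs q)"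
proof (induction p arbitrary: l)
  case (Seq p1 p2)
  from Seq.IH(1)[of "p2 # l"] Seq.IH(2)[of l] Seq.prems show ?case by auto
next
  case (Alt p1 p2)
  from Alt.IH(1)[of l] Alt.IH(2)[of l] Alt.prems show ?case by auto
next
  case (Star p)
  from Star.IH[of "Star p # l"] Star.prems show ?case by auto
qed auto

section \<open>Work tapes with several binary tracks\<close>

text \<open>The offset 2 keeps columns apart from the blank 0 and the marker 1.\<close>

definition col :: "nat set \<Rightarrow> nat" where
  "col S = 2 + set_encode S"

text \<open>Cell 0 carries the marker 1, cell \<open>j + 1\<close> holds bit \<open>j\<close> of all registers, and the first
  blank 0 marks the right end.\<close>

definition tape :: "nat \<Rightarrow> nat \<Rightarrow> env \<Rightarrow> nat \<Rightarrow> nat" where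
  "tape k m \<rho> j = (if j = 0 then 1 else if j \<le> m then col {r. r < k \<and> bit (\<rho> r) (j - 1)} else 0)"

lemma col_neq [simp]: "col S \<noteq> 0" "col S \<noteq> 1" "0 \<noteq> col S" "1 \<noteq> col S" "col S \<noteq> Suc 0" "Suc 0 \<noteq> col S"
  by (auto simp: col_def)

lemma col_eq: "finite S \<Longrightarrow> finite T \<Longrightarrow> col S = col T \<longleftrightarrow> S = T"
  by (auto simp: col_def set_encode_eq)

lemma col_eq': "S \<subseteq> {..<k} \<Longrightarrow> T \<subseteq> {..<k} \<Longrightarrow> col S = col T \<longleftrightarrow> S = T"
  by (auto simp: col_eq finite_subset)

lemma tape_col_cases:
  assumes "tape k m \<rho> j = col S" "S \<subseteq> {..<k}"
  shows "0 < j \<and> j \<le> m \<and> S = {r. r < k \<and> bit (\<rho> r) (j - 1)}"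
proof -
  have "{r. r < k \<and> bit (\<rho> r) (j - 1)} \<subseteq> {..<k}" by auto
  with assms show ?thesis by (auto simp: tape_def col_eq' split: if_splits)
qed

lemma tape_0 [simp]: "tape k m \<rho> 0 = 1"
  by (simp add: tape_def)

lemma tape_Suc: "j < m \<Longrightarrow> tape k m \<rho> (Suc j) = col {r. r < k \<and> bit (\<rho> r) j}"
  by (simp add: tape_def)

lemma tape_1_cases: "tape k m \<rho> j = 1 \<longleftrightarrow> j = 0" "tape k m \<rho> j = Suc 0 \<longleftrightarrow> j = 0"
  by (auto simp: tape_def)

lemma tape_0_cases: "tape k m \<rho> j = 0 \<longleftrightarrow> m < j"
  by (auto simp: tape_def)

definition put_bit :: "bool \<Rightarrow> nat \<Rightarrow> nat \<Rightarrow> nat" where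
  "put_bit b j y = (if b then set_bit j y else unset_bit j y)"

lemma bit_put_bit: "bit (put_bit b j y) i = (if i = j then b else bit y i)"
  by (auto simp: put_bit_def bit_set_bit_iff bit_unset_bit_iff)

lemma less_exp_iff_bit: "(y :: nat) < 2 ^ m \<longleftrightarrow> (\<forall>i\<ge>m. \<not> bit y i)"
proof
  assume "y < 2 ^ m"
  then have "take_bit m y = y" by (simp add: take_bit_nat_eq_self)
  then have "bit y i \<longleftrightarrow> i < m \<and> bit y i" for i
    using bit_take_bit_iff[of m y i] by simp
  then show "\<forall>i\<ge>m. \<not> bit y i" by (meson linorder_not_le)
next
  assume "\<forall>i\<ge>m. \<not> bit y i"
  then have "bit (take_bit m y) i = bit y i" for i
    unfolding bit_take_bit_iff by (meson linorder_not_le)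
  then have "take_bit m y = y" by (simp add: bit_eq_iff)
  then show "y < 2 ^ m" by (metis take_bit_nat_less_exp)
qed

lemma put_bit_less: "y < 2 ^ m \<Longrightarrow> j < m \<Longrightarrow> put_bit b j y < 2 ^ m"
  by (auto simp: less_exp_iff_bit bit_put_bit)

text \<open>Only track \<open>r\<close> of the overwritten column may differ, so a single write of
  the machine is an update of one register and the tape keeps the form
  \<open>tape k m _\<close>.\<close>

lemma tape_put_bit:
  assumes "j < m" "r < k" "S' \<subseteq> {..<k}" "S' - {r} = {s. s < k \<and> bit (\<rho> s) j} - {r}"
  shows "(tape k m \<rho>)(Suc j := col S') = tape k m (\<rho>(r := put_bit (r \<in> S') j (\<rho> r)))"
proof
  fix i
  show "((tape k m \<rho>)(Suc j := col S')) i = tape k m (\<rho>(r := put_bit (r \<in> S') j (\<rho> r))) i"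
  proof (cases "i = Suc j")
    case True
    have "s \<in> S' \<longleftrightarrow> s < k \<and> bit ((\<rho>(r := put_bit (r \<in> S') j (\<rho> r))) s) j" for s
      using assms by (cases "s = r") (auto simp: bit_put_bit)
    then have "S' = {s. s < k \<and> bit ((\<rho>(r := put_bit (r \<in> S') j (\<rho> r))) s) j}" by blast
    then show ?thesis using True assms by (simp only: fun_upd_same tape_Suc)
  next
    case False
    then have "i \<noteq> 0 \<Longrightarrow> i - 1 \<noteq> j" by auto
    then have "i \<noteq> 0 \<Longrightarrow> bit ((\<rho>(r := put_bit (r \<in> S') j (\<rho> r))) s) (i - 1) = bit (\<rho> s) (i - 1)" for s
      by (simp add: bit_put_bit)
    then have "i \<noteq> 0 \<Longrightarrow> {s. s < k \<and> bit ((\<rho>(r := put_bit (r \<in> S') j (\<rho> r))) s) (i - 1)}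
        = {s. s < k \<and> bit (\<rho> s) (i - 1)}"
      by presburger
    then have "i \<noteq> 0 \<Longrightarrow> tape k m \<rho> i = tape k m (\<rho>(r := put_bit (r \<in> S') j (\<rho> r))) i"
      unfolding tape_def by presburger
    with False show ?thesis by (cases "i = 0") simp_all
  qed
qed

section \<open>Compiling register programs to Turing machines\<close>

instance sym :: countable by countable_datatype
instance act :: countable by countable_datatype
instance prog :: countable by countable_datatype

text \<open>In the states \<open>Count\<close> and \<open>Return\<close> the machine puts the input length plus one into register 1,
  one increment per move of the input head; the work tape gets longer only when this counter
  overflows, which bounds the space on every input. Afterwards a guess or a test is one sweep
  over the columns, starting at the least significant bit, followed by a return to cell 0. The Boolean
  of \<open>TestSweep\<close> is the carry.\<close>

datatype mstate = Start | Count | Return | Main "prog list" | GuessSweep nat "prog list"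
    | TestSweep nat nat bool "prog list" | Rewind "prog list"

instance mstate :: countable by countable_datatype

text \<open>The rules for \<open>Main\<close> read the marker 1, so program steps start with the
  work head on cell 0. \<open>tcol\<close> adds the carry to the digit of \<open>s\<close> and
  compares with the digit of \<open>r\<close>: the sum digit is the exclusive or, the new carry the
  conjunction. A mismatch, or a carry left over at the blank, leaves no applicable rule.\<close>

inductive mtrans :: "nat \<Rightarrow> prog \<Rightarrow> mstate \<Rightarrow> sym option \<Rightarrow> nat \<Rightarrow> mstate \<Rightarrow> nat \<Rightarrow> int \<Rightarrow> int \<Rightarrow> bool" for k p where
  ini: "mtrans k p Start a 0 Count 1 1 1"
| inc1: "mtrans k p Count a (col {1}) Count (col {}) 0 1"
| inc0: "b = 0 \<or> b = col {} \<Longrightarrow> mtrans k p Count a b Return (col {1}) 0 (-1)"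
| ret: "S \<subseteq> {..<k} \<Longrightarrow> mtrans k p Return a (col S) Return (col S) 0 (-1)"
| ret_more: "mtrans k p Return (Some y) 1 Count 1 1 1"
| ret_done: "mtrans k p Return None 1 (Main [p]) 1 0 0"
| ctl: "ctl l l' \<Longrightarrow> mtrans k p (Main l) a 1 (Main l') 1 0 0"
| movel: "mtrans k p (Main (Act MoveL # l)) a 1 (Main l) 1 (-1) 0"
| mover: "mtrans k p (Main (Act MoveR # l)) a 1 (Main l) 1 1 0"
| sym: "mtrans k p (Main (Act (Sym a) # l)) a 1 (Main l) 1 0 0"
| guess: "mtrans k p (Main (Act (Guess r) # l)) a 1 (GuessSweep r l) 1 0 1"
| gcol: "S \<subseteq> {..<k} \<Longrightarrow> S' \<subseteq> {..<k} \<Longrightarrow> S' - {r} = S - {r} \<Longrightarrow> mtrans k p (GuessSweep r l) a (col S)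
    (GuessSweep r l) (col S') 0 1"
| gend: "mtrans k p (GuessSweep r l) a 0 (Rewind l) 0 0 (-1)"
| test: "mtrans k p (Main (Act (Test r s c) # l)) a 1 (TestSweep r s c l) 1 0 1"
| tcol: "S \<subseteq> {..<k} \<Longrightarrow> r \<in> S \<longleftrightarrow> (s \<in> S \<longleftrightarrow> \<not> c) \<Longrightarrow> mtrans k p (TestSweep r s c l) a (col S)
    (TestSweep r s (c \<and> s \<in> S) l) (col S) 0 1"
| tend: "mtrans k p (TestSweep r s False l) a 0 (Rewind l) 0 0 (-1)"
| bcol: "S \<subseteq> {..<k} \<Longrightarrow> mtrans k p (Rewind l) a (col S) (Rewind l) (col S) 0 (-1)"
| bend: "mtrans k p (Rewind l) a 1 (Main l) 1 0 0"

definition labels :: "prog \<Rightarrow> prog list set" where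
  "labels p = insert [] (conts p [])"

definition mstates :: "nat \<Rightarrow> prog \<Rightarrow> mstate set" where
  "mstates k p = {Start, Count, Return} \<union> Main ` labels p \<union> (\<lambda>(r, l). GuessSweep r l) `
      ({..<k} \<times> labels p) \<union>
     (\<lambda>(r, s, c, l). TestSweep r s c l) ` ({..<k} \<times> {..<k} \<times> UNIV \<times> labels p) \<union> Rewind ` labels p"

lemma mstates_iff [simp]:
  "Start \<in> mstates k p" "Count \<in> mstates k p" "Return \<in> mstates k p"
  "Main l \<in> mstates k p \<longleftrightarrow> l \<in> labels p"
  "GuessSweep r l \<in> mstates k p \<longleftrightarrow> r < k \<and> l \<in> labels p"
  "TestSweep r s c l \<in> mstates k p \<longleftrightarrow> r < k \<and> s < k \<and> l \<in> labels p"
  "Rewind l \<in> mstates k p \<longleftrightarrow> l \<in> labels p"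
  by (auto simp: mstates_def image_iff)

text \<open>\<open>mtrans\<close> speaks of arbitrary program lists. Restricting it to
  \<open>mstates k p\<close> makes the machine finite, at the price that the simulation must show
  that labels lead to labels.\<close>

definition machine :: "nat \<Rightarrow> prog \<Rightarrow> ntm" where
  "machine k p = \<lparr> states = to_nat ` mstates k p, start = to_nat Start, accepting = {to_nat (Main [])},
     walph = {0, 1} \<union> col ` Pow {..<k},
     delta = {(to_nat q, a, b, to_nat q', b', di, dj) | q a b q' b' di dj.
        q \<in> mstates k p \<and> q' \<in> mstates k p \<and> mtrans k p q a b q' b' di dj} \<rparr>"

lemma trans_walph:
  assumes "2 \<le> k" "mtrans k p q a b q' b' di dj"
  shows "b \<in> {0, 1} \<union> col ` Pow {..<k} \<and> b' \<in> {0, 1} \<union> col ` Pow {..<k} \<and> di \<in> {-1, 0, 1} \<and>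
      dj \<in> {-1, 0, 1}"
  using assms(2,1) by cases auto

lemma finite_mstates: "finite (mstates k p)"
  by (auto simp: mstates_def labels_def finite_conts)

lemma ntm_wf_machine:
  assumes "2 \<le> k"
  shows "ntm_wf (machine k p)"
proof -
  have "Start \<in> mstates k p" "Main [] \<in> mstates k p"
    by (auto simp: mstates_def labels_def)
  moreover have "\<forall>(q, a, b, q', b', di, dj) \<in> delta (machine k p).
        q \<in> states (machine k p) \<and> b \<in> walph (machine k p) \<and> q' \<in> states (machine k p) \<and>
        b' \<in> walph (machine k p) \<and> di \<in> {-1, 0, 1} \<and> dj \<in> {-1, 0, 1}"
  proof clarify
    fix q a b q' b' di dj assume "(q, a, b, q', b', di, dj) \<in> delta (machine k p)"
    then obtain u u' where "q = to_nat u" "q' = to_nat u'" "u \<in> mstates k p" "u' \<in> mstates k p"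
        "mtrans k p u a b u' b' di dj"
      by (auto simp: machine_def)
    with trans_walph[OF assms this(5)]
    show "q \<in> states (machine k p) \<and> b \<in> walph (machine k p) \<and> q' \<in> states (machine k p) \<and>
        b' \<in> walph (machine k p) \<and> di \<in> {-1, 0, 1} \<and> dj \<in> {-1, 0, 1}"
      by (simp add: machine_def)
  qed
  ultimately show ?thesis
    unfolding ntm_wf_def by (simp add: machine_def finite_mstates)
qed

section \<open>Machine runs with symbolic states\<close>

type_synonym mconf = "mstate \<times> nat \<times> (nat \<Rightarrow> nat) \<times> nat"

inductive mstep :: "nat \<Rightarrow> prog \<Rightarrow> sym list \<Rightarrow> mconf \<Rightarrow> mconf \<Rightarrow> bool" for k p x where
  mstepI: "mtrans k p q (inp x i) (t j) q' b' di dj \<Longrightarrow> q \<in> mstates k p \<Longrightarrow> q' \<in> mstates k p \<Longrightarrow>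
     int i' = int i + di \<Longrightarrow> i' \<le> length x + 1 \<Longrightarrow> int j' = int j + dj \<Longrightarrow>
     mstep k p x (q, i, t, j) (q', i', t(j := b'), j')"

definition emb :: "mconf \<Rightarrow> conf" where
  "emb = (\<lambda>(q, i, t, j). (to_nat q, i, t, j))"

lemma mstep_imp_step: "mstep k p x c c' \<Longrightarrow> step (machine k p) x (emb c) (emb c')"
proof (induction rule: mstep.induct)
  case (mstepI q i t j q' b' di dj i' j')
  have "nat (int i + di) = i'" "nat (int j + dj) = j'" using mstepI by auto
  moreover have "(to_nat q, inp x i, t j, to_nat q', b', di, dj) \<in> delta (machine k p)"
    using mstepI by (auto simp: machine_def)
  ultimately show ?case
    unfolding step_def emb_def using mstepI
    by (intro exI[of _ "to_nat q"] exI[of _ i] exI[of _ t] exI[of _ j] exI[of _ "to_nat q'"] exI[of _ b'] exI[of _ di] exI[of _ dj]) simp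
qed

lemma step_imp_mstep:
  assumes "step (machine k p) x (emb c) d"
  shows "\<exists>c'. d = emb c' \<and> mstep k p x c c'"
proof -
  obtain q i t j where c: "c = (q, i, t, j)" by (cases c)
  from assms obtain q' b' di dj where
    *: "(to_nat q, inp x i, t j, q', b', di, dj) \<in> delta (machine k p)" and
    b: "0 \<le> int i + di" "int i + di \<le> int (length x) + 1" "0 \<le> int j + dj" and
    d: "d = (q', nat (int i + di), t(j := b'), nat (int j + dj))"
    unfolding step_def emb_def c by auto
  from * obtain u u' where u: "q = u" "q' = to_nat u'" "u \<in> mstates k p" "u' \<in> mstates k p"
      "mtrans k p u (inp x i) (t j) u' b' di dj"
    by (auto simp: machine_def)
  have "mstep k p x c (u', nat (int i + di), t(j := b'), nat (int j + dj))"
    unfolding c u(1) using u b by (intro mstep.intros) auto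
  then show ?thesis unfolding d u(2) emb_def by auto
qed

lemma steps_imp_msteps:
  assumes "(step (machine k p) x)\<^sup>*\<^sup>* (emb c) d"
  shows "\<exists>c'. d = emb c' \<and> (mstep k p x)\<^sup>*\<^sup>* c c'"
  using assms
proof (induction rule: rtranclp_induct)
  case base
  show ?case by (rule exI[of _ c]) simp
next
  case (step y z)
  then show ?case by (metis step_imp_mstep rtranclp.rtrancl_into_rtrancl)
qed

lemma msteps_imp_steps: "(mstep k p x)\<^sup>*\<^sup>* c d \<Longrightarrow> (step (machine k p) x)\<^sup>*\<^sup>* (emb c) (emb d)"
  by (induction rule: rtranclp_induct) (auto intro: mstep_imp_step rtranclp.rtrancl_into_rtrancl)

definition minit :: mconf where
  "minit = (Start, 0, \<lambda>_. 0, 0)"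

lemma reachable_machine_iff:
  "reachable (machine k p) x d \<longleftrightarrow> (\<exists>c. d = emb c \<and> (mstep k p x)\<^sup>*\<^sup>* minit c)"
proof -
  have "init_conf (machine k p) = emb minit" by (simp add: init_conf_def minit_def emb_def machine_def)
  then show ?thesis unfolding reachable_def by (metis steps_imp_msteps msteps_imp_steps)
qed

text \<open>The register contents at the end of the counting phase, which stops with the input head
  on the right end marker; \<open>run\<close> starts there.\<close>

definition env0 :: "nat \<Rightarrow> env" where
  "env0 c = (\<lambda>_. 0)(1 := c)"

definition run :: "prog \<Rightarrow> sym list \<Rightarrow> prog list \<times> nat \<times> env \<Rightarrow> bool" where
  "run p x c \<longleftrightarrow> (sstep x)\<^sup>*\<^sup>* ([p], length x + 1, env0 (length x + 1)) c"

abbreviation width :: "sym list \<Rightarrow> nat" where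
  "width x \<equiv> floorlog 2 (length x + 1)"

text \<open>Sweeps change one column at a time, so at each moment the tape represents some register
  contents; during an increment of \<open>c\<close>, with \<open>e\<close> trailing ones cleared, it is \<open>c + 1 - 2 ^ e\<close>.\<close>

fun minv :: "nat \<Rightarrow> prog \<Rightarrow> sym list \<Rightarrow> mconf \<Rightarrow> bool" where
  "minv k p x (Start, i, t, j) \<longleftrightarrow> i = 0 \<and> j = 0 \<and> t = (\<lambda>_. 0)"
| "minv k p x (Count, i, t, j) \<longleftrightarrow> (\<exists>c e. i = Suc c \<and> c \<le> length x \<and> j = Suc e \<and> e \<le> floorlog 2 c \<and>
     c mod 2 ^ e = 2 ^ e - 1 \<and> t = tape k (floorlog 2 c) (env0 (Suc c - 2 ^ e)))"
| "minv k p x (Return, i, t, j) \<longleftrightarrow> 1 \<le> i \<and> i \<le> length x + 1 \<and> j \<le> floorlog 2 i \<and> t = tape k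
    (floorlog 2 i) (env0 i)"
| "minv k p x (Main l, i, t, j) \<longleftrightarrow> j = 0 \<and> i \<le> length x + 1 \<and> (\<exists>\<rho>. run p x (l, i, \<rho>) \<and>
    (\<forall>r. \<rho> r < cap x) \<and> t = tape k (width x) \<rho>)"
| "minv k p x (GuessSweep r l, i, t, j) \<longleftrightarrow> r < k \<and> 0 < j \<and> j \<le> width x + 1 \<and> i \<le> length x + 1 \<and>
     (\<exists>\<rho> a. run p x (Act (Guess r) # l, i, \<rho>) \<and> (\<forall>r. \<rho> r < cap x) \<and> a < cap x \<and> t = tape k
         (width x) (\<rho>(r := a)))"
| "minv k p x (TestSweep r s c l, i, t, j) \<longleftrightarrow> r < k \<and> s < k \<and> (\<exists>e. j = Suc e \<and> e \<le> width x \<and>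
    i \<le> length x + 1 \<and>
     (\<exists>\<rho> c0. run p x (Act (Test r s c0) # l, i, \<rho>) \<and> (\<forall>r. \<rho> r < cap x) \<and> t = tape k (width x) \<rho> \<and>
       \<rho> r mod 2 ^ e + of_bool c * 2 ^ e = \<rho> s mod 2 ^ e + of_bool c0))"
| "minv k p x (Rewind l, i, t, j) \<longleftrightarrow> j \<le> width x \<and> i \<le> length x + 1 \<and> (\<exists>\<rho>. run p x (l, i, \<rho>) \<and>
    (\<forall>r. \<rho> r < cap x) \<and> t = tape k (width x) \<rho>)"

section \<open>Soundness: the invariant holds in every reachable configuration\<close>

lemma mod_Suc_exp_bit: "(a :: nat) mod 2 ^ Suc e = a mod 2 ^ e + of_bool (bit a e) * 2 ^ e"
  using take_bit_Suc_from_most[of e a] by (simp add: take_bit_eq_mod)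


lemma floorlog2_le_iff: "floorlog 2 c \<le> m \<longleftrightarrow> c < 2 ^ m"
  by (cases "c = 0") (auto simp: floorlog_le_iff)

lemma less_exp_floorlog: "c < 2 ^ floorlog 2 c"
  using floorlog2_le_iff[of c "floorlog 2 c"] by simp

lemma inp_Some_imp: "inp x i = Some a \<Longrightarrow> 1 \<le> i \<and> i \<le> length x"
  by (auto simp: inp_def split: if_splits)

lemma inp_None_imp: "inp x i = None \<Longrightarrow> i = 0 \<or> length x < i"
  by (auto simp: inp_def split: if_splits)

text \<open>The \<open>e\<close> low digits of \<open>c\<close> are ones, so
  \<open>Suc c - 2 ^ e\<close> is \<open>c\<close> with these digits cleared, and the digits from
  \<open>e\<close> on are untouched.\<close>

lemma low_ones:
  assumes "c mod 2 ^ e = 2 ^ e - (1 :: nat)"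
  shows "2 ^ e \<le> Suc c" "bit (Suc c - 2 ^ e) e \<longleftrightarrow> bit c e"
proof -
  have *: "Suc c = 2 ^ e * (c div 2 ^ e) + 2 ^ e"
    using assms mult_div_mod_eq[of "2 ^ e" c] by (metis Suc_pred add_Suc_right zero_less_numeral zero_less_power One_nat_def)
  then show "2 ^ e \<le> Suc c" by linarith
  from * have "Suc c - 2 ^ e = 2 ^ e * (c div 2 ^ e)" by linarith
  then show "bit (Suc c - 2 ^ e) e \<longleftrightarrow> bit c e"
    by (simp add: bit_iff_odd)
qed

lemma put_bit_True: "\<not> bit y e \<Longrightarrow> put_bit True e y = y + 2 ^ e"
  by (simp add: put_bit_def set_bit_eq)

lemma put_bit_False:
  assumes "bit y e"
  shows "put_bit False e y = y - 2 ^ e"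
proof -
  have "set_bit e (unset_bit e y) = y"
    using assms by (intro bit_eqI) (auto simp: bit_set_bit_iff bit_unset_bit_iff)
  then have "unset_bit e y + 2 ^ e = y"
    using set_bit_eq[of e "unset_bit e y"] by (simp add: bit_unset_bit_iff)
  then show ?thesis unfolding put_bit_def by simp
qed

lemma env0_0: "env0 0 = (\<lambda>_. 0)"
  by (auto simp: env0_def)

lemma env0_upd: "(env0 a)(1 := b) = env0 b"
  by (simp add: env0_def)

lemma env0_bits: "1 < k \<Longrightarrow> {r. r < k \<and> bit (env0 a r) j} = (if bit a j then {1} else {})"
  by (auto simp: env0_def)

lemma minv_inc1:
  assumes "2 \<le> k" "minv k p x (Count, i, t, j)" "t j = col {1}"
  shows "minv k p x (Count, i, t(j := col {}), Suc j)"
proof -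
  from assms(2) obtain c e where *: "i = Suc c" "c \<le> length x" "j = Suc e" "e \<le> floorlog 2 c"
    "c mod 2 ^ e = 2 ^ e - 1" "t = tape k (floorlog 2 c) (env0 (Suc c - 2 ^ e))" by auto
  let ?m = "floorlog 2 c" and ?y = "Suc c - 2 ^ e"
  have "tape k ?m (env0 ?y) (Suc e) = col {1}" using assms(3) * by simp
  with assms(1) have e: "e < ?m" "{1} = {r. r < k \<and> bit (env0 ?y r) e}"
    using tape_col_cases[of k ?m "env0 ?y" "Suc e" "{1}"] by auto
  with env0_bits[of k ?y e] assms(1) have b: "bit ?y e" by (auto split: if_splits)
  have "(tape k ?m (env0 ?y))(Suc e := col {}) = tape k ?m ((env0 ?y)(1 := put_bit False e (env0 ?y 1)))"
    using tape_put_bit[of e ?m 1 k "{}" "env0 ?y"] e assms(1) by auto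
  also have "env0 ?y 1 = ?y" by (simp add: env0_def)
  also have "put_bit False e ?y = Suc c - 2 ^ Suc e" using b by (simp add: put_bit_False)
  finally have t: "(tape k ?m (env0 ?y))(Suc e := col {}) = tape k ?m (env0 (Suc c - 2 ^ Suc e))"
    by (simp only: env0_upd)
  have "c mod 2 ^ Suc e = 2 ^ Suc e - 1"
    using *(5) b low_ones[OF *(5)] by (simp only: mod_Suc_exp_bit) simp
  with t e * show ?thesis by auto
qed

lemma minv_inc0:
  assumes "2 \<le> k" "minv k p x (Count, i, t, Suc j)" "t (Suc j) = 0 \<or> t (Suc j) = col {}"
  shows "minv k p x (Return, i, t(Suc j := col {1}), j)"
proof -
  from assms(2) obtain c where *: "i = Suc c" "c \<le> length x" "j \<le> floorlog 2 c"
    "c mod 2 ^ j = 2 ^ j - 1" "t = tape k (floorlog 2 c) (env0 (Suc c - 2 ^ j))" by auto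
  let ?m = "floorlog 2 c" and ?y = "Suc c - 2 ^ j"
  have "j \<le> floorlog 2 (Suc c) \<and> t(Suc j := col {1}) = tape k (floorlog 2 (Suc c)) (env0 (Suc c))"
    using assms(3)
  proof
    \<comment> \<open>The carry ran off the end: all \<open>?m\<close> digits of \<open>c\<close>
      are ones, so \<open>Suc c\<close> is \<open>2 ^ ?m\<close>. The tape grows by one column
      exactly when \<open>floorlog 2\<close> of the counter does.\<close>
    assume "t (Suc j) = 0"
    then have j: "j = ?m" using * by (simp add: tape_0_cases)
    then have c: "Suc c = 2 ^ ?m" using *(4) less_exp_floorlog[of c] by simp
    have m: "floorlog 2 (Suc c) = Suc ?m"
    proof -
      have "floorlog 2 (Suc c) \<le> Suc ?m" "\<not> floorlog 2 (Suc c) \<le> ?m"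
        unfolding floorlog2_le_iff using c by auto
      then show ?thesis by simp
    qed
    have "bit (Suc c) i \<longleftrightarrow> i = ?m" for i unfolding c by (simp add: bit_exp_iff)
    then have "t(Suc j := col {1}) = tape k (Suc ?m) (env0 (Suc c))"
      using assms(1) env0_bits[of k "Suc c"] c unfolding * j
      by (auto simp: fun_eq_iff tape_def env0_0)
    with m j show ?thesis by simp
  next
    assume "t (Suc j) = col {}"
    then have j: "j < ?m" "{} = {r. r < k \<and> bit (env0 ?y r) j}"
      using tape_col_cases[of k ?m "env0 ?y" "Suc j" "{}"] * by auto
    with env0_bits[of k ?y j] assms(1) have b: "\<not> bit ?y j" by (auto split: if_splits)
    have "0 < (2 :: nat) ^ j" by simp
    then have "?y \<le> c" by linarith
    then have "?y < 2 ^ ?m" using less_exp_floorlog[of c] by (rule le_less_trans)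
    then have "put_bit True j ?y < 2 ^ ?m" using j by (intro put_bit_less)
    moreover have y: "put_bit True j ?y = Suc c" using low_ones(1)[OF *(4)] b by (simp add: put_bit_True)
    ultimately have "Suc c < 2 ^ ?m" by simp
    then have m: "floorlog 2 (Suc c) = ?m"
      using floorlog2_le_iff[of "Suc c" ?m] floorlog_mono[of c "Suc c" 2] by simp
    have "(tape k ?m (env0 ?y))(Suc j := col {1}) = tape k ?m ((env0 ?y)(1 := put_bit True j
        (env0 ?y 1)))"
      using tape_put_bit[of j ?m 1 k "{1}" "env0 ?y"] j assms(1) by auto
    also have "env0 ?y 1 = ?y" by (simp add: env0_def)
    finally have "(tape k ?m (env0 ?y))(Suc j := col {1}) = tape k ?m (env0 (Suc c))"
      by (simp only: env0_upd y)
    then show ?thesis unfolding m *(5) using j by (intro conjI) auto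
  qed
  with * show ?thesis by auto
qed


lemma run_step: "run p x c \<Longrightarrow> sstep x c c' \<Longrightarrow> run p x c'"
  unfolding run_def by (rule rtranclp.rtrancl_into_rtrancl)

lemma width_mono: "i \<le> length x + 1 \<Longrightarrow> floorlog 2 i \<le> width x"
  by (rule floorlog_mono)

lemma mod_cap: "a < cap x \<Longrightarrow> a mod 2 ^ width x = a"
  by (simp add: cap_def)

text \<open>During the sweep the program still stands before \<open>Guess r\<close> with its old
  \<open>\<rho>\<close>, while track \<open>r\<close> shows some \<open>a\<close>. Each intermediate
  content of the track is itself a legal guess, so no record of the progress is kept.\<close>

lemma minv_gcol:
  assumes "minv k p x (GuessSweep r l, i, t, j)" "t j = col S" "S \<subseteq> {..<k}" "S' \<subseteq> {..<k}" "S' - {r}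
      = S - {r}"
  shows "minv k p x (GuessSweep r l, i, t(j := col S'), Suc j)"
proof -
  from assms(1) obtain \<rho> a where *: "r < k" "0 < j" "i \<le> length x + 1"
     "run p x (Act (Guess r) # l, i, \<rho>)" "\<forall>r. \<rho> r < cap x" "a < cap x" "t = tape k (width x) (\<rho>(r := a))"
    by auto
  then obtain e where j: "j = Suc e" by (cases j) auto
  from assms(2) * j tape_col_cases[OF _ assms(3), of "width x" "\<rho>(r := a)" j]
  have S: "e < width x" "S = {s. s < k \<and> bit ((\<rho>(r := a)) s) e}" by auto
  have "t(j := col S') = tape k (width x) ((\<rho>(r := a))(r := put_bit (r \<in> S') e a))"
    using tape_put_bit[of e "width x" r k S' "\<rho>(r := a)"] S * j assms by (simp del: fun_upd_upd)
  also have "(\<rho>(r := a))(r := put_bit (r \<in> S') e a) = \<rho>(r := put_bit (r \<in> S') e a)" by simp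
  finally have "t(j := col S') = tape k (width x) (\<rho>(r := put_bit (r \<in> S') e a))" .
  moreover have "put_bit (r \<in> S') e a < cap x"
    using put_bit_less[of a "width x" e "r \<in> S'"] *(6) S(1) by (simp add: cap_def)
  ultimately show ?thesis using * S j by (simp only: minv.simps) (intro conjI exI[of _ \<rho>] exI, auto)
qed

text \<open>Written addition: the \<open>e\<close> low digits of \<open>s\<close> plus
  \<open>c0\<close> give the \<open>e\<close> low digits of \<open>r\<close> plus a carry of weight
  \<open>2 ^ e\<close>. The condition on \<open>S\<close> preserves this identity when
  \<open>e\<close> grows by one.\<close>

lemma minv_tcol:
  assumes "minv k p x (TestSweep r s c l, i, t, j)" "t j = col S" "S \<subseteq> {..<k}" "r \<in> S \<longleftrightarrow> (s \<in> S \<longleftrightarrow> \<not> c)"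
  shows "minv k p x (TestSweep r s (c \<and> s \<in> S) l, i, t, Suc j)"
proof -
  from assms(1) obtain e \<rho> c0 where *: "r < k" "s < k" "j = Suc e" "i \<le> length x + 1"
     "run p x (Act (Test r s c0) # l, i, \<rho>)" "\<forall>r. \<rho> r < cap x" "t = tape k (width x) \<rho>"
     "\<rho> r mod 2 ^ e + of_bool c * 2 ^ e = \<rho> s mod 2 ^ e + of_bool c0"
    by auto
  from assms(2) * tape_col_cases[OF _ assms(3), of "width x" \<rho> j]
  have S: "e < width x" "S = {s. s < k \<and> bit (\<rho> s) e}" by auto
  with * assms(4) have b: "bit (\<rho> r) e \<longleftrightarrow> (bit (\<rho> s) e \<longleftrightarrow> \<not> c)" "s \<in> S \<longleftrightarrow> bit (\<rho> s) e" by auto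
  have "\<rho> r mod 2 ^ Suc e + of_bool (c \<and> s \<in> S) * 2 ^ Suc e = \<rho> s mod 2 ^ Suc e + of_bool c0"
    using *(8) b unfolding mod_Suc_exp_bit by (auto split: if_splits)
  with * S(1) show ?thesis
    by (simp only: minv.simps) (intro conjI exI[of _ \<rho>] exI[of _ c0] exI[of _ j] impI, auto)
qed

lemma minv_mstep:
  assumes "2 \<le> k" "mstep k p x (q, i, t, j) (q', i', t', j')" "minv k p x (q, i, t, j)"
  shows "minv k p x (q', i', t', j')"
  using assms(2)
proof cases
  case (mstepI b' di dj)
  note I = this
  from I(2) show ?thesis
  proof cases
    case ini
    then show ?thesis using I assms(3) by (auto simp: tape_def env0_0 floorlog_def fun_eq_iff)
  next
    case inc1
    then have "i' = i" "j' = Suc j" using I by auto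
    with inc1 show ?thesis using I(1) assms(1,3) minv_inc1[of k p x i t j] by (simp only:)
  next
    case inc0
    then show ?thesis using I assms minv_inc0[of k p x i t j'] by auto
  next
    case (ret S)
    then show ?thesis using I assms(3) by (auto simp: fun_upd_idem)
  next
    case ret_more
    have "i \<le> length x" using ret_more inp_Some_imp[of x i] by auto
    have j: "j = 0" "1 \<le> i" "t = tape k (floorlog 2 i) (env0 i)"
      using assms(3) ret_more by (auto simp: tape_1_cases)
    then have "t' = t" "i' = Suc i" "j' = Suc 0" using I ret_more by (auto simp: fun_upd_idem)
    then show ?thesis using \<open>i \<le> length x\<close> j unfolding ret_more(4) by simp
  next
    case ret_done
    \<comment> \<open>Both end markers read as \<open>None\<close>; the invariant of
      \<open>Return\<close> has \<open>1 \<le> i\<close>, which leaves only the right one.\<close>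
    then have "i = length x + 1" using I assms(3) inp_None_imp[of x i] by auto
    moreover have "j = 0" "t = tape k (floorlog 2 i) (env0 i)"
      using assms(3) ret_done by (auto simp: tape_1_cases)
    moreover from this have "t' = t" "i' = i" "j' = 0" using I ret_done by (auto simp: fun_upd_idem)
    moreover have "env0 (length x + 1) r < cap x" for r
      using less_exp_floorlog[of "length x + 1"] by (auto simp: env0_def cap_def)
    ultimately show ?thesis unfolding ret_done(4) minv.simps
      by (intro conjI exI[of _ "env0 (length x + 1)"]) (auto simp: run_def)
  next
    case (ctl l l')
    then show ?thesis using I assms(3) by (fastforce intro: run_step sstep_ctl)
  next
    case (movel l)
    then show ?thesis using I assms(3) by (fastforce intro: run_step sstep_act)
  next
    case (mover l)
    then show ?thesis using I assms(3) by (fastforce intro: run_step sstep_act)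
  next
    case (sym l)
    then show ?thesis using I assms(3) by (fastforce intro: run_step sstep_act)
  next
    case (guess r l)
    then have "r < k" using I by auto
    have "i' = i" "j' = Suc j" using guess I by auto
    moreover obtain \<rho> where "j = 0" "i \<le> length x + 1" "run p x (Act (Guess r) # l, i, \<rho>)"
      "\<forall>r. \<rho> r < cap x" "t = tape k (width x) \<rho>"
      using assms(3) guess by auto
    moreover from this have "t' = tape k (width x) (\<rho>(r := \<rho> r))"
      using I guess by (simp add: fun_upd_idem)
    ultimately show ?thesis using \<open>r < k\<close> unfolding guess(3) minv.simps
      by (intro conjI exI[of _ \<rho>] exI[of _ "\<rho> r"]) auto
  next
    case (gcol S S' r l)
    then have "i' = i" "j' = Suc j" using I by auto
    with gcol show ?thesis using I(1) assms(3) minv_gcol[of k p x r l i t j S S'] by (simp only:)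
  next
    case (gend r l)
    obtain \<rho> a where *: "r < k" "0 < j" "j \<le> width x + 1" "i \<le> length x + 1"
     "run p x (Act (Guess r) # l, i, \<rho>)" "\<forall>r. \<rho> r < cap x" "a < cap x" "t = tape k (width x) (\<rho>(r := a))"
      using assms(3) gend by auto
    then have "width x < j" using gend(2) by (simp add: tape_0_cases)
    moreover have "run p x (l, i, \<rho>(r := a))"
      using run_step[OF *(5) sstep_act[of x "Guess r" _ "(i, \<rho>(r := a))"]] *(7) by auto
    moreover have "t' = t" using I(1) gend by (simp add: fun_upd_idem)
    ultimately show ?thesis using * I gend unfolding gend(3) minv.simps
      by (intro conjI exI[of _ "\<rho>(r := a)"]) auto
  next
    case (test r s c l)
    then have "r < k" "s < k" using I by auto
    moreover have "i' = i" "j' = Suc j" using test I by auto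
    moreover obtain \<rho> where "j = 0" "i \<le> length x + 1" "run p x (Act (Test r s c) # l, i, \<rho>)"
      "\<forall>r. \<rho> r < cap x" "t = tape k (width x) \<rho>"
      using assms(3) test by auto
    moreover from this have "t' = tape k (width x) \<rho>" using I test by (simp add: fun_upd_idem)
    ultimately show ?thesis unfolding test(3) minv.simps
      by (intro conjI exI[of _ \<rho>] exI[of _ 0] exI[of _ c]) auto
  next
    case (tcol S r s c l)
    then have "i' = i" "j' = Suc j" "t' = t" using I by (auto simp: fun_upd_idem)
    with tcol show ?thesis using assms(3) minv_tcol[of k p x r s c l i t j S] by (simp only:)
  next
    case (tend r s l)
    obtain e \<rho> c0 where *: "j = Suc e" "e \<le> width x" "i \<le> length x + 1"
      "run p x (Act (Test r s c0) # l, i, \<rho>)" "\<forall>r. \<rho> r < cap x" "t = tape k (width x) \<rho>"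
      "\<rho> r mod 2 ^ e = \<rho> s mod 2 ^ e + of_bool c0"
      using assms(3) tend by auto
    then have "e = width x" using tend(2) by (simp add: tape_0_cases)
    \<comment> \<open>All digits have been compared and no carry is left. As the registers lie below
      \<open>cap x\<close>, the agreement modulo \<open>2 ^ width x\<close> is equality of the
      numbers.\<close>
    have "\<rho> r mod 2 ^ width x = \<rho> r" "\<rho> s mod 2 ^ width x = \<rho> s"
      using * by (simp_all add: mod_cap del: One_nat_def add_Suc_right Nat.add_0_right)
    with * \<open>e = width x\<close> have "\<rho> r = \<rho> s + of_bool c0" by simp
    then have "run p x (l, i, \<rho>)"
      using run_step[OF *(4) sstep_act[of x "Test r s c0" _ "(i, \<rho>)"]] by auto
    moreover have "t' = t" using I(1) tend by (simp add: fun_upd_idem)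
    ultimately show ?thesis using * I tend unfolding tend(3) minv.simps
      by (intro conjI exI[of _ "\<rho>"]) auto
  next
    case (bcol S l)
    then show ?thesis using I assms(3) by (auto simp: fun_upd_idem)
  next
    case (bend l)
    then have "t' = t" using I(1) by (simp add: fun_upd_idem)
    with bend show ?thesis using I assms(3) by (auto simp: tape_1_cases)
  qed
qed


lemma minv_reachable:
  assumes "2 \<le> k" "(mstep k p x)\<^sup>*\<^sup>* minit c"
  shows "minv k p x c"
  using assms(2)
proof (induction rule: rtranclp_induct)
  case base
  show ?case by (simp add: minit_def)
next
  case (step y z)
  then show ?case using minv_mstep[OF assms(1)] by (cases y, cases z) blast
qed

lemma width_le: "width x \<le> floorlog 2 (length x) + 1"
proof -
  have "length x < 2 ^ floorlog 2 (length x)" by (rule less_exp_floorlog)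
  then show ?thesis unfolding floorlog2_le_iff power_add by simp
qed

text \<open>The extra 1 is the blank cell just behind the digits, where sweeps turn round and where
  the counter may overflow.\<close>

lemma minv_head:
  assumes "minv k p x (q, i, t, j)"
  shows "j \<le> width x + 1"
proof (cases q)
  case Count
  with assms obtain c where "c \<le> length x" "j \<le> Suc (floorlog 2 c)" by auto
  with width_mono[of c x] show ?thesis by auto
next
  case Return
  with assms width_mono[of i x] show ?thesis by auto
qed (use assms in auto)

lemma logspace_machine:
  assumes "2 \<le> k"
  shows "logspace (machine k p)"
  unfolding logspace_def
\<comment> \<open>The head stays within \<open>width x + 1\<close>, which is at most
  \<open>floorlog 2 (length x) + 2\<close>; doubling \<open>floorlog 2 (length x) + 1\<close> covers
  this also when the logarithm is 0.\<close>
proof (intro exI[of _ 2] allI impI)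
  fix x q i t j
  assume "reachable (machine k p) x (q, i, t, j)"
  then obtain q' where "(mstep k p x)\<^sup>*\<^sup>* minit (q', i, t, j)"
    unfolding reachable_machine_iff emb_def by auto
  from minv_head[OF minv_reachable[OF assms this]] width_le[of x]
  show "j \<le> 2 * (floorlog 2 (length x) + 1)" by simp
qed

section \<open>Completeness: the machine can follow every run of the program\<close>

lemma mstepI':
  assumes "mtrans k p q (inp x i) b q' b' di dj" "t j = b" "q \<in> mstates k p" "q' \<in> mstates k p"
     "int i' = int i + di" "i' \<le> length x + 1" "int j' = int j + dj" "t' = t(j := b')"
  shows "mstep k p x (q, i, t, j) (q', i', t', j')"
  using assms mstepI by blast

lemma labels_basic [simp]: "[p] \<in> labels p" "[] \<in> labels p"
  by (auto simp: labels_def conts_self)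

lemma bits_subset: "{r. r < k \<and> P r} \<subseteq> {..<k}"
  by auto

text \<open>The invariant keeps the head within \<open>width x + 1\<close>, so a carry that moves
  right at each step must meet a zero digit or the blank.\<close>

lemma inc_reach:
  assumes "2 \<le> k" "minv k p x (Count, i, t, j)"
  shows "\<exists>t' j'. (mstep k p x)\<^sup>*\<^sup>* (Count, i, t, j) (Return, i, t', j')"
  using assms(2)
proof (induction "width x + 1 - j" arbitrary: j t rule: less_induct)
  case less
  from less.prems obtain c e where *: "i = Suc c" "c \<le> length x" "j = Suc e" "e \<le> floorlog 2 c"
    "c mod 2 ^ e = 2 ^ e - 1" "t = tape k (floorlog 2 c) (env0 (Suc c - 2 ^ e))" by auto
  have i: "i \<le> length x + 1" using * by simp
  show ?case
  proof (cases "t j = col {1}")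
    case True
    have "mstep k p x (Count, i, t, j) (Count, i, t(j := col {}), Suc j)"
      using True i by (intro mstepI'[OF mtrans.inc1]) (auto simp del: fun_upd_apply)
    moreover from minv_inc1[OF assms(1) less.prems True]
    have inv: "minv k p x (Count, i, t(j := col {}), Suc j)" .
    moreover from minv_head[OF inv] have "width x + 1 - Suc j < width x + 1 - j" by simp
    ultimately show ?thesis using less.hyps[of "Suc j" "t(j := col {})"]
      by (meson converse_rtranclp_into_rtranclp)
  next
    case False
    have "t j = 0 \<or> t j = col {}"
      using False env0_bits[of k "Suc c - 2 ^ e" e] assms(1) unfolding * tape_def
      by (auto split: if_splits)
    then have "mstep k p x (Count, i, t, j) (Return, i, t(j := col {1}), e)"
      using * i by (intro mstepI'[OF mtrans.inc0]) (auto simp del: fun_upd_apply)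
    then show ?thesis by blast
  qed
qed

lemma ret_reach:
  assumes "j \<le> m" "i \<le> length x + 1"
  shows "(mstep k p x)\<^sup>*\<^sup>* (Return, i, tape k m \<rho>, j) (Return, i, tape k m \<rho>, 0)"
  using assms(1)
proof (induction j)
  case (Suc j)
  have "mstep k p x (Return, i, tape k m \<rho>, Suc j) (Return, i, tape k m \<rho>, j)"
    using Suc.prems assms(2)
    by (intro mstepI'[OF mtrans.ret[OF bits_subset, of _ _ _ "\<lambda>r. bit (\<rho> r) j"]])
       (auto simp: tape_Suc fun_upd_idem)
  with Suc show ?case by (meson converse_rtranclp_into_rtranclp Suc_leD)
qed auto

lemma back_reach:
  assumes "j \<le> m" "i \<le> length x + 1" "l \<in> labels p"
  shows "(mstep k p x)\<^sup>*\<^sup>* (Rewind l, i, tape k m \<rho>, j) (Main l, i, tape k m \<rho>, 0)"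
  using assms(1)
proof (induction j)
  case 0
  have "mstep k p x (Rewind l, i, tape k m \<rho>, 0) (Main l, i, tape k m \<rho>, 0)"
    using assms(2,3) by (intro mstepI'[OF mtrans.bend]) (auto simp: fun_upd_idem)
  then show ?case by blast
next
  case (Suc j)
  have "mstep k p x (Rewind l, i, tape k m \<rho>, Suc j) (Rewind l, i, tape k m \<rho>, j)"
    using Suc.prems assms(2,3)
    by (intro mstepI'[OF mtrans.bcol[OF bits_subset, of _ _ _ _ "\<lambda>r. bit (\<rho> r) j"]])
       (auto simp: tape_Suc fun_upd_idem)
  with Suc show ?case by (meson converse_rtranclp_into_rtranclp Suc_leD)
qed


text \<open>Cancelling the low digits leaves \<open>a div 2 ^ e = b div 2 ^ e + of_bool c\<close>;
  the claim is the parity of both sides.\<close>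

lemma carry_bit:
  assumes "a = b + c0" "a mod 2 ^ e + of_bool c * 2 ^ e = b mod 2 ^ e + (c0 :: nat)"
  shows "bit a e \<longleftrightarrow> (bit b e \<longleftrightarrow> \<not> c)"
proof -
  have "2 ^ e * (a div 2 ^ e) + a mod 2 ^ e = 2 ^ e * (b div 2 ^ e) + b mod 2 ^ e + c0"
    using assms(1) by simp
  with assms(2) have "2 ^ e * (a div 2 ^ e) = 2 ^ e * (b div 2 ^ e + of_bool c)"
    unfolding distrib_left by (simp only: mult.commute[of "2 ^ e" "of_bool c"])
  then have "a div 2 ^ e = b div 2 ^ e + of_bool c" by simp
  then show ?thesis by (simp add: bit_iff_odd)
qed

lemma test_reach:
  assumes "r < k" "s < k" "l \<in> labels p" "i \<le> length x + 1" "\<forall>r. \<rho> r < cap x" "\<rho> r = \<rho> s + of_bool c0"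
    "e \<le> width x" "\<rho> r mod 2 ^ e + of_bool c * 2 ^ e = \<rho> s mod 2 ^ e + of_bool c0"
  shows "(mstep k p x)\<^sup>*\<^sup>* (TestSweep r s c l, i, tape k (width x) \<rho>, Suc e) (Rewind l, i, tape k
      (width x) \<rho>, width x)"
  using assms(7,8)
proof (induction e arbitrary: c rule: inc_induct)
  case base
  have "\<rho> r mod 2 ^ width x = \<rho> r" "\<rho> s mod 2 ^ width x = \<rho> s"
    using assms(5) by (simp_all add: mod_cap del: One_nat_def add_Suc_right Nat.add_0_right)
  with base.prems assms(6) have "\<not> c" by (cases c) simp_all
  then have "mstep k p x (TestSweep r s c l, i, tape k (width x) \<rho>, Suc (width x))
      (Rewind l, i, tape k (width x) \<rho>, width x)"
    using assms by simp (intro mstepI'[OF mtrans.tend], auto simp: tape_def)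
  then show ?case by blast
next
  case (step e)
  let ?S = "{r. r < k \<and> bit (\<rho> r) e}" and ?c = "c \<and> bit (\<rho> s) e"
  have b: "bit (\<rho> r) e \<longleftrightarrow> (bit (\<rho> s) e \<longleftrightarrow> \<not> c)" using carry_bit[OF assms(6) step.prems] .
  have "mtrans k p (TestSweep r s c l) (inp x i) (col ?S) (TestSweep r s (c \<and> s \<in> ?S) l) (col ?S) 0 1"
    using b assms(1,2) by (intro mtrans.tcol) auto
  then have "mtrans k p (TestSweep r s c l) (inp x i) (col ?S) (TestSweep r s ?c l) (col ?S) 0 1"
    using assms(2) by simp
  then have "mstep k p x (TestSweep r s c l, i, tape k (width x) \<rho>, Suc e)
      (TestSweep r s ?c l, i, tape k (width x) \<rho>, Suc (Suc e))"
    by (rule mstepI') (use step.hyps assms in \<open>auto simp: tape_Suc fun_upd_idem\<close>)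
  moreover have "\<rho> r mod 2 ^ Suc e + of_bool ?c * 2 ^ Suc e = \<rho> s mod 2 ^ Suc e + of_bool c0"
    using step.prems b unfolding mod_Suc_exp_bit by (auto split: if_splits)
  ultimately show ?case using step.IH by (meson converse_rtranclp_into_rtranclp)
qed

text \<open>\<open>y\<close> is the register in mid-sweep: below digit \<open>e\<close> it already
  shows the target \<open>a\<close>, above it still the old digits, which are overwritten one at a
  time.\<close>

lemma guess_reach:
  assumes "r < k" "l \<in> labels p" "i \<le> length x + 1" "a < cap x"
    "e \<le> width x" "y < cap x" "\<forall>j<e. bit y j = bit a j"
  shows "(mstep k p x)\<^sup>*\<^sup>* (GuessSweep r l, i, tape k (width x) (\<rho>(r := y)), Suc e)
      (Rewind l, i, tape k (width x) (\<rho>(r := a)), width x)"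
  using assms(5-7)
proof (induction e arbitrary: y rule: inc_induct)
  case base
  have "y = a"
  proof (rule bit_eqI)
    fix j show "bit y j = bit a j" using base assms(4) by (cases "j < width x") (auto
        simp: cap_def less_exp_iff_bit)
  qed
  then have "mstep k p x (GuessSweep r l, i, tape k (width x) (\<rho>(r := y)), Suc (width x))
      (Rewind l, i, tape k (width x) (\<rho>(r := a)), width x)"
    using assms by (intro mstepI'[OF mtrans.gend]) (auto simp: tape_def)
  then show ?case by blast
next
  case (step e)
  let ?t = "\<lambda>y. tape k (width x) (\<rho>(r := y))"
  define S where "S = {s. s < k \<and> bit ((\<rho>(r := y)) s) e}"
  define S' where "S' = (if bit a e then insert r S else S - {r})"
  define y' where "y' = put_bit (r \<in> S') e y"
  have sub: "S \<subseteq> {..<k}" "S' \<subseteq> {..<k}" "S' - {r} = S - {r}" "r \<in> S' \<longleftrightarrow> bit a e"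
    using assms(1) by (auto simp: S_def S'_def)
  have "(?t y)(Suc e := col S') = tape k (width x) ((\<rho>(r := y))(r := put_bit (r \<in> S') e
      ((\<rho>(r := y)) r)))"
    using tape_put_bit[OF step.hyps(2) assms(1) sub(2), of "\<rho>(r := y)"] sub(3) unfolding S_def by blast
  also have "(\<rho>(r := y))(r := put_bit (r \<in> S') e ((\<rho>(r := y)) r)) = \<rho>(r := y')" by (simp add: y'_def)
  finally have t: "?t y' = (?t y)(Suc e := col S')" ..
  have S: "?t y (Suc e) = col S" using step.hyps(2) by (simp only: tape_Suc S_def)
  have "mstep k p x (GuessSweep r l, i, ?t y, Suc e) (GuessSweep r l, i, ?t y', Suc (Suc e))"
    by (rule mstepI'[OF mtrans.gcol[OF sub(1-3)] S _ _ _ _ _ t]) (use assms in auto)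
  moreover have "y' < cap x"
    using put_bit_less[OF _ step.hyps(2)] step.prems(1) unfolding y'_def cap_def by blast
  moreover have "\<forall>j<Suc e. bit y' j = bit a j"
    using step.prems(2) sub(4) by (simp add: y'_def bit_put_bit less_Suc_eq)
  ultimately show ?case using step.IH[of y'] by (meson converse_rtranclp_into_rtranclp)
qed


lemma main_step_reach:
  assumes "2 \<le> k" "regs p \<subseteq> {..<k}" "l \<in> labels p" "i \<le> length x + 1" "\<forall>r. \<rho> r < cap x"
    "sstep x (l, i, \<rho>) (l', i', \<rho>')"
  shows "l' \<in> labels p \<and> i' \<le> length x + 1 \<and> (\<forall>r. \<rho>' r < cap x) \<and>
    (mstep k p x)\<^sup>*\<^sup>* (Main l, i, tape k (width x) \<rho>, 0) (Main l', i', tape k (width x) \<rho>', 0)"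
  using assms(6)
proof cases
  case sstep_ctl
  then have l': "l' \<in> labels p"
    using assms(3) conts_ctl[of l p "[]" l'] by (auto simp: labels_def elim: ctl.cases)
  have "mstep k p x (Main l, i, tape k (width x) \<rho>, 0) (Main l', i, tape k (width x) \<rho>, 0)"
    by (rule mstepI'[OF mtrans.ctl]) (use sstep_ctl l' assms in \<open>auto simp: fun_upd_idem\<close>)
  with sstep_ctl l' assms show ?thesis by auto
next
  case (sstep_act a)
  then have l': "l' \<in> labels p"
    using assms(3) conts_act[of a l' p "[]"] by (auto simp: labels_def)
  have "regs q \<subseteq> {..<k}" if "q \<in> set l" for q
    using regs_conts[of l p "[]" q] that assms(2,3) by (auto simp: labels_def)
  then have a: "act_regs a \<subseteq> {..<k}" using sstep_act(1) by fastforce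
  show ?thesis
  proof (cases a)
    case (Guess r)
    with sstep_act obtain b where b: "b < cap x" "i' = i" "\<rho>' = \<rho>(r := b)" by auto
    have 1: "mstep k p x (Main l, i, tape k (width x) \<rho>, 0) (GuessSweep r l', i, tape k
        (width x) \<rho>, Suc 0)"
      unfolding sstep_act(1) Guess
      by (rule mstepI'[OF mtrans.guess]) (use sstep_act Guess l' a assms in \<open>auto simp: fun_upd_idem\<close>)
    have 2: "(mstep k p x)\<^sup>*\<^sup>* (GuessSweep r l', i, tape k (width x) \<rho>, Suc 0)
        (Rewind l', i, tape k (width x) \<rho>', width x)"
      using guess_reach[of r k l' p i x b 0 "\<rho> r" \<rho>] Guess a l' assms b by simp
    have 3: "(mstep k p x)\<^sup>*\<^sup>* (Rewind l', i, tape k (width x) \<rho>', width x) (Main l', i, tape k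
        (width x) \<rho>', 0)"
      using l' assms by (intro back_reach) auto
    show ?thesis using rtranclp_trans[OF converse_rtranclp_into_rtranclp[OF 1 2] 3] b assms(4,5) l'
        by auto
  next
    case (Test r s c)
    with sstep_act have b: "i' = i" "\<rho>' = \<rho>" "\<rho> r = \<rho> s + of_bool c" by auto
    have 1: "mstep k p x (Main l, i, tape k (width x) \<rho>, 0) (TestSweep r s c l', i, tape k
        (width x) \<rho>, Suc 0)"
      unfolding sstep_act(1) Test
      by (rule mstepI'[OF mtrans.test]) (use sstep_act Test l' a assms in \<open>auto simp: fun_upd_idem\<close>)
    have 2: "(mstep k p x)\<^sup>*\<^sup>* (TestSweep r s c l', i, tape k (width x) \<rho>, Suc 0)
        (Rewind l', i, tape k (width x) \<rho>, width x)"
      using Test a l' assms b by (intro test_reach[where c = c and ?c0.0 = c]) auto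
    have 3: "(mstep k p x)\<^sup>*\<^sup>* (Rewind l', i, tape k (width x) \<rho>, width x) (Main l', i, tape k
        (width x) \<rho>, 0)"
      using l' assms by (intro back_reach) auto
    show ?thesis using rtranclp_trans[OF converse_rtranclp_into_rtranclp[OF 1 2] 3] b assms(4,5) l'
        by auto
  next
    case MoveL
    have "mstep k p x (Main l, i, tape k (width x) \<rho>, 0) (Main l', i', tape k (width x) \<rho>', 0)"
      unfolding sstep_act(1) MoveL
      by (rule mstepI'[OF mtrans.movel]) (use sstep_act MoveL l' assms in \<open>auto simp: fun_upd_idem\<close>)
    then show ?thesis using MoveL sstep_act assms l' by auto
  next
    case MoveR
    have "mstep k p x (Main l, i, tape k (width x) \<rho>, 0) (Main l', i', tape k (width x) \<rho>', 0)"
      unfolding sstep_act(1) MoveR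
      by (rule mstepI'[OF mtrans.mover]) (use sstep_act MoveR l' assms in \<open>auto simp: fun_upd_idem\<close>)
    then show ?thesis using MoveR sstep_act assms l' by auto
  next
    case (Sym b)
    then have b: "inp x i = b" "i' = i" "\<rho>' = \<rho>" using sstep_act by auto
    have "mstep k p x (Main l, i, tape k (width x) \<rho>, 0) (Main l', i', tape k (width x) \<rho>', 0)"
      unfolding sstep_act(1) Sym b(1)[symmetric]
      by (rule mstepI'[OF mtrans.sym]) (use sstep_act Sym l' assms b in \<open>auto simp: fun_upd_idem\<close>)
    then show ?thesis using b assms l' by auto
  qed
qed

lemma main_reach:
  assumes "2 \<le> k" "regs p \<subseteq> {..<k}" "l \<in> labels p" "i \<le> length x + 1" "\<forall>r. \<rho> r < cap x"
    "(sstep x)\<^sup>*\<^sup>* (l, i, \<rho>) (l', i', \<rho>')"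
  shows "(mstep k p x)\<^sup>*\<^sup>* (Main l, i, tape k (width x) \<rho>, 0) (Main l', i', tape k (width x) \<rho>', 0)"
  using assms(6,3-5)
proof (induction "(l, i, \<rho>)" arbitrary: l i \<rho> rule: converse_rtranclp_induct)
  case base
  show ?case by simp
next
  case (step z)
  obtain l1 i1 r1 where z: "z = (l1, i1, r1)" by (cases z)
  from main_step_reach[OF assms(1,2) step.prems step.hyps(1)[unfolded z]] step.hyps(3)[OF z]
  show ?case by (meson rtranclp_trans)
qed

text \<open>By induction on the head position: on return to cell 0 at position \<open>i\<close>,
  register 1 holds \<open>i\<close>. The loop ends at the right end marker.\<close>

lemma init_reach:
  assumes "2 \<le> k"
  shows "(mstep k p x)\<^sup>*\<^sup>* minit (Main [p], length x + 1, tape k (width x) (env0 (length x + 1)), 0)"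
proof -
  let ?R = "\<lambda>i. (Return, i, tape k (floorlog 2 i) (env0 i), 0 :: nat)"
  have inc: "(mstep k p x)\<^sup>*\<^sup>* (Count, i, t, j) (?R i)" if "minv k p x (Count, i, t, j)" for i t j
  proof -
    from inc_reach[OF assms that] obtain t' j' where r: "(mstep k p x)\<^sup>*\<^sup>* (Count, i, t, j)
        (Return, i, t', j')" by blast
    then have "minv k p x (Return, i, t', j')" using that
    proof (induction rule: rtranclp_induct)
      case (step y z)
      then show ?case using minv_mstep[OF assms] by (cases y, cases z) blast
    qed
    with r ret_reach[of j' "floorlog 2 i" i x k p "env0 i"] show ?thesis
      by (auto intro: rtranclp_trans)
  qed
  have "(mstep k p x)\<^sup>*\<^sup>* minit (?R i)" if "1 \<le> i" "i \<le> length x + 1" for i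
    using that
  proof (induction i rule: nat_induct_at_least)
    case base
    have s: "mstep k p x minit (Count, 1, (\<lambda>_. 0)(0 := 1), 1)"
      unfolding minit_def by (rule mstepI'[OF mtrans.ini]) auto
    moreover from minv_mstep[OF assms s[unfolded minit_def]]
    have "minv k p x (Count, 1, (\<lambda>_. 0)(0 := 1), 1)" by simp
    ultimately show ?case using inc by (meson converse_rtranclp_into_rtranclp)
  next
    case (Suc i)
    then have "inp x i = Some (x ! (i - 1))" by (simp add: inp_def)
    then have s: "mstep k p x (?R i) (Count, Suc i, tape k (floorlog 2 i) (env0 i), Suc 0)"
      using Suc by (intro mstepI'[OF mtrans.ret_more[of k p "x ! (i - 1)", folded \<open>inp x i = _\<close>]])
          (auto simp: fun_upd_idem)
    moreover have "minv k p x (?R i)" using Suc by simp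
    ultimately show ?case using inc[OF minv_mstep[OF assms s]] Suc
      by (meson Suc_leD rtranclp.rtrancl_into_rtrancl rtranclp_trans)
  qed
  then have "(mstep k p x)\<^sup>*\<^sup>* minit (?R (length x + 1))" by simp
  moreover have "inp x (length x + 1) = None" by (simp add: inp_def)
  then have "mstep k p x (?R (length x + 1)) (Main [p], length x + 1, tape k (width x) (env0
      (length x + 1)), 0)"
    by (intro mstepI'[OF mtrans.ret_done[of k p, folded \<open>inp x _ = _\<close>]]) (auto simp: fun_upd_idem)
  ultimately show ?thesis by simp
qed

text \<open>The interface between machines and programs. One direction reads the invariant at the
  state \<open>Main []\<close>, the other appends the simulation to the counting phase; afterwards
  only \<open>sem\<close> is considered.\<close>

theorem accepts_machine_iff:
  assumes "2 \<le> k" "regs p \<subseteq> {..<k}"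
  shows "accepts (machine k p) x \<longleftrightarrow> (\<exists>s. sem x p (length x + 1, env0 (length x + 1)) s)"
proof
  assume "accepts (machine k p) x"
  then obtain q i t j where "(mstep k p x)\<^sup>*\<^sup>* minit (q, i, t, j)" "to_nat q = to_nat (Main [])"
    unfolding accepts_def reachable_machine_iff emb_def by (auto simp: machine_def)
  with minv_reachable[OF assms(1), of p x "(Main [], i, t, j)"] have "minv k p x
      (Main [], i, t, j)" by simp
  then show "\<exists>s. sem x p (length x + 1, env0 (length x + 1)) s"
    by (auto simp: run_def sem_iff_sstep)
next
  assume "\<exists>s. sem x p (length x + 1, env0 (length x + 1)) s"
  then obtain i \<rho> where "(sstep x)\<^sup>*\<^sup>* ([p], length x + 1, env0 (length x + 1)) ([], i, \<rho>)"
    by (auto simp: sem_iff_sstep)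
  moreover have "env0 (length x + 1) r < cap x" for r
    using less_exp_floorlog[of "length x + 1"] by (auto simp: env0_def cap_def)
  ultimately have "(mstep k p x)\<^sup>*\<^sup>* (Main [p], length x + 1, tape k (width x) (env0 (length x + 1)), 0)
      (Main [], i, tape k (width x) \<rho>, 0)"
    using assms by (intro main_reach) auto
  with init_reach[OF assms(1)] have "(mstep k p x)\<^sup>*\<^sup>* minit (Main [], i, tape k (width x) \<rho>, 0)"
    by (rule rtranclp_trans)
  then have "reachable (machine k p) x (to_nat (Main []), i, tape k (width x) \<rho>, 0)"
    unfolding reachable_machine_iff by (intro exI[of _ "(Main [], i, tape k (width x) \<rho>, 0)"])
        (simp add: emb_def)
  then show "accepts (machine k p) x"
    unfolding accepts_def by (auto simp: machine_def)
qed

section \<open>Predicates decided by register programs\<close>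

record instance_rec =
  gn :: nat
  gE :: "nat \<Rightarrow> nat \<Rightarrow> bool"
  gv :: nat
  gw :: nat

type_synonym inst = instance_rec

definition valid :: "inst \<Rightarrow> bool" where
  "valid g \<longleftrightarrow> ord_graph (gn g) (gE g) \<and> gv g < gn g \<and> gw g < gn g"

definition word :: "inst \<Rightarrow> sym list" where
  "word g = enc_input (gn g) (gE g) (gv g) (gw g)"

abbreviation lim :: "inst \<Rightarrow> nat" where
  "lim g \<equiv> cap (word g)"

text \<open>Registers 0 and 1 serve as constants. The condition \<open>2 \<le> d\<close> in the
  lemmas below protects them from being used as scratch space.\<close>

definition ok :: "inst \<Rightarrow> env \<Rightarrow> bool" where
  "ok g \<rho> \<longleftrightarrow> (\<forall>r. \<rho> r < lim g) \<and> \<rho> 0 = 0 \<and> \<rho> 1 = length (word g) + 1"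

definition agree :: "nat \<Rightarrow> env \<Rightarrow> env \<Rightarrow> bool" where
  "agree d \<rho> \<rho>' \<longleftrightarrow> (\<forall>r<d. \<rho> r = \<rho>' r)"

lemma agree_refl [simp]: "agree d \<rho> \<rho>" by (simp add: agree_def)

lemma agree_trans: "agree d \<rho> \<rho>' \<Longrightarrow> agree d \<rho>' \<rho>'' \<Longrightarrow> agree d \<rho> \<rho>''" by (simp add: agree_def)

lemma agree_sym: "agree d \<rho> \<rho>' \<Longrightarrow> agree d \<rho>' \<rho>" by (simp add: agree_def)

lemma agree_mono: "agree d \<rho> \<rho>' \<Longrightarrow> d' \<le> d \<Longrightarrow> agree d' \<rho> \<rho>'" by (simp add: agree_def)

lemma agree_upd: "agree d (\<rho>(r := a)) \<rho>' \<longleftrightarrow> agree d \<rho> \<rho>'" "agree d \<rho>' (\<rho>(r := a)) \<longleftrightarrow>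
    agree d \<rho>' \<rho>" if "d \<le> r"
  using that by (auto simp: agree_def)

lemma agreeD: "agree d \<rho> \<rho>' \<Longrightarrow> r < d \<Longrightarrow> \<rho>' r = \<rho> r" by (simp add: agree_def)

lemma cap_gt: "length x + 1 < cap x"
  using less_exp_floorlog[of "length x + 1"] by (simp add: cap_def)

lemma sem_bounds:
  assumes "sem x p s s'" "fst s \<le> length x + 1" "\<forall>r. snd s r < cap x"
  shows "fst s' \<le> length x + 1 \<and> (\<forall>r. snd s' r < cap x)"
  using assms
proof (induction p arbitrary: s s')
  case (Act a)
  then show ?case by (cases a; cases s; cases s') auto
next
  case (Seq p q)
  from Seq.prems(1) obtain u where "sem x p s u" "sem x q u s'" by auto
  with Seq.IH(1)[of s u] Seq.IH(2)[of u s'] Seq.prems(2,3) show ?case by simp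
next
  case (Alt p q)
  from Alt.prems(1) have "sem x p s s' \<or> sem x q s s'" by simp
  with Alt.IH(1)[of s s'] Alt.IH(2)[of s s'] Alt.prems(2,3) show ?case by blast
next
  case (Star p)
  from Star.prems(1) have "(sem x p)\<^sup>*\<^sup>* s s'" by simp
  then show ?case using Star.prems(2,3)
  proof (induction rule: rtranclp_induct)
    case (step y z)
    then show ?case using Star.IH[OF step(2)] by simp
  qed simp
qed

definition start_ok :: "inst \<Rightarrow> nat \<times> env \<Rightarrow> bool" where
  "start_ok g s \<longleftrightarrow> fst s \<le> length (word g) + 1 \<and> ok g (snd s)"

lemma start_ok_sem:
  assumes "sem (word g) p s s'" "start_ok g s" "agree d (snd s) (snd s')" "2 \<le> d"
  shows "start_ok g s'"
  using sem_bounds[OF assms(1)] assms(2-4) agreeD[OF assms(3), of 0] agreeD[OF assms(3), of 1]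
  by (auto simp: start_ok_def ok_def)

text \<open>Registers below \<open>d\<close> are arguments and survive; the others are scratch space.\<close>

definition decides :: "nat \<Rightarrow> prog \<Rightarrow> (inst \<Rightarrow> env \<Rightarrow> bool) \<Rightarrow> bool" where
  "decides d p P \<longleftrightarrow> (\<forall>g s. valid g \<longrightarrow> start_ok g s \<longrightarrow>
     (\<forall>s'. sem (word g) p s s' \<longrightarrow> P g (snd s) \<and> agree d (snd s) (snd s')) \<and>
     (P g (snd s) \<longrightarrow> (\<exists>s'. sem (word g) p s s')))"

text \<open>Locality lets a predicate keep its truth value after another program has overwritten the
  scratch registers.\<close>

definition local_pred :: "nat \<Rightarrow> (inst \<Rightarrow> env \<Rightarrow> bool) \<Rightarrow> bool" where
  "local_pred d P \<longleftrightarrow> (\<forall>g \<rho> \<rho>'. valid g \<longrightarrow> ok g \<rho> \<longrightarrow> ok g \<rho>' \<longrightarrow> agree d \<rho> \<rho>' \<longrightarrow> P g \<rho> = P g \<rho>')"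

definition definable :: "nat \<Rightarrow> (inst \<Rightarrow> env \<Rightarrow> bool) \<Rightarrow> bool" where
  "definable d P \<longleftrightarrow> 2 \<le> d \<and> local_pred d P \<and> (\<exists>p. decides d p P)"

lemma decidesD:
  assumes "decides d p P" "valid g" "start_ok g s" "2 \<le> d"
  shows "sem (word g) p s s' \<Longrightarrow> P g (snd s) \<and> agree d (snd s) (snd s') \<and> start_ok g s'"
    and "P g (snd s) \<Longrightarrow> \<exists>s'. sem (word g) p s s' \<and> agree d (snd s) (snd s') \<and> start_ok g s'"
proof -
  have *: "sem (word g) p s s' \<Longrightarrow> P g (snd s) \<and> agree d (snd s) (snd s') \<and> start_ok g s'" for s'
    using assms start_ok_sem[of g p s s' d] unfolding decides_def by blast
  then show "sem (word g) p s s' \<Longrightarrow> P g (snd s) \<and> agree d (snd s) (snd s') \<and> start_ok g s'" .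
  show "P g (snd s) \<Longrightarrow> \<exists>s'. sem (word g) p s s' \<and> agree d (snd s) (snd s') \<and> start_ok g s'"
    using assms * unfolding decides_def by blast
qed

lemma start_ok_ok: "start_ok g s \<Longrightarrow> ok g (snd s)"
  by (simp add: start_ok_def)

section \<open>Closure under connectives and bounded existential quantification\<close>

lemma definable_cong:
  assumes "definable d P" "\<And>g \<rho>. valid g \<Longrightarrow> ok g \<rho> \<Longrightarrow> P g \<rho> \<longleftrightarrow> Q g \<rho>"
  shows "definable d Q"
proof -
  from assms(1) obtain p where p: "decides d p P" "2 \<le> d" "local_pred d P"
    unfolding definable_def by blast
  have "decides d p Q"
    using p(1) assms(2) start_ok_ok unfolding decides_def by metis
  moreover have "local_pred d Q"
    using p(3) assms(2) unfolding local_pred_def by metis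
  ultimately show ?thesis using p(2) unfolding definable_def by blast
qed

text \<open>Sequential composition: \<open>p\<close> may move the head and spoil scratch registers,
  but it preserves the arguments and \<open>start_ok\<close>, and \<open>Q\<close> sees nothing
  else.\<close>

lemma definable_conj:
  assumes "definable d P" "definable d Q"
  shows "definable d (\<lambda>g \<rho>. P g \<rho> \<and> Q g \<rho>)"
proof -
  from assms obtain p q where pq: "decides d p P" "decides d q Q" and d: "2 \<le> d" and
    loc: "local_pred d P" "local_pred d Q"
    unfolding definable_def by blast
  have "decides d (Seq p q) (\<lambda>g \<rho>. P g \<rho> \<and> Q g \<rho>)"
    unfolding decides_def
  proof (intro allI impI conjI)
    fix g s s' assume g: "valid g" "start_ok g s" and "sem (word g) (Seq p q) s s'"
    then obtain u where u: "sem (word g) p s u" "sem (word g) q u s'" by auto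
    note 1 = decidesD(1)[OF pq(1) g d u(1)]
    note 2 = decidesD(1)[OF pq(2) g(1) _ d u(2)]
    from 1 2 loc(2) g show "P g (snd s)" "Q g (snd s)" "agree d (snd s) (snd s')"
      unfolding local_pred_def using start_ok_ok agree_trans by metis+
  next
    fix g s assume g: "valid g" "start_ok g s" and PQ: "P g (snd s) \<and> Q g (snd s)"
    from decidesD(2)[OF pq(1) g d] PQ obtain u where
      u: "sem (word g) p s u" "agree d (snd s) (snd u)" "start_ok g u" by blast
    with loc(2) g PQ have "Q g (snd u)" unfolding local_pred_def using start_ok_ok by metis
    from decidesD(2)[OF pq(2) g(1) u(3) d this] u show "\<exists>s'. sem (word g) (Seq p q) s s'"
      by (auto simp: OO_def simp del: split_paired_Ex)
  qed
  moreover have "local_pred d (\<lambda>g \<rho>. P g \<rho> \<and> Q g \<rho>)" using loc unfolding local_pred_def by metis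
  ultimately show ?thesis using d unfolding definable_def by blast
qed

lemma definable_disj:
  assumes "definable d P" "definable d Q"
  shows "definable d (\<lambda>g \<rho>. P g \<rho> \<or> Q g \<rho>)"
proof -
  from assms obtain p q where pq: "decides d p P" "decides d q Q" and d: "2 \<le> d" and
    loc: "local_pred d P" "local_pred d Q"
    unfolding definable_def by blast
  have "decides d (Alt p q) (\<lambda>g \<rho>. P g \<rho> \<or> Q g \<rho>)"
    using pq unfolding decides_def sem.simps by blast
  moreover have "local_pred d (\<lambda>g \<rho>. P g \<rho> \<or> Q g \<rho>)" using loc unfolding local_pred_def by metis
  ultimately show ?thesis using d unfolding definable_def by blast
qed

lemma ok_upd: "ok g \<rho> \<Longrightarrow> a < lim g \<Longrightarrow> 2 \<le> r \<Longrightarrow> ok g (\<rho>(r := a))"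
  by (auto simp: ok_def)

text \<open>The witness is guessed into register \<open>d\<close>, which thereby becomes an argument
  of \<open>P\<close>. Registers are thus allotted by nesting depth, as with de Bruijn
  levels.\<close>

lemma definable_ex:
  assumes "definable (Suc d) P" "2 \<le> d"
  shows "definable d (\<lambda>g \<rho>. \<exists>a<lim g. P g (\<rho>(d := a)))"
proof -
  from assms obtain p where p: "decides (Suc d) p P" and loc: "local_pred (Suc d) P"
    unfolding definable_def by blast
  have ok: "start_ok g (i, \<rho>(d := a))" if "start_ok g (i, \<rho>)" "a < lim g" for g i \<rho> a
    using that assms(2) by (auto simp: start_ok_def intro: ok_upd)
  have "decides d (Seq (Act (Guess d)) p) (\<lambda>g \<rho>. \<exists>a<lim g. P g (\<rho>(d := a)))"
    unfolding decides_def
  proof (intro allI impI conjI)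
    fix g s s' assume g: "valid g" "start_ok g s" and "sem (word g) (Seq (Act (Guess d)) p) s s'"
    then obtain a where a: "a < lim g" "sem (word g) p (fst s, (snd s)(d := a)) s'"
      by (cases s) auto
    with decidesD(1)[OF p g(1) ok _ a(2)] g(2) assms(2)
    have "P g ((snd s)(d := a))" "agree (Suc d) ((snd s)(d := a)) (snd s')"
      by (auto simp: start_ok_def)
    with a agree_mono[of "Suc d" "(snd s)(d := a)" "snd s'" d]
    show "\<exists>a<lim g. P g ((snd s)(d := a))" "agree d (snd s) (snd s')"
      by (auto simp: agree_upd)
  next
    fix g s assume g: "valid g" "start_ok g s" and "\<exists>a<lim g. P g ((snd s)(d := a))"
    then obtain a where a: "a < lim g" "P g ((snd s)(d := a))" by blast
    from decidesD(2)[OF p g(1) ok[of g "fst s" "snd s" a]] g(2) a assms(2)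
    obtain s' where "sem (word g) p (fst s, (snd s)(d := a)) s'" by auto
    with a show "\<exists>s'. sem (word g) (Seq (Act (Guess d)) p) s s'"
      by (cases s) (auto simp: OO_def simp del: split_paired_Ex)
  qed
  moreover have "local_pred d (\<lambda>g \<rho>. \<exists>a<lim g. P g (\<rho>(d := a)))"
    unfolding local_pred_def
  proof (intro allI impI)
    fix g \<rho> \<rho>' assume *: "valid g" "ok g \<rho>" "ok g \<rho>'" "agree d \<rho> \<rho>'"
    have "P g (\<rho>(d := a)) = P g (\<rho>'(d := a))" if "a < lim g" for a
    proof -
      have "agree (Suc d) (\<rho>(d := a)) (\<rho>'(d := a))" using *(4) by (auto simp: agree_def)
      then show ?thesis using loc * that ok_upd assms(2) unfolding local_pred_def by blast
    qed
    then show "(\<exists>a<lim g. P g (\<rho>(d := a))) = (\<exists>a<lim g. P g (\<rho>'(d := a)))" by blast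
  qed
  ultimately show ?thesis using assms(2) unfolding definable_def by blast
qed

lemma definable_test:
  assumes "a < d" "b < d" "2 \<le> d"
  shows "definable d (\<lambda>g \<rho>. \<rho> a = \<rho> b + of_bool c)"
proof -
  have "decides d (Act (Test a b c)) (\<lambda>g \<rho>. \<rho> a = \<rho> b + of_bool c)"
    unfolding decides_def by auto
  then show ?thesis using assms unfolding definable_def local_pred_def agree_def by auto
qed

lemma definable_eq: "a < d \<Longrightarrow> b < d \<Longrightarrow> 2 \<le> d \<Longrightarrow> definable d (\<lambda>g \<rho>. \<rho> a = \<rho> b)"
  using definable_test[of a d b False] by simp

lemma definable_Suc: "a < d \<Longrightarrow> b < d \<Longrightarrow> 2 \<le> d \<Longrightarrow> definable d (\<lambda>g \<rho>. \<rho> a = Suc (\<rho> b))"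
  using definable_test[of a d b True] by simp

lemma definable_zero: "a < d \<Longrightarrow> 2 \<le> d \<Longrightarrow> definable d (\<lambda>g \<rho>. \<rho> a = 0)"
  by (rule definable_cong[OF definable_eq[of a d 0]]) (auto simp: ok_def)

lemma definable_end: "a < d \<Longrightarrow> 2 \<le> d \<Longrightarrow> definable d (\<lambda>g \<rho>. \<rho> a = length (word g) + 1)"
  by (rule definable_cong[OF definable_eq[of a d 1]]) (auto simp: ok_def)

subsection \<open>Transitive closure\<close>

abbreviation upd2 :: "env \<Rightarrow> nat \<Rightarrow> nat \<Rightarrow> nat \<Rightarrow> env" where
  "upd2 \<rho> d a b \<equiv> \<rho>(d := a, Suc d := b)"

text \<open>Registers \<open>d\<close> and \<open>d + 1\<close> hold the current pair, the next two
  its successor. Pairs are enough for all later uses: a moving element or position together with a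
  counter or an accumulated value.\<close>

definition tc_step :: "nat \<Rightarrow> (inst \<Rightarrow> env \<Rightarrow> bool) \<Rightarrow> inst \<Rightarrow> env \<Rightarrow> nat \<times> nat \<Rightarrow> nat \<times> nat \<Rightarrow> bool" where
  "tc_step d R g \<rho> s t \<longleftrightarrow> fst t < lim g \<and> snd t < lim g \<and>
     R g (upd2 (upd2 \<rho> d (fst s) (snd s)) (Suc (Suc d)) (fst t) (snd t))"

definition tc :: "nat \<Rightarrow> (inst \<Rightarrow> env \<Rightarrow> bool) \<Rightarrow> (inst \<Rightarrow> env \<Rightarrow> bool) \<Rightarrow>
    (inst \<Rightarrow> env \<Rightarrow> bool) \<Rightarrow> inst \<Rightarrow> env \<Rightarrow> bool" where
  "tc d I R F g \<rho> \<longleftrightarrow> (\<exists>s t. fst s < lim g \<and> snd s < lim g \<and> I g (upd2 \<rho> d (fst s) (snd s)) \<and>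
     (tc_step d R g \<rho>)\<^sup>*\<^sup>* s t \<and> F g (upd2 \<rho> d (fst t) (snd t)))"

text \<open>One round: guess the next pair, confirm the step, and move the pair down to become the
  current one. Copying a register means guessing and testing for equality.\<close>

definition tc_body :: "nat \<Rightarrow> prog \<Rightarrow> prog" where
  "tc_body d r = Seq (Act (Guess (d + 2))) (Seq (Act (Guess (d + 3))) (Seq r
     (Seq (Act (Guess d)) (Seq (Act (Test d (d + 2) False))
       (Seq (Act (Guess (Suc d))) (Act (Test (Suc d) (d + 3) False)))))))"

lemma sem_Seq_Guess:
  "sem x (Seq (Act (Guess r)) p) (i, \<rho>) s \<longleftrightarrow> (\<exists>a<cap x. sem x p (i, \<rho>(r := a)) s)"
  by (auto simp: OO_def)

lemma sem_Seq_Test: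
  "sem x (Seq (Act (Test r s c)) p) (i, \<rho>) t \<longleftrightarrow> \<rho> r = \<rho> s + of_bool c \<and> sem x p (i, \<rho>) t"
  by (auto simp: OO_def)

lemma sem_Seq: "sem x (Seq p q) s t \<longleftrightarrow> (\<exists>i \<rho>. sem x p s (i, \<rho>) \<and> sem x q (i, \<rho>) t)"
  by (auto simp: OO_def)

lemma sem_tc_body:
  "sem x (tc_body d r) (i, \<rho>) s' \<longleftrightarrow> (\<exists>a<cap x. \<exists>b<cap x. \<exists>j \<sigma>. sem x r (i, upd2 \<rho> (d + 2) a b) (j, \<sigma>) \<and>
     \<sigma> (d + 2) < cap x \<and> \<sigma> (d + 3) < cap x \<and> s' = (j, upd2 \<sigma> d (\<sigma> (d + 2)) (\<sigma> (d + 3))))"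
proof -
  have *: "Suc (d + 2) = d + 3" by simp
  have tail: "sem x (Seq (Act (Guess d)) (Seq (Act (Test d (d + 2) False))
       (Seq (Act (Guess (Suc d))) (Act (Test (Suc d) (d + 3) False))))) (j, \<sigma>) s' \<longleftrightarrow>
     \<sigma> (d + 2) < cap x \<and> \<sigma> (d + 3) < cap x \<and> s' = (j, upd2 \<sigma> d (\<sigma> (d + 2)) (\<sigma> (d + 3)))" for j \<sigma>
    unfolding sem_Seq_Guess sem_Seq_Test by auto
  show ?thesis
    unfolding tc_body_def sem_Seq_Guess[of _ "d + 2"] sem_Seq_Guess[of _ "d + 3"] sem_Seq[of _ r] tail *
    by (rule refl)
qed

lemma tc_body_sound:
  assumes "decides (d + 4) r R" "local_pred (d + 4) R" "valid g" "start_ok g s" "2 \<le> d"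
    "sem (word g) (tc_body d r) s s'"
  shows "agree d (snd s) (snd s') \<and> start_ok g s' \<and>
    tc_step d R g (snd s) (snd s d, snd s (Suc d)) (snd s' d, snd s' (Suc d))"
proof -
  obtain i \<rho> where s: "s = (i, \<rho>)" by (cases s)
  from assms(6) obtain a b j \<sigma> where ab: "a < lim g" "b < lim g"
    and r: "sem (word g) r (i, upd2 \<rho> (d + 2) a b) (j, \<sigma>)"
    and s': "s' = (j, upd2 \<sigma> d (\<sigma> (d + 2)) (\<sigma> (d + 3)))"
    unfolding s sem_tc_body by blast
  have "start_ok g (i, upd2 \<rho> (d + 2) a b)"
    using assms(4,5) ab unfolding s start_ok_def by (auto intro!: ok_upd)
  from decidesD(1)[OF assms(1,3) this _ r] assms(5)
  have R: "R g (upd2 \<rho> (d + 2) a b)" and ag: "agree (d + 4) (upd2 \<rho> (d + 2) a b) \<sigma>"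
      and ok: "start_ok g (j, \<sigma>)"
    by auto
  from agreeD[OF ag, of "d + 2"] agreeD[OF ag, of "d + 3"] have \<sigma>: "\<sigma> (d + 2) = a" "\<sigma> (d + 3) = b"
      by auto
  have "agree d \<rho> (snd s')" using agree_mono[OF ag, of d] unfolding s' by (simp add: agree_upd)
  moreover have "start_ok g s'"
    using ok ab assms(5) unfolding s' \<sigma> start_ok_def by (auto intro!: ok_upd)
  moreover have "upd2 \<rho> (d + 2) a b = upd2 (upd2 \<rho> d (\<rho> d) (\<rho> (Suc d))) (Suc (Suc d)) a b" by auto
  with R ab have "tc_step d R g \<rho> (\<rho> d, \<rho> (Suc d)) (a, b)" unfolding tc_step_def by simp
  moreover have "(snd s' d, snd s' (Suc d)) = (a, b)" unfolding s' \<sigma> by simp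
  ultimately show ?thesis unfolding s by simp
qed

lemma tc_body_complete:
  assumes "decides (d + 4) r R" "local_pred (d + 4) R" "valid g" "start_ok g s" "2 \<le> d"
    "tc_step d R g (snd s) (snd s d, snd s (Suc d)) t"
  shows "\<exists>s'. sem (word g) (tc_body d r) s s' \<and> (snd s' d, snd s' (Suc d)) = t"
proof -
  obtain i \<rho> where s: "s = (i, \<rho>)" by (cases s)
  obtain a b where t: "t = (a, b)" by (cases t)
  have eq: "upd2 \<rho> (d + 2) a b = upd2 (upd2 \<rho> d (\<rho> d) (\<rho> (Suc d))) (Suc (Suc d)) a b" by auto
  from assms(6) have R: "R g (upd2 \<rho> (d + 2) a b)" and ab: "a < lim g" "b < lim g"
    unfolding s t tc_step_def fst_conv snd_conv eq by blast+
  have "start_ok g (i, upd2 \<rho> (d + 2) a b)"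
    using assms(4,5) ab unfolding s start_ok_def by (auto intro!: ok_upd)
  from decidesD(2)[OF assms(1,3) this] assms(5) R obtain j \<sigma> where
    r: "sem (word g) r (i, upd2 \<rho> (d + 2) a b) (j, \<sigma>)" and ag: "agree (d + 4) (upd2 \<rho> (d + 2) a b) \<sigma>"
    by auto
  from agreeD[OF ag, of "d + 2"] agreeD[OF ag, of "d + 3"]
  have "\<sigma> (d + 2) = a" "\<sigma> (d + 3) = b" by auto
  with r ab have "sem (word g) (tc_body d r) s (j, upd2 \<sigma> d a b)"
    unfolding s sem_tc_body by blast
  then show ?thesis unfolding t by (intro exI[of _ "(j, upd2 \<sigma> d a b)"]) simp
qed

text \<open>Each round leaves different scratch contents behind, so formally every round has its own
  step relation. Locality identifies all of them with that of the initial environment.\<close>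

lemma tc_step_cong:
  assumes "local_pred (d + 4) R" "valid g" "ok g \<rho>" "ok g \<rho>'" "agree d \<rho> \<rho>'" "2 \<le> d"
    "fst s < lim g" "snd s < lim g"
  shows "tc_step d R g \<rho> s t = tc_step d R g \<rho>' s t"
proof (cases "fst t < lim g \<and> snd t < lim g")
  case True
  let ?u = "\<lambda>\<rho>. upd2 (upd2 \<rho> d (fst s) (snd s)) (Suc (Suc d)) (fst t) (snd t)"
  have "agree (d + 4) (?u \<rho>) (?u \<rho>')" using assms(5) by (auto simp: agree_def)
  moreover have "ok g (?u \<rho>)" "ok g (?u \<rho>')"
    using assms True by (auto intro!: ok_upd)
  ultimately have "R g (?u \<rho>) = R g (?u \<rho>')" using assms(1,2) unfolding local_pred_def by blast
  then show ?thesis unfolding tc_step_def by simp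
qed (auto simp: tc_step_def)

lemma tc_steps_bounded:
  assumes "(tc_step d R g \<rho>)\<^sup>*\<^sup>* s t" "fst s < lim g" "snd s < lim g"
  shows "fst t < lim g \<and> snd t < lim g"
  using assms by (induction rule: rtranclp_induct) (auto simp: tc_step_def)

lemma tc_steps_cong:
  assumes "local_pred (d + 4) R" "valid g" "ok g \<rho>" "ok g \<rho>'" "agree d \<rho> \<rho>'" "2 \<le> d"
    "fst s < lim g" "snd s < lim g" "(tc_step d R g \<rho>)\<^sup>*\<^sup>* s t"
  shows "(tc_step d R g \<rho>')\<^sup>*\<^sup>* s t"
  using assms(9)
proof (induction rule: rtranclp_induct)
  case (step y z)
  then show ?case
    using tc_step_cong[OF assms(1-6), of y z] tc_steps_bounded[OF step(1) assms(7,8)] by auto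
qed simp

text \<open>\<open>Star\<close> leaves the loop at any round, and the test \<open>F\<close> after it
  discards the wrong exits; so runs of the program correspond to finite chains of steps.\<close>

lemma definable_tc:
  assumes I: "definable (d + 2) I" and R: "definable (d + 4) R" and F: "definable (d + 2) F"
      and d: "2 \<le> d"
  shows "definable d (tc d I R F)"
proof -
  from I R F obtain p q f where
    p: "decides (d + 2) p I" and q: "decides (d + 4) q R" and f: "decides (d + 2) f F" and
    loc: "local_pred (d + 2) I" "local_pred (d + 4) R" "local_pred (d + 2) F"
    unfolding definable_def by blast
  let ?star = "Star (tc_body d q)"
  let ?p = "Seq (Act (Guess d)) (Seq (Act (Guess (Suc d))) (Seq p (Seq ?star f)))"
  have sound: "agree d (snd s) (snd s') \<and> start_ok g s' \<and>
      (tc_step d R g (snd s))\<^sup>*\<^sup>* (snd s d, snd s (Suc d)) (snd s' d, snd s' (Suc d))"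
    if g: "valid g" "start_ok g s" "sem (word g) ?star s s'" for g s s'
  proof -
    from g(3) have "(sem (word g) (tc_body d q))\<^sup>*\<^sup>* s s'" by simp
    then show ?thesis
    proof (induction rule: rtranclp_induct)
      case base
      with g show ?case by simp
    next
      case (step y z)
      then have y: "agree d (snd s) (snd y)" "start_ok g y" by auto
      note b = tc_body_sound[OF q loc(2) g(1) y(2) d step(2)]
      have "snd y d < lim g" "snd y (Suc d) < lim g" using y(2) by (auto simp: start_ok_def ok_def)
      with b tc_step_cong[OF loc(2) g(1) start_ok_ok[OF g(2)] start_ok_ok[OF y(2)] y(1) d,
          of "(snd y d, snd y (Suc d))" "(snd z d, snd z (Suc d))"]
      have "tc_step d R g (snd s) (snd y d, snd y (Suc d)) (snd z d, snd z (Suc d))" by simp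
      with step(3) have "(tc_step d R g (snd s))\<^sup>*\<^sup>* (snd s d, snd s (Suc d)) (snd z d, snd z (Suc d))"
        by (blast intro: rtranclp.rtrancl_into_rtrancl)
      with b agree_trans[OF y(1)] show ?case by blast
    qed
  qed
  have complete: "\<exists>s'. sem (word g) ?star s s' \<and> (snd s' d, snd s' (Suc d)) = t"
    if g: "valid g" "start_ok g s" "(tc_step d R g (snd s))\<^sup>*\<^sup>* (snd s d, snd s (Suc d)) t" for g s t
    using g(3)
  proof (induction rule: rtranclp_induct)
    case base
    show ?case by (intro exI[of _ s]) auto
  next
    case (step y z)
    then obtain s' where s': "sem (word g) ?star s s'" "(snd s' d, snd s' (Suc d)) = y" by blast
    note * = sound[OF g(1,2) s'(1)]
    have "snd s' d < lim g" "snd s' (Suc d) < lim g" using * by (auto simp: start_ok_def ok_def)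
    then have "fst y < lim g" "snd y < lim g" using s'(2) by auto
    with * tc_step_cong[OF loc(2) g(1) _ _ _ d, of "snd s" "snd s'" y z] g step(2) start_ok_ok
    have "tc_step d R g (snd s') (snd s' d, snd s' (Suc d)) z"
      unfolding s'(2) by blast
    from tc_body_complete[OF q loc(2) g(1) _ d this] * obtain s''
      where s'': "sem (word g) (tc_body d q) s' s''" "(snd s'' d, snd s'' (Suc d)) = z" by blast
    then have "sem (word g) ?star s s''" using s'(1) by (simp add: rtranclp.rtrancl_into_rtrancl)
    with s''(2) show ?case by blast
  qed
  have ok: "start_ok g (i, upd2 \<rho> d a b)" if "start_ok g (i, \<rho>)" "a < lim g" "b < lim g" for g i \<rho> a b
    using that d by (auto simp: start_ok_def intro!: ok_upd)
  have "decides d ?p (tc d I R F)"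
    unfolding decides_def
  proof (intro allI impI)
    fix g s assume g: "valid g" "start_ok g s"
    obtain i \<rho> where s: "s = (i, \<rho>)" by (cases s)
    have d2: "2 \<le> d + 2" by simp
    have ok\<rho>: "ok g \<rho>" using g(2) s by (simp add: start_ok_def)
    show "(\<forall>s'. sem (word g) ?p s s' \<longrightarrow> tc d I R F g (snd s) \<and> agree d (snd s) (snd s')) \<and>
      (tc d I R F g (snd s) \<longrightarrow> (\<exists>s'. sem (word g) ?p s s'))"
    proof (intro conjI allI impI)
      fix s' assume "sem (word g) ?p s s'"
      then obtain a b s2 s3 where ab: "a < lim g" "b < lim g" and
         s2: "sem (word g) p (i, upd2 \<rho> d a b) s2" and s3: "sem (word g) ?star s2 s3" and
         s': "sem (word g) f s3 s'"
        unfolding s sem_Seq_Guess sem_Seq[of _ p] sem_Seq[of _ ?star] by blast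
      note ok1 = ok[OF g(2)[unfolded s] ab]
      from decidesD(1)[OF p g(1) ok1 d2 s2]
      have 1: "I g (upd2 \<rho> d a b)" "agree (d + 2) (upd2 \<rho> d a b) (snd s2)" "start_ok g s2" by auto
      from agreeD[OF 1(2), of d] agreeD[OF 1(2), of "Suc d"]
      have s2ab: "snd s2 d = a" "snd s2 (Suc d) = b" by auto
      note 2 = sound[OF g(1) 1(3) s3]
      from decidesD(1)[OF f g(1) _ d2 s'] 2 have 3: "F g (snd s3)" "agree (d + 2) (snd s3)
          (snd s')" by auto
      have a1: "agree d \<rho> (snd s2)" using agree_mono[OF 1(2), of d] by (simp add: agree_upd)
      have a2: "agree d \<rho> (snd s3)" using 2 a1 agree_trans by blast
      show "agree d (snd s) (snd s')" using agree_trans[OF a2 agree_mono[OF 3(2), of d]] unfolding s by simp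
      have "(tc_step d R g \<rho>)\<^sup>*\<^sup>* (a, b) (snd s3 d, snd s3 (Suc d))"
        using 2 tc_steps_cong[OF loc(2) g(1) start_ok_ok[OF 1(3)] ok\<rho> agree_sym[OF a1] d] ab
        unfolding s2ab by simp
      moreover have "F g (upd2 \<rho> d (snd s3 d) (snd s3 (Suc d)))"
      proof -
        have "agree (d + 2) (snd s3) (upd2 \<rho> d (snd s3 d) (snd s3 (Suc d)))"
          using a2 by (auto simp: agree_def less_Suc_eq)
        moreover have "ok g (snd s3)" using 2 start_ok_ok by blast
        moreover from this have "ok g (upd2 \<rho> d (snd s3 d) (snd s3 (Suc d)))"
          using ok\<rho> d by (intro ok_upd) (auto simp: ok_def)
        ultimately show ?thesis using 3(1) loc(3) g(1) unfolding local_pred_def by blast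
      qed
      ultimately show "tc d I R F g (snd s)" unfolding tc_def s using 1(1) ab
        by (intro exI[of _ "(a, b)"] exI[of _ "(snd s3 d, snd s3 (Suc d))"]) auto
    next
      assume "tc d I R F g (snd s)"
      then obtain a b t where ab: "a < lim g" "b < lim g" "I g (upd2 \<rho> d a b)"
        "(tc_step d R g \<rho>)\<^sup>*\<^sup>* (a, b) t" "F g (upd2 \<rho> d (fst t) (snd t))"
        unfolding tc_def s by auto
      note ok1 = ok[OF g(2)[unfolded s] ab(1,2)]
      from decidesD(2)[OF p g(1) ok1 d2] ab obtain s2 where
        s2: "sem (word g) p (i, upd2 \<rho> d a b) s2" "agree (d + 2) (upd2 \<rho> d a b) (snd s2)"
            "start_ok g s2" by auto
      from agreeD[OF s2(2), of d] agreeD[OF s2(2), of "Suc d"]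
      have s2ab: "snd s2 d = a" "snd s2 (Suc d) = b" by auto
      have a1: "agree d \<rho> (snd s2)" using agree_mono[OF s2(2), of d] by (simp add: agree_upd)
      have "(tc_step d R g (snd s2))\<^sup>*\<^sup>* (snd s2 d, snd s2 (Suc d)) t"
        using ab tc_steps_cong[OF loc(2) g(1) ok\<rho> start_ok_ok[OF s2(3)] a1 d, of "(a, b)"]
        unfolding s2ab by simp
      from complete[OF g(1) s2(3) this] obtain s3 where
        s3: "sem (word g) ?star s2 s3" "(snd s3 d, snd s3 (Suc d)) = t" by blast
      note 2 = sound[OF g(1) s2(3) s3(1)]
      have a2: "agree d \<rho> (snd s3)" using 2 a1 agree_trans by blast
      have "F g (snd s3)"
      proof -
        have "agree (d + 2) (snd s3) (upd2 \<rho> d (snd s3 d) (snd s3 (Suc d)))"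
          using a2 by (auto simp: agree_def less_Suc_eq)
        moreover have "ok g (snd s3)" using 2 start_ok_ok by blast
        moreover from this have "ok g (upd2 \<rho> d (snd s3 d) (snd s3 (Suc d)))"
          using ok\<rho> d by (intro ok_upd) (auto simp: ok_def)
        moreover have "upd2 \<rho> d (fst t) (snd t) = upd2 \<rho> d (snd s3 d) (snd s3 (Suc d))"
          using s3(2) by auto
        ultimately show ?thesis using ab(5) loc(3) g(1) unfolding local_pred_def by metis
      qed
      with decidesD(2)[OF f g(1) _ d2] 2 obtain s' where "sem (word g) f s3 s'" by blast
      with s2 s3 ab show "\<exists>s'. sem (word g) ?p s s'"
        unfolding s sem_Seq_Guess sem_Seq[of _ p] sem_Seq[of _ ?star] by (metis surj_pair)
    qed
  qed
  moreover have "local_pred d (tc d I R F)"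
  proof -
    have "tc d I R F g \<rho>'" if *: "valid g" "ok g \<rho>" "ok g \<rho>'" "agree d \<rho> \<rho>'" "tc d I R F g \<rho>" for g \<rho> \<rho>'
    proof -
      from *(5) obtain s t where st: "fst s < lim g" "snd s < lim g" "I g (upd2 \<rho> d (fst s) (snd s))"
        "(tc_step d R g \<rho>)\<^sup>*\<^sup>* s t" "F g (upd2 \<rho> d (fst t) (snd t))" unfolding tc_def by auto
      have t: "fst t < lim g \<and> snd t < lim g" using tc_steps_bounded[OF st(4,1,2)] .
      have ag: "agree (d + 2) (upd2 \<rho> d a b) (upd2 \<rho>' d a b)" for a b
        using *(4) by (auto simp: agree_def less_Suc_eq)
      have okk: "ok g (upd2 \<rho> d a b)" "ok g (upd2 \<rho>' d a b)" if "a < lim g" "b < lim g" for a b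
        using that * d by (auto intro!: ok_upd)
      have "I g (upd2 \<rho>' d (fst s) (snd s))" "F g (upd2 \<rho>' d (fst t) (snd t))"
        using st(3,5) loc(1,3) *(1) okk[OF st(1,2)] okk[of "fst t" "snd t"] t ag
        unfolding local_pred_def by (metis, metis)
      then show ?thesis unfolding tc_def using st(1,2) tc_steps_cong[OF loc(2) *(1-4) d st(1,2,4)]
          by blast
    qed
    then show ?thesis unfolding local_pred_def using agree_sym by blast
  qed
  ultimately show ?thesis using d unfolding definable_def by blast
qed

subsection \<open>Reading the input\<close>

text \<open>The head and register \<open>d\<close> advance in lockstep. The increment goes through
  \<open>Suc d\<close>, because a successor test relates two distinct registers.\<close>

definition sym_body :: "nat \<Rightarrow> prog" where
  "sym_body d = Seq (Act MoveR) (Seq (Act (Guess (Suc d))) (Seq (Act (Test (Suc d) d True))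
     (Seq (Act (Guess d)) (Act (Test d (Suc d) False)))))"

lemma sem_Seq_Move:
  "sem x (Seq (Act MoveL) p) (i, \<rho>) s \<longleftrightarrow> 0 < i \<and> sem x p (i - 1, \<rho>) s"
  "sem x (Seq (Act MoveR) p) (i, \<rho>) s \<longleftrightarrow> i \<le> length x \<and> sem x p (i + 1, \<rho>) s"
  "sem x (Seq (Act (Sym a)) p) (i, \<rho>) s \<longleftrightarrow> inp x i = a \<and> sem x p (i, \<rho>) s"
  by (auto simp: OO_def)

lemma sem_sym_body:
  "sem x (sym_body d) (i, \<rho>) s' \<longleftrightarrow> i \<le> length x \<and> Suc (\<rho> d) < cap x \<and>
     s' = (Suc i, \<rho>(Suc d := Suc (\<rho> d), d := Suc (\<rho> d)))"
  unfolding sym_body_def sem_Seq_Guess sem_Seq_Test sem_Seq_Move by auto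

lemma sym_star_sound:
  assumes "sem x (Star (sym_body d)) (\<rho> d, \<rho>) (i, \<rho>')"
  shows "i = \<rho>' d \<and> agree d \<rho> \<rho>'"
proof -
  from assms have "(sem x (sym_body d))\<^sup>*\<^sup>* (\<rho> d, \<rho>) (i, \<rho>')" by simp
  then show ?thesis
    by (induction "(i, \<rho>')" arbitrary: i \<rho>' rule: rtranclp_induct)
       (auto simp: sem_sym_body agree_upd)
qed

lemma sym_star_complete:
  assumes "n \<le> length x + 1" "\<rho> d = 0"
  shows "\<exists>\<rho>'. sem x (Star (sym_body d)) (0, \<rho>) (n, \<rho>') \<and> \<rho>' d = n"
  using assms(1)
proof (induction n)
  case 0
  then show ?case using assms(2) by auto
next
  case (Suc n)
  then obtain \<rho>' where r: "(sem x (sym_body d))\<^sup>*\<^sup>* (0, \<rho>) (n, \<rho>')" "\<rho>' d = n" by auto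
  let ?\<rho> = "\<rho>'(Suc d := Suc n, d := Suc n)"
  have "sem x (sym_body d) (n, \<rho>') (Suc n, ?\<rho>)"
    using Suc.prems r(2) cap_gt[of x] unfolding sem_sym_body by simp
  with r(1) have "(sem x (sym_body d))\<^sup>*\<^sup>* (0, \<rho>) (Suc n, ?\<rho>)" by (rule rtranclp.rtrancl_into_rtrancl)
  moreover have "?\<rho> d = Suc n" by simp
  ultimately show ?case unfolding sem.simps by blast
qed

lemma sem_Star_MoveL: "sem x (Star (Act MoveL)) (i, \<rho>) s \<longleftrightarrow> fst s \<le> i \<and> snd s = \<rho>"
proof
  assume "sem x (Star (Act MoveL)) (i, \<rho>) s"
  then have "(exec x MoveL)\<^sup>*\<^sup>* (i, \<rho>) s" by simp
  then show "fst s \<le> i \<and> snd s = \<rho>" by (induction rule: rtranclp_induct) auto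
next
  have "(exec x MoveL)\<^sup>*\<^sup>* (j + n, \<rho>) (j, \<rho>)" for j n
  proof (induction n)
    case (Suc n)
    have "exec x MoveL (j + Suc n, \<rho>) (j + n, \<rho>)" by simp
    with Suc show ?case by (rule converse_rtranclp_into_rtranclp[rotated])
  qed simp
  from this[of "fst s" "i - fst s"]
  show "fst s \<le> i \<and> snd s = \<rho> \<Longrightarrow> sem x (Star (Act MoveL)) (i, \<rho>) s" by (cases s) auto
qed

text \<open>\<open>Sym None\<close> holds at both ends of the input. The detour
  \<open>MoveR\<close>, \<open>MoveL\<close> is possible only at the left one, since nothing lies to
  the right of the right end marker.\<close>

lemma sem_rewind:
  assumes "i \<le> length x + 1"
  shows "sem x (Seq (Star (Act MoveL)) (Seq (Act (Sym None)) (Seq (Act MoveR) (Seq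
      (Act MoveL) r)))) (i, \<rho>) s \<longleftrightarrow>
    sem x r (0, \<rho>) s"
proof -
  have *: "inp x j = None \<and> j \<le> length x \<longleftrightarrow> j = 0" for j by (auto simp: inp_def)
  have "sem x (Seq (Act (Sym None)) (Seq (Act MoveR) (Seq (Act MoveL) r))) (j, \<rho>) s \<longleftrightarrow> j = 0 \<and>
      sem x r (0, \<rho>) s" for j
    unfolding sem_Seq_Move using *[of j] by auto
  then show ?thesis
    unfolding sem_Seq[of _ "Star (Act MoveL)"] sem_Star_MoveL fst_conv snd_conv by blast
qed

text \<open>Random access to the input: go to the left end, walk right while counting in register
  \<open>d\<close>, and stop at a position equal to register \<open>a\<close>.\<close>

lemma definable_sym:
  assumes "a < d" "2 \<le> d"
  shows "definable d (\<lambda>g \<rho>. inp (word g) (\<rho> a) = Some y)"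
proof -
  let ?p1 = "Seq (Act (Test d a False)) (Act (Sym (Some y)))"
  let ?p = "Seq (Star (Act MoveL)) (Seq (Act (Sym None)) (Seq (Act MoveR) (Seq (Act MoveL)
    (Seq (Act (Guess d)) (Seq (Act (Test d 0 False)) (Seq (Star (sym_body d)) ?p1))))))"
  have sem: "sem (word g) ?p (i, \<rho>) s' \<longleftrightarrow> (\<exists>\<rho>'. sem (word g) (Star (sym_body d)) (0, \<rho>(d := 0))
      (\<rho>' a, \<rho>') \<and>
      \<rho>' d = \<rho>' a \<and> inp (word g) (\<rho>' a) = Some y \<and> s' = (\<rho>' a, \<rho>'))"
    if "start_ok g (i, \<rho>)" for g i \<rho> s'
  proof -
    let ?x = "word g" and ?r = "Seq (Act (Guess d)) (Seq (Act (Test d 0 False)) (Seq (Star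
        (sym_body d)) ?p1))"
    have "sem ?x ?p (i, \<rho>) s' \<longleftrightarrow> sem ?x ?r (0, \<rho>) s'"
      using that by (intro sem_rewind) (simp add: start_ok_def)
    also have "\<dots> \<longleftrightarrow> sem ?x (Seq (Star (sym_body d)) ?p1) (0, \<rho>(d := 0)) s'"
      unfolding sem_Seq_Guess sem_Seq_Test using that assms(2)
      by (auto simp: start_ok_def ok_def simp del: sem.simps)
    also have "\<dots> \<longleftrightarrow> (\<exists>i \<rho>'. sem ?x (Star (sym_body d)) (0, \<rho>(d := 0)) (i, \<rho>') \<and>
      \<rho>' d = \<rho>' a \<and> inp (word g) i = Some y \<and> s' = (i, \<rho>'))"
      unfolding sem_Seq[of _ "Star (sym_body d)"] sem_Seq_Test by auto
    finally have *: "sem ?x ?p (i, \<rho>) s' \<longleftrightarrow> (\<exists>i \<rho>'. sem ?x (Star (sym_body d)) (0, \<rho>(d := 0)) (i, \<rho>') \<and>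
      \<rho>' d = \<rho>' a \<and> inp (word g) i = Some y \<and> s' = (i, \<rho>'))" .
    have "sem ?x (Star (sym_body d)) (0, \<rho>(d := 0)) (i, \<rho>') \<Longrightarrow> i = \<rho>' d" for i \<rho>'
      using sym_star_sound[of ?x d "\<rho>(d := 0)" i \<rho>'] by simp
    then show ?thesis unfolding * by metis
  qed
  have "decides d ?p (\<lambda>g \<rho>. inp (word g) (\<rho> a) = Some y)"
    unfolding decides_def
  proof (intro allI impI, intro conjI allI impI)
    fix g s s' assume g: "valid g" "start_ok g s" and s': "sem (word g) ?p s s'"
    obtain i \<rho> where s: "s = (i, \<rho>)" by (cases s)
    from s' sem[OF g(2)[unfolded s]] obtain \<rho>' where
      r: "sem (word g) (Star (sym_body d)) (0, \<rho>(d := 0)) (\<rho>' a, \<rho>')"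
      "inp (word g) (\<rho>' a) = Some y" "s' = (\<rho>' a, \<rho>')" unfolding s by blast
    from sym_star_sound[of "word g" d "\<rho>(d := 0)"] r(1) have "agree d \<rho> \<rho>'" by (simp add: agree_upd)
    with r agreeD[OF this assms(1)] show "inp (word g) (snd s a) = Some y" "agree d (snd s) (snd s')"
      unfolding s by auto
  next
    fix g s assume g: "valid g" "start_ok g s" and *: "inp (word g) (snd s a) = Some y"
    obtain i \<rho> where s: "s = (i, \<rho>)" by (cases s)
    from inp_Some_imp[OF *] sym_star_complete[of "\<rho> a" "word g" "\<rho>(d := 0)" d] obtain \<rho>' where
      r: "sem (word g) (Star (sym_body d)) (0, \<rho>(d := 0)) (\<rho> a, \<rho>')" "\<rho>' d = \<rho> a" unfolding s by auto
    from sym_star_sound[of "word g" d "\<rho>(d := 0)"] r(1) have "agree d \<rho> \<rho>'" by (simp add: agree_upd)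
    from agreeD[OF this assms(1)] r * have "sem (word g) ?p (i, \<rho>) (\<rho> a, \<rho>')"
      unfolding sem[OF g(2)[unfolded s]] s by (intro exI[of _ \<rho>']) (simp del: sem.simps)
    then show "\<exists>s'. sem (word g) ?p s s'" unfolding s by blast
  qed
  then show ?thesis using assms unfolding definable_def local_pred_def agree_def by auto
qed

subsection \<open>Arithmetic\<close>

text \<open>With this condition a predicate can take its bound variables as plain values instead of
  naming the registers that hold them.\<close>

definition indep :: "nat \<Rightarrow> (env \<Rightarrow> 'a) \<Rightarrow> bool" where
  "indep d f \<longleftrightarrow> (\<forall>\<rho> r u. d \<le> r \<longrightarrow> f (\<rho>(r := u)) = f \<rho>)"

lemma indepD: "indep d f \<Longrightarrow> d \<le> r \<Longrightarrow> f (\<rho>(r := u)) = f \<rho>"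
  by (simp add: indep_def)

lemma definable_ex':
  assumes "definable (Suc d) (\<lambda>g \<rho>. P g \<rho> (\<rho> d))" "\<And>g. indep d (P g)" "2 \<le> d"
  shows "definable d (\<lambda>g \<rho>. \<exists>a<lim g. P g \<rho> a)"
  by (rule definable_cong[OF definable_ex[OF assms(1,3)]]) (simp add: indepD[OF assms(2)])

text \<open>The closure computed by \<open>tc\<close>, free of registers. The bound \<open>m\<close>
  is imposed on the targets of steps only; bounds on the starting pair are stated where it is
  chosen.\<close>

definition tcr :: "nat \<Rightarrow> (nat \<Rightarrow> nat \<Rightarrow> nat \<Rightarrow> nat \<Rightarrow> bool) \<Rightarrow> nat \<times> nat \<Rightarrow> nat \<times> nat \<Rightarrow> bool" where
  "tcr m R = (\<lambda>s t. fst t < m \<and> snd t < m \<and> R (fst s) (snd s) (fst t) (snd t))\<^sup>*\<^sup>*"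

lemma tcr_refl [simp]: "tcr m R s s"
  by (simp add: tcr_def)

lemma tcr_step: "tcr m R s (a, b) \<Longrightarrow> R a b a' b' \<Longrightarrow> a' < m \<Longrightarrow> b' < m \<Longrightarrow> tcr m R s (a', b')"
  unfolding tcr_def by (erule rtranclp.rtrancl_into_rtrancl) simp

lemma tcr_step': "R a b a' b' \<Longrightarrow> a' < m \<Longrightarrow> b' < m \<Longrightarrow> tcr m R (a', b') t \<Longrightarrow> tcr m R (a, b) t"
  unfolding tcr_def by (erule converse_rtranclp_into_rtranclp[rotated]) simp

lemma tcr_induct [consumes 1, case_names base step]:
  assumes "tcr m R (a, b) (a', b')" "P a b"
    "\<And>c d c' d'. P c d \<Longrightarrow> R c d c' d' \<Longrightarrow> c' < m \<Longrightarrow> d' < m \<Longrightarrow> P c' d'"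
  shows "P a' b'"
  using assms(1) unfolding tcr_def
  by (induction "(a', b')" arbitrary: a' b' rule: rtranclp_induct) (use assms(2,3) in auto)

lemma definable_tcr:
  assumes "definable (d + 2) (\<lambda>g \<rho>. I g \<rho> (\<rho> d) (\<rho> (d + 1)))"
    "definable (d + 4) (\<lambda>g \<rho>. R g \<rho> (\<rho> d) (\<rho> (d + 1)) (\<rho> (d + 2)) (\<rho> (d + 3)))"
    "definable (d + 2) (\<lambda>g \<rho>. F g \<rho> (\<rho> d) (\<rho> (d + 1)))"
    "\<And>g. indep d (I g)" "\<And>g. indep d (R g)" "\<And>g. indep d (F g)" "2 \<le> d"
  shows "definable d (\<lambda>g \<rho>. \<exists>a b a' b'. a < lim g \<and> b < lim g \<and> I g \<rho> a b \<and>
    tcr (lim g) (R g \<rho>) (a, b) (a', b') \<and> F g \<rho> a' b')"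
proof (rule definable_cong[OF definable_tc[OF assms(1,2,3,7)]])
  fix g \<rho>
  have "tc_step d (\<lambda>g \<rho>. R g \<rho> (\<rho> d) (\<rho> (d + 1)) (\<rho> (d + 2)) (\<rho> (d + 3))) g \<rho> =
    (\<lambda>s t. fst t < lim g \<and> snd t < lim g \<and> R g \<rho> (fst s) (snd s) (fst t) (snd t))"
    by (auto simp: fun_eq_iff tc_step_def indepD[OF assms(5)])
  then show "tc d (\<lambda>g \<rho>. I g \<rho> (\<rho> d) (\<rho> (d + 1))) (\<lambda>g \<rho>. R g \<rho> (\<rho> d) (\<rho> (d + 1)) (\<rho> (d + 2)) (\<rho> (d + 3)))
     (\<lambda>g \<rho>. F g \<rho> (\<rho> d) (\<rho> (d + 1))) g \<rho> \<longleftrightarrow>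
    (\<exists>a b a' b'. a < lim g \<and> b < lim g \<and> I g \<rho> a b \<and> tcr (lim g) (R g \<rho>) (a, b) (a', b') \<and> F g \<rho> a' b')"
    unfolding tc_def tcr_def by (auto simp: indepD[OF assms(4)] indepD[OF assms(6)])
qed

text \<open>These rules let \<open>intro\<close> compile a formula along its syntax. Atoms take
  registers as arguments, so the intermediate values of compound terms are named by bounded
  existential quantifiers.\<close>

named_theorems dfn
lemmas [dfn] = definable_conj definable_disj definable_eq definable_Suc definable_zero definable_end definable_sym

lemma ok_less: "ok g \<rho> \<Longrightarrow> \<rho> r < lim g"
  by (simp add: ok_def)

lemma definable_add [dfn]:
  assumes "a < d" "b < d" "c < d" "2 \<le> d"
  shows "definable d (\<lambda>g \<rho>. \<rho> a + \<rho> b = \<rho> c)"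
proof (rule definable_cong)
  let ?R = "\<lambda>i j i' j'. i' = Suc i \<and> j' = Suc j"
  show "definable d (\<lambda>g \<rho>. \<exists>s0 s1 t0 t1. s0 < lim g \<and> s1 < lim g \<and> (s0 = \<rho> a \<and> s1 = 0) \<and>
    tcr (lim g) ?R (s0, s1) (t0, t1) \<and> (t0 = \<rho> c \<and> t1 = \<rho> b))"
    using assms by (intro definable_tcr dfn) (auto simp: indep_def)
  fix g \<rho> assume ok: "ok g \<rho>"
  have "tcr (lim g) ?R (i, 0) (i', j') \<Longrightarrow> i' = i + j'" for i i' j'
    by (erule tcr_induct) auto
  moreover have "\<rho> a + j < lim g \<Longrightarrow> tcr (lim g) ?R (\<rho> a, 0) (\<rho> a + j, j)" for j
    by (induction j) (auto intro: tcr_step)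
  then have "\<rho> a + \<rho> b = \<rho> c \<Longrightarrow> tcr (lim g) ?R (\<rho> a, 0) (\<rho> c, \<rho> b)"
    using ok_less[OF ok, of c] by metis
  ultimately show "(\<exists>s0 s1 t0 t1. s0 < lim g \<and> s1 < lim g \<and> (s0 = \<rho> a \<and> s1 = 0) \<and>
      tcr (lim g) ?R (s0, s1) (t0, t1) \<and> (t0 = \<rho> c \<and> t1 = \<rho> b)) \<longleftrightarrow> \<rho> a + \<rho> b = \<rho> c"
    using ok ok_less[OF ok, of a] by auto
qed

lemma definable_le [dfn]:
  assumes "a < d" "b < d" "2 \<le> d"
  shows "definable d (\<lambda>g \<rho>. \<rho> a \<le> \<rho> b)"
proof (rule definable_cong)
  show "definable d (\<lambda>g \<rho>. \<exists>u<lim g. \<rho> a + u = \<rho> b)"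
    using assms by (intro definable_ex' dfn) (auto simp: indep_def)
  show "(\<exists>u<lim g. \<rho> a + u = \<rho> b) \<longleftrightarrow> \<rho> a \<le> \<rho> b" if "ok g \<rho>" for g \<rho>
    using ok_less[OF that, of b] by (auto intro!: exI[of _ "\<rho> b - \<rho> a"])
qed

lemma definable_less [dfn]:
  assumes "a < d" "b < d" "2 \<le> d"
  shows "definable d (\<lambda>g \<rho>. \<rho> a < \<rho> b)"
proof (rule definable_cong)
  show "definable d (\<lambda>g \<rho>. \<exists>u<lim g. u = Suc (\<rho> a) \<and> u \<le> \<rho> b)"
    using assms by (intro definable_ex' dfn) (auto simp: indep_def)
  show "(\<exists>u<lim g. u = Suc (\<rho> a) \<and> u \<le> \<rho> b) \<longleftrightarrow> \<rho> a < \<rho> b" if "ok g \<rho>" for g \<rho>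
    using ok_less[OF that, of b] by (auto simp: Suc_le_eq)
qed

text \<open>Negation is avoided by the linear order: one of the two numbers is smaller.\<close>

lemma definable_neq [dfn]:
  assumes "a < d" "b < d" "2 \<le> d"
  shows "definable d (\<lambda>g \<rho>. \<rho> a \<noteq> \<rho> b)"
  using definable_disj[OF definable_less[of a d b] definable_less[of b d a]] assms
  by (simp add: neq_iff)

text \<open>Repeated addition. The partial products stay below the final one, so a product that fits
  into a register is never lost on the way.\<close>

lemma definable_mult [dfn]:
  assumes "a < d" "b < d" "c < d" "2 \<le> d"
  shows "definable d (\<lambda>g \<rho>. \<rho> a * \<rho> b = \<rho> c)"
proof (rule definable_cong)
  let ?R = "\<lambda>\<rho> i j i' j'. i' = Suc i \<and> j + \<rho> b = j'"
  show "definable d (\<lambda>g \<rho>. \<exists>s0 s1 t0 t1. s0 < lim g \<and> s1 < lim g \<and> (s0 = 0 \<and> s1 = 0) \<and>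
    tcr (lim g) (?R \<rho>) (s0, s1) (t0, t1) \<and> (t0 = \<rho> a \<and> t1 = \<rho> c))"
    using assms by (intro definable_tcr dfn) (auto simp: indep_def)
  fix g \<rho> assume ok: "ok g \<rho>"
  have "tcr (lim g) (?R \<rho>) (0, 0) (i, j) \<Longrightarrow> j = i * \<rho> b" for i j
    by (erule tcr_induct) auto
  moreover have "i < lim g \<Longrightarrow> i * \<rho> b < lim g \<Longrightarrow> tcr (lim g) (?R \<rho>) (0, 0) (i, i * \<rho> b)" for i
    by (induction i) (auto intro: tcr_step)
  then have "\<rho> a * \<rho> b = \<rho> c \<Longrightarrow> tcr (lim g) (?R \<rho>) (0, 0) (\<rho> a, \<rho> c)"
    using ok_less[OF ok, of a] ok_less[OF ok, of c] by metis
  ultimately show "(\<exists>s0 s1 t0 t1. s0 < lim g \<and> s1 < lim g \<and> (s0 = 0 \<and> s1 = 0) \<and>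
    tcr (lim g) (?R \<rho>) (s0, s1) (t0, t1) \<and> (t0 = \<rho> a \<and> t1 = \<rho> c)) \<longleftrightarrow> \<rho> a * \<rho> b = \<rho> c"
    using ok ok_less[OF ok, of 0] by (auto simp: ok_def)
qed

lemma card_less_Suc_filter:
  "card {u. u < Suc i \<and> Q u} = card {u. u < i \<and> Q u} + of_bool (Q i)"
proof -
  have "{u. u < Suc i \<and> Q u} = (if Q i then insert i {u. u < i \<and> Q u} else {u. u < i \<and> Q u})"
    by (auto simp: less_Suc_eq)
  then show ?thesis by simp
qed

text \<open>The counter \<open>j\<close> may grow at \<open>i\<close> only if \<open>Q\<close> is
  confirmed there, and it may always stay. So exactly the \<open>j\<close> up to the true count are
  reachable: lower bounds on counts are certified, upper bounds are not. \<open>Q\<close> is run at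
  depth \<open>d + 4\<close> because it occurs within a step between two pairs, with the current
  element in register \<open>d\<close>.\<close>

lemma definable_atleast:
  assumes "definable (d + 4) (\<lambda>g \<rho>. Q g \<rho> (\<rho> d))" "\<And>g. indep d (Q g)" "b < d" "c < d" "2 \<le> d"
  shows "definable d (\<lambda>g \<rho>. \<rho> c \<le> card {u. u < \<rho> b \<and> Q g \<rho> u})"
proof (rule definable_cong)
  let ?R = "\<lambda>g \<rho> i j i' j'. i' = Suc i \<and> (j' = j \<or> j' = Suc j \<and> Q g \<rho> i)"
  show "definable d (\<lambda>g \<rho>. \<exists>s0 s1 t0 t1. s0 < lim g \<and> s1 < lim g \<and> (s0 = 0 \<and> s1 = 0) \<and>
    tcr (lim g) (?R g \<rho>) (s0, s1) (t0, t1) \<and> (t0 = \<rho> b \<and> t1 = \<rho> c))"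
    using assms(3-5) by (intro definable_tcr dfn assms(1)) (auto simp: indep_def indepD[OF assms(2)])
  fix g \<rho> assume ok: "ok g \<rho>"
  have "tcr (lim g) (?R g \<rho>) (0, 0) (i, j) \<Longrightarrow> j \<le> card {u. u < i \<and> Q g \<rho> u}" for i j
    by (erule tcr_induct) (auto simp: card_less_Suc_filter)
  moreover have "i < lim g \<Longrightarrow> j < lim g \<Longrightarrow> j \<le> card {u. u < i \<and> Q g \<rho> u} \<Longrightarrow> tcr (lim g) (?R g \<rho>)
      (0, 0) (i, j)" for i j
  proof (induction i arbitrary: j)
    case (Suc i)
    show ?case
    proof (cases "j \<le> card {u. u < i \<and> Q g \<rho> u}")
      case True
      with Suc.IH[of j] Suc.prems have "tcr (lim g) (?R g \<rho>) (0, 0) (i, j)" by simp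
      then show ?thesis by (rule tcr_step) (use Suc.prems in auto)
    next
      case False
      with Suc.prems(3) have "Q g \<rho> i" "j = Suc (card {u. u < i \<and> Q g \<rho> u})"
        by (auto simp: card_less_Suc_filter of_bool_def split: if_splits)
      with Suc.IH[of "j - 1"] Suc.prems have "tcr (lim g) (?R g \<rho>) (0, 0) (i, j - 1)" by simp
      then show ?thesis by (rule tcr_step) (use Suc.prems \<open>Q g \<rho> i\<close> \<open>j = _\<close> in auto)
    qed
  qed simp
  ultimately have *: "tcr (lim g) (?R g \<rho>) (0, 0) (\<rho> b, \<rho> c) \<longleftrightarrow> \<rho> c \<le> card {u. u < \<rho> b \<and> Q g \<rho> u}"
    using ok_less[OF ok] by blast
  have "0 < lim g" using ok_less[OF ok, of 0] by simp
  then show "(\<exists>s0 s1 t0 t1. s0 < lim g \<and> s1 < lim g \<and> (s0 = 0 \<and> s1 = 0) \<and>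
    tcr (lim g) (?R g \<rho>) (s0, s1) (t0, t1) \<and> (t0 = \<rho> b \<and> t1 = \<rho> c)) \<longleftrightarrow> \<rho> c \<le> card {u. u < \<rho> b \<and> Q g \<rho> u}"
    unfolding *[symmetric] by blast
qed

lemma card_filter_full: "(n :: nat) \<le> card {u. u < n \<and> Q u} \<longleftrightarrow> (\<forall>u<n. Q u)"
proof
  assume "n \<le> card {u. u < n \<and> Q u}"
  moreover have sub: "{u. u < n \<and> Q u} \<subseteq> {..<n}" by auto
  ultimately have "{u. u < n \<and> Q u} = {..<n}"
    by (intro card_subset_eq) (auto intro: antisym[OF card_mono[OF _ sub, simplified]])
  then show "\<forall>u<n. Q u" by auto
next
  assume "\<forall>u<n. Q u"
  then have "{u. u < n \<and> Q u} = {..<n}" by auto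
  then show "n \<le> card {u. u < n \<and> Q u}" by simp
qed

text \<open>A universal statement below \<open>n\<close> says that at least \<open>n\<close>
  elements below \<open>n\<close> qualify, so it too has a positive certificate.\<close>

lemma definable_all:
  assumes "definable (d + 4) (\<lambda>g \<rho>. Q g \<rho> (\<rho> d))" "\<And>g. indep d (Q g)" "b < d" "2 \<le> d"
  shows "definable d (\<lambda>g \<rho>. \<forall>u<\<rho> b. Q g \<rho> u)"
  using definable_atleast[OF assms(1-3,3,4)] by (simp only: card_filter_full)

subsection \<open>Decoding the input\<close>

definition bits_val :: "sym list \<Rightarrow> nat" where
  "bits_val = foldl (\<lambda>a s. 2 * a + of_bool (s = One)) 0"

lemma bits_val_snoc: "bits_val (xs @ [s]) = 2 * bits_val xs + of_bool (s = One)"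
  by (simp add: bits_val_def)

declare bin.simps [simp del]

lemma bits_val_bin: "bits_val (bin k) = k"
proof (induction k rule: bin.induct)
  case (1 k)
  show ?case
  proof (cases "k < 2")
    case True
    then show ?thesis by (subst bin.simps) (auto simp: bits_val_def)
  next
    case False
    then have "bits_val (bin k) = 2 * (k div 2) + of_bool (odd k)"
      using 1 by (subst bin.simps) (simp add: bits_val_snoc)
    then show ?thesis by simp
  qed
qed

lemma Sep_notin_bin: "Sep \<notin> set (bin k)"
proof (induction k rule: bin.induct)
  case (1 k)
  then show ?case by (subst bin.simps) auto
qed

lemma concat_rows_nth:
  assumes "i < m" "j < n"
  shows "concat (map (\<lambda>i. map (f i) [0..<n]) [0..<m]) ! (i * n + j) = f i j"
  using assms
proof (induction m)
  case (Suc m)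
  have len: "length (concat (map (\<lambda>i. map (f i) [0..<n]) [0..<m])) = m * n" for m
    by (induction m) auto
  show ?case
  proof (cases "i = m")
    case True
    with Suc.prems len[of m] show ?thesis by (simp add: nth_append)
  next
    case False
    with Suc.prems have "i < m" by simp
    then have "i * n + j < m * n"
      using Suc.prems(2) mult_le_mono1[of "Suc i" m n] by simp
    with Suc \<open>i < m\<close> len[of m] show ?thesis by (simp add: nth_append)
  qed
qed simp

lemma length_enc_graph: "length (enc_graph n E) = n * n"
proof -
  have "length (concat (map (\<lambda>i. map (f i) [0..<n]) [0..<m])) = m * n" for f :: "nat \<Rightarrow> nat \<Rightarrow> sym" and m
    by (induction m) auto
  then show ?thesis unfolding enc_graph_def by simp
qed

lemma enc_graph_nth: "i < n \<Longrightarrow> j < n \<Longrightarrow> enc_graph n E ! (i * n + j) = (if E i j then One else Zero)"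
  unfolding enc_graph_def by (rule concat_rows_nth)

lemma Sep_notin_enc_graph: "Sep \<notin> set (enc_graph n E)"
  by (auto simp: enc_graph_def)


lemma bits_val_mono: "bits_val xs \<le> bits_val (xs @ ys)"
proof (induction ys rule: rev_induct)
  case (snoc s ys)
  then show ?case using bits_val_snoc[of "xs @ ys" s] by simp
qed simp

text \<open>The tape positions of the two separators, counted from 1. \<open>seg1\<close> later
  serves as a bound on walk lengths as well.\<close>

definition seg1 :: "inst \<Rightarrow> nat" where "seg1 g = gn g * gn g + 1"
definition seg2 :: "inst \<Rightarrow> nat" where "seg2 g = seg1 g + length (bin (gv g)) + 1"

lemma word_eq: "word g = enc_graph (gn g) (gE g) @ Sep # bin (gv g) @ Sep # bin (gw g)"
  by (simp add: word_def enc_input_def)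

lemma length_word: "length (word g) = seg2 g + length (bin (gw g))"
  by (simp add: word_eq length_enc_graph seg1_def seg2_def)

lemma seg_less: "seg1 g < seg2 g" "seg2 g \<le> length (word g)" "length (word g) + 1 < lim g"
    "seg2 g < lim g" "seg1 g < lim g"
  using cap_gt[of "word g"] by (auto simp: length_word seg2_def)

lemma inp_append:
  "inp (xs @ ys) i = (if i \<le> length xs then inp xs i else inp ys (i - length xs))"
  by (auto simp: inp_def nth_append)

lemma inp_Sep_notin: "Sep \<notin> set xs \<Longrightarrow> 1 \<le> i \<Longrightarrow> i \<le> length xs \<Longrightarrow> inp xs i = Some Zero \<or> inp xs i = Some One"
proof -
  assume *: "Sep \<notin> set xs" "1 \<le> i" "i \<le> length xs"
  then have "i - 1 < length xs" by linarith
  from nth_mem[OF this] *(1) have "xs ! (i - 1) \<noteq> Sep" by metis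
  with * show ?thesis unfolding inp_def by (cases "xs ! (i - 1)") simp_all
qed

lemma inp_seg1: "inp (word g) (seg1 g) = Some Sep"
  by (simp add: word_eq inp_append length_enc_graph seg1_def) (simp add: inp_def)

lemma inp_seg2: "inp (word g) (seg2 g) = Some Sep"
  by (simp add: word_eq inp_def length_enc_graph seg1_def seg2_def nth_append)

lemma inp_graph:
  assumes "1 \<le> i" "i < seg1 g"
  shows "inp (word g) i = inp (enc_graph (gn g) (gE g)) i"
  using assms by (simp add: word_eq inp_append length_enc_graph seg1_def)

lemma inp_v:
  assumes "k < length (bin (gv g))"
  shows "inp (word g) (Suc (seg1 g) + k) = Some (bin (gv g) ! k)"
  using assms by (simp add: word_eq inp_def length_enc_graph seg1_def nth_append)

lemma inp_w:
  assumes "k < length (bin (gw g))"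
  shows "inp (word g) (Suc (seg2 g) + k) = Some (bin (gw g) ! k)"
  using assms by (simp add: word_eq inp_def length_enc_graph seg1_def seg2_def nth_append)

lemma bits_before_seg1:
  assumes "1 \<le> i" "i < seg1 g"
  shows "inp (word g) i = Some Zero \<or> inp (word g) i = Some One"
  unfolding inp_graph[OF assms] using assms
  by (intro inp_Sep_notin Sep_notin_enc_graph) (auto simp: length_enc_graph seg1_def)

lemma nth_bin: "k < length (bin v) \<Longrightarrow> bin v ! k \<noteq> Sep"
  using nth_mem[of k "bin v"] Sep_notin_bin[of v] by metis

lemma bits_before_seg2:
  assumes "seg1 g < i" "i < seg2 g"
  shows "inp (word g) i = Some Zero \<or> inp (word g) i = Some One"
proof -
  have "i - Suc (seg1 g) < length (bin (gv g))" "Suc (seg1 g) + (i - Suc (seg1 g)) = i"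
    using assms by (auto simp: seg2_def)
  then show ?thesis using inp_v[of "i - Suc (seg1 g)" g] nth_bin[of "i - Suc (seg1 g)" "gv g"]
    by (cases "bin (gv g) ! (i - Suc (seg1 g))") simp_all
qed

text \<open>Being the first separator is expressed positively: every earlier position carries a bit.
  Position 0 is exempted, as it holds the end marker.\<close>

lemma definable_seg1 [dfn]:
  assumes "a < d" "2 \<le> d"
  shows "definable d (\<lambda>g \<rho>. \<rho> a = seg1 g)"
proof (rule definable_cong)
  let ?bit = "\<lambda>g u. inp (word g) u = Some Zero \<or> inp (word g) u = Some One"
  show "definable d (\<lambda>g \<rho>. inp (word g) (\<rho> a) = Some Sep \<and> (\<forall>u<\<rho> a. u = 0 \<or> ?bit g u))"
    using assms by (intro definable_all dfn) (auto simp: indep_def)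
  show "inp (word g) (\<rho> a) = Some Sep \<and> (\<forall>u<\<rho> a. u = 0 \<or> ?bit g u) \<longleftrightarrow> \<rho> a = seg1 g" for g \<rho>
  proof
    assume *: "inp (word g) (\<rho> a) = Some Sep \<and> (\<forall>u<\<rho> a. u = 0 \<or> ?bit g u)"
    then have "\<not> seg1 g < \<rho> a" using inp_seg1[of g] by (auto simp: seg1_def)
    moreover have "\<not> \<rho> a < seg1 g" using * bits_before_seg1[of "\<rho> a" g] inp_Some_imp[of "word g"
        "\<rho> a"] by auto
    ultimately show "\<rho> a = seg1 g" by simp
  next
    assume "\<rho> a = seg1 g"
    with inp_seg1[of g] bits_before_seg1[of _ g] show "inp (word g) (\<rho> a) = Some Sep \<and> (\<forall>u<\<rho> a. u
        = 0 \<or> ?bit g u)"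
      by (metis One_nat_def Suc_leI neq0_conv)
  qed
qed

lemma definable_seg2 [dfn]:
  assumes "a < d" "2 \<le> d"
  shows "definable d (\<lambda>g \<rho>. \<rho> a = seg2 g)"
proof (rule definable_cong)
  let ?bit = "\<lambda>g u. inp (word g) u = Some Zero \<or> inp (word g) u = Some One"
  let ?P = "\<lambda>g \<rho>. \<exists>s<lim g. s = seg1 g \<and> s < \<rho> a \<and> inp (word g) (\<rho> a) = Some Sep \<and> (\<forall>u<\<rho> a. u \<le> s \<or>
      ?bit g u)"
  show "definable d ?P"
    using assms by (intro definable_ex' definable_all dfn) (auto simp: indep_def)
  show "?P g \<rho> \<longleftrightarrow> \<rho> a = seg2 g" for g \<rho>
  proof
    assume *: "?P g \<rho>"
    then have "\<not> seg2 g < \<rho> a" using inp_seg2[of g] seg_less(1)[of g] by auto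
    moreover have "\<not> \<rho> a < seg2 g" using * bits_before_seg2[of g "\<rho> a"] by auto
    ultimately show "\<rho> a = seg2 g" by simp
  next
    assume "\<rho> a = seg2 g"
    with inp_seg2[of g] bits_before_seg2[of g] seg_less(1,5)[of g] show "?P g \<rho>"
      by (metis not_le)
  qed
qed

text \<open>The input does not contain the number of vertices; it is recovered as the square root of
  the length of the adjacency matrix.\<close>

lemma definable_gn [dfn]:
  assumes "a < d" "2 \<le> d"
  shows "definable d (\<lambda>g \<rho>. \<rho> a = gn g)"
proof (rule definable_cong)
  let ?P = "\<lambda>g \<rho>. \<exists>s<lim g. \<exists>p<lim g. s = seg1 g \<and> s = Suc p \<and> \<rho> a * \<rho> a = p"
  show "definable d ?P"
    using assms by (intro definable_ex' dfn) (auto simp: indep_def)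
  show "?P g \<rho> \<longleftrightarrow> \<rho> a = gn g" for g \<rho>
    using seg_less(5)[of g] power2_eq_iff_nonneg[of "\<rho> a" "gn g"] by (auto
        simp: seg1_def power2_eq_square)
qed

text \<open>Horner's scheme from the most significant digit. Prefixes never have larger values than
  the whole string, so all accumulated values stay below \<open>m\<close>; \<open>e\<close> is the
  doubled value before a digit \<open>One\<close> is added.\<close>

lemma bits_run_iff:
  assumes bits: "\<And>k. k < length b \<Longrightarrow> inp x (Suc l + k) = Some (b ! k) \<and> b ! k \<noteq> Sep"
    and h: "h = Suc l + length b" "h < m" "bits_val b < m"
  shows "tcr m (\<lambda>i j i' j'. i < h \<and> i' = Suc i \<and> (inp x i = Some Zero \<and> j + j = j' \<or>
      inp x i = Some One \<and> (\<exists>e<m. j + j = e \<and> j' = Suc e))) (Suc l, 0) (h, a) \<longleftrightarrow> a = bits_val b"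
    (is "tcr m ?R _ _ \<longleftrightarrow> _")
proof -
  have take: "bits_val (take (Suc k) b) = 2 * bits_val (take k b) + of_bool (b ! k
      = One)" if "k < length b" for k
    using that bits_val_snoc[of "take k b" "b ! k"] by (simp add: take_Suc_conv_app_nth)
  have lim: "bits_val (take k b) < m" for k
    using bits_val_mono[of "take k b" "drop k b"] h(3) by simp
  have "Suc l \<le> i \<and> i \<le> h \<and> j = bits_val (take (i - Suc l) b)" if "tcr m ?R (Suc l, 0) (i, j)" for i j
    using that
  proof (induction rule: tcr_induct)
    case base
    show ?case using h by (simp add: bits_val_def)
  next
    case (step i j i' j')
    then have k: "i - Suc l < length b" "Suc l + (i - Suc l) = i" "i' - Suc l = Suc (i - Suc l)"
        using h(1) by auto
    from bits[OF k(1)] take[OF k(1)] step show ?case unfolding k by (cases "b ! (i - Suc l)") auto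
  qed
  from this[of h a] have "tcr m ?R (Suc l, 0) (h, a) \<Longrightarrow> a = bits_val b" using h by simp
  moreover have "tcr m ?R (Suc l, 0) (Suc l + k, bits_val (take k b))" if "k \<le> length b" for k
    using that
  proof (induction k)
    case 0
    show ?case by (simp add: bits_val_def)
  next
    case (Suc k)
    then have k: "k < length b" by simp
    from Suc have "tcr m ?R (Suc l, 0) (Suc l + k, bits_val (take k b))" by simp
    then show ?case
      by (rule tcr_step) (use bits[OF k] take[OF k] lim[of "Suc k"] lim[of k] k h in \<open>cases "b ! k"; simp\<close>)+
  qed
  from this[of "length b"] have "tcr m ?R (Suc l, 0) (h, bits_val b)" using h by simp
  ultimately show ?thesis by blast
qed

lemma definable_bits:
  assumes "a < d" "l < d" "h < d" "2 \<le> d"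
  shows "definable d (\<lambda>g \<rho>. tcr (lim g) (\<lambda>i j i' j'. i < \<rho> h \<and> i' = Suc i \<and> (inp (word g) i
      = Some Zero \<and> j + j = j' \<or>
      inp (word g) i = Some One \<and> (\<exists>e<lim g. j + j = e \<and> j' = Suc e))) (Suc (\<rho> l), 0) (\<rho> h, \<rho> a) \<and>
          Suc (\<rho> l) < lim g)"
proof (rule definable_cong)
  let ?R = "\<lambda>g \<rho> i j i' j'. i < \<rho> h \<and> i' = Suc i \<and> (inp (word g) i = Some Zero \<and> j + j = j' \<or>
      inp (word g) i = Some One \<and> (\<exists>e<lim g. j + j = e \<and> j' = Suc e))"
  show "definable d (\<lambda>g \<rho>. \<exists>s0 s1 t0 t1. s0 < lim g \<and> s1 < lim g \<and> (s0 = Suc (\<rho> l) \<and> s1 = 0) \<and>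
    tcr (lim g) (?R g \<rho>) (s0, s1) (t0, t1) \<and> (t0 = \<rho> h \<and> t1 = \<rho> a))"
    using assms by (intro definable_tcr definable_ex' dfn) (auto simp: indep_def)
  fix g \<rho> assume "ok g \<rho>"
  then have "0 < lim g" using ok_less[of g \<rho> 0] by simp
  then show "(\<exists>s0 s1 t0 t1. s0 < lim g \<and> s1 < lim g \<and> (s0 = Suc (\<rho> l) \<and> s1 = 0) \<and>
    tcr (lim g) (?R g \<rho>) (s0, s1) (t0, t1) \<and> (t0 = \<rho> h \<and> t1 = \<rho> a)) \<longleftrightarrow>
    tcr (lim g) (?R g \<rho>) (Suc (\<rho> l), 0) (\<rho> h, \<rho> a) \<and> Suc (\<rho> l) < lim g" by blast
qed

lemma gn_less: "gn g < lim g"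
proof -
  have "gn g \<le> gn g * gn g" by simp
  then show ?thesis using seg_less(5)[of g] unfolding seg1_def by linarith
qed

lemma definable_gv [dfn]:
  assumes "a < d" "2 \<le> d"
  shows "definable d (\<lambda>g \<rho>. \<rho> a = gv g)"
proof (rule definable_cong)
  let ?R = "\<lambda>g h i j i' j'. i < h \<and> i' = Suc i \<and> (inp (word g) i = Some Zero \<and> j + j = j' \<or>
      inp (word g) i = Some One \<and> (\<exists>e<lim g. j + j = e \<and> j' = Suc e))"
  let ?P = "\<lambda>g \<rho>. \<exists>l<lim g. \<exists>h<lim g. l = seg1 g \<and> h = seg2 g \<and>
     tcr (lim g) (?R g h) (Suc l, 0) (h, \<rho> a) \<and> Suc l < lim g"
  show "definable d ?P"
    using assms by (intro definable_ex' definable_bits dfn) (auto simp: indep_def)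
  fix g :: inst and \<rho> assume "valid g"
  then have "bits_val (bin (gv g)) < lim g" using gn_less[of g] by (simp add: bits_val_bin valid_def)
  then have "tcr (lim g) (?R g (seg2 g)) (Suc (seg1 g), 0) (seg2 g, \<rho> a) \<longleftrightarrow> \<rho> a = bits_val (bin (gv g))"
    using inp_v[of _ g] nth_bin[of _ "gv g"] seg_less[of g]
    by (intro bits_run_iff) (auto simp: seg2_def)
  then show "?P g \<rho> \<longleftrightarrow> \<rho> a = gv g"
    using seg_less[of g] by (auto simp: bits_val_bin)
qed

lemma definable_gw [dfn]:
  assumes "a < d" "2 \<le> d"
  shows "definable d (\<lambda>g \<rho>. \<rho> a = gw g)"
proof (rule definable_cong)
  let ?R = "\<lambda>g h i j i' j'. i < h \<and> i' = Suc i \<and> (inp (word g) i = Some Zero \<and> j + j = j' \<or>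
      inp (word g) i = Some One \<and> (\<exists>e<lim g. j + j = e \<and> j' = Suc e))"
  let ?P = "\<lambda>g \<rho>. \<exists>l<lim g. \<exists>h<lim g. l = seg2 g \<and> h = length (word g) + 1 \<and>
     tcr (lim g) (?R g h) (Suc l, 0) (h, \<rho> a) \<and> Suc l < lim g"
  show "definable d ?P"
    using assms by (intro definable_ex' definable_bits dfn) (auto simp: indep_def)
  fix g :: inst and \<rho> assume "valid g"
  then have "bits_val (bin (gw g)) < lim g" using gn_less[of g] by (simp add: bits_val_bin valid_def)
  then have "tcr (lim g) (?R g (length (word g) + 1)) (Suc (seg2 g), 0) (length
      (word g) + 1, \<rho> a) \<longleftrightarrow> \<rho> a = bits_val (bin (gw g))"
    using inp_w[of _ g] nth_bin[of _ "gw g"] seg_less[of g]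
    by (intro bits_run_iff) (auto simp: length_word)
  then show "?P g \<rho> \<longleftrightarrow> \<rho> a = gw g"
    using seg_less[of g] by (auto simp: bits_val_bin)
qed

lemma adj_bit:
  assumes "a < gn g" "b < gn g"
  shows "inp (word g) (Suc (a * gn g + b)) = Some (if gE g a b then One else Zero)"
proof -
  have "a * gn g + b < gn g * gn g"
    using assms mult_le_mono1[of "Suc a" "gn g" "gn g"] by simp
  then show ?thesis
    using assms by (subst inp_graph) (auto simp: seg1_def inp_def length_enc_graph enc_graph_nth)
qed

text \<open>Stated for an arbitrary symbol \<open>y\<close>, so that \<open>One\<close> yields
  adjacency and \<open>Zero\<close> its negation. The latter comes with range conditions, since
  outside the matrix there is no symbol to read.\<close>

lemma definable_adj_bit:
  assumes "a < d" "b < d" "2 \<le> d"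
  shows "definable d (\<lambda>g \<rho>. \<rho> a < gn g \<and> \<rho> b < gn g \<and> Some (if gE g (\<rho> a) (\<rho> b) then One else Zero)
      = Some y)"
proof (rule definable_cong)
  let ?P = "\<lambda>g \<rho>. \<exists>n<lim g. \<exists>p<lim g. \<exists>q<lim g. \<exists>r<lim g. n = gn g \<and> \<rho> a < n \<and> \<rho> b < n \<and>
     \<rho> a * n = p \<and> p + \<rho> b = q \<and> r = Suc q \<and> inp (word g) r = Some y"
  show "definable d ?P"
    using assms by (intro definable_ex' dfn) (auto simp: indep_def)
  fix g :: inst and \<rho>
  show "?P g \<rho> \<longleftrightarrow> \<rho> a < gn g \<and> \<rho> b < gn g \<and> Some (if gE g (\<rho> a) (\<rho> b) then One else Zero) = Some y"
  proof (cases "\<rho> a < gn g \<and> \<rho> b < gn g")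
    case True
    then have "\<rho> a * gn g + \<rho> b < gn g * gn g"
      using mult_le_mono1[of "Suc (\<rho> a)" "gn g" "gn g"] by simp
    with seg_less(5)[of g] have "Suc (\<rho> a * gn g + \<rho> b) < lim g" by (simp add: seg1_def)
    then show ?thesis using True adj_bit[of "\<rho> a" g "\<rho> b"] gn_less[of g] by auto
  qed auto
qed

lemma definable_adj [dfn]:
  assumes "a < d" "b < d" "2 \<le> d"
  shows "definable d (\<lambda>g \<rho>. gE g (\<rho> a) (\<rho> b))"
  by (rule definable_cong[OF definable_adj_bit[OF assms, where y = One]])
     (auto simp: valid_def ord_graph_def)

lemma definable_nonadj [dfn]:
  assumes "a < d" "b < d" "2 \<le> d"
  shows "definable d (\<lambda>g \<rho>. \<rho> a < gn g \<and> \<rho> b < gn g \<and> \<not> gE g (\<rho> a) (\<rho> b))"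
  by (rule definable_cong[OF definable_adj_bit[OF assms, where y = Zero]]) auto

section \<open>Walks and inductive counting\<close>

text \<open>The length is exact, not an upper bound, and vertices may repeat; consequently
  \<open>sphere\<close> below is not the set of vertices at a given distance.\<close>

definition walk :: "(nat \<Rightarrow> nat \<Rightarrow> bool) \<Rightarrow> nat \<Rightarrow> nat \<Rightarrow> nat \<Rightarrow> bool" where
  "walk E r a b \<longleftrightarrow> (E ^^ r) a b"

lemma walk_0 [simp]: "walk E 0 a b \<longleftrightarrow> a = b"
  by (auto simp: walk_def)

lemma walk_Suc: "walk E (Suc r) a b \<longleftrightarrow> (\<exists>c. E a c \<and> walk E r c b)"
  unfolding walk_def by (metis relpowp_Suc_D2 relpowp_Suc_I2)

lemma walk_Suc': "walk E (Suc r) a b \<longleftrightarrow> (\<exists>c. walk E r a c \<and> E c b)"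
  unfolding walk_def by auto

lemma ord_graph_less: "ord_graph n E \<Longrightarrow> E a b \<Longrightarrow> a < n \<and> b < n"
  by (auto simp: ord_graph_def)

lemma walk_less: "ord_graph n E \<Longrightarrow> walk E r a b \<Longrightarrow> a < n \<longleftrightarrow> b < n"
  by (induction r arbitrary: a) (auto simp: walk_Suc dest: ord_graph_less)

lemma valid_graph: "valid g \<Longrightarrow> ord_graph (gn g) (gE g)"
  by (simp add: valid_def)

lemma definable_walk [dfn]:
  assumes "r < d" "a < d" "b < d" "2 \<le> d"
  shows "definable d (\<lambda>g \<rho>. walk (gE g) (\<rho> r) (\<rho> a) (\<rho> b))"
proof (rule definable_cong)
  let ?R = "\<lambda>g i j i' j'. gE g i i' \<and> j' = Suc j"
  show "definable d (\<lambda>g \<rho>. \<exists>s0 s1 t0 t1. s0 < lim g \<and> s1 < lim g \<and> (s0 = \<rho> a \<and> s1 = 0) \<and>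
    tcr (lim g) (?R g) (s0, s1) (t0, t1) \<and> (t0 = \<rho> b \<and> t1 = \<rho> r))"
    using assms by (intro definable_tcr dfn) (auto simp: indep_def)
  fix g \<rho> assume g: "valid g" and ok: "ok g \<rho>"
  have "tcr (lim g) (?R g) (i, 0) (i', j) \<Longrightarrow> walk (gE g) j i i'" for i i' j
    by (erule tcr_induct) (auto simp: walk_Suc')
  moreover have "walk (gE g) j i i' \<Longrightarrow> j < lim g \<Longrightarrow> tcr (lim g) (?R g) (i, 0) (i', j)" for i i' j
  proof (induction j arbitrary: i')
    case (Suc j)
    then obtain c where "walk (gE g) j i c" "gE g c i'" by (auto simp: walk_Suc')
    with Suc ord_graph_less[OF valid_graph[OF g] this(2)] gn_less[of g] show ?case
      by (auto intro: tcr_step[of _ _ _ c j])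
  qed simp
  ultimately have "tcr (lim g) (?R g) (\<rho> a, 0) (\<rho> b, \<rho> r) \<longleftrightarrow> walk (gE g) (\<rho> r) (\<rho> a) (\<rho> b)"
    using ok_less[OF ok] by blast
  then show "(\<exists>s0 s1 t0 t1. s0 < lim g \<and> s1 < lim g \<and> (s0 = \<rho> a \<and> s1 = 0) \<and>
    tcr (lim g) (?R g) (s0, s1) (t0, t1) \<and> (t0 = \<rho> b \<and> t1 = \<rho> r)) \<longleftrightarrow> walk (gE g) (\<rho> r) (\<rho> a) (\<rho> b)"
    using ok_less[OF ok, of a] ok_less[OF ok, of 0] by auto
qed

definition sphere :: "inst \<Rightarrow> nat \<Rightarrow> nat \<Rightarrow> nat set" where
  "sphere g a r = {u. u < gn g \<and> walk (gE g) r a u}"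

lemma card_filter_le: "card {u :: nat. u < n \<and> P u} \<le> n"
  using card_mono[of "{..<n}" "{u. u < n \<and> P u}"] by auto

lemma card_compl_filter: "card {u :: nat. u < n \<and> \<not> P u} = n - card {u. u < n \<and> P u}"
proof -
  have "{u. u < n \<and> \<not> P u} = {..<n} - {u. u < n \<and> P u}" by auto
  then show ?thesis by (simp add: card_Diff_subset subset_iff)
qed

lemma card_filter_eq_iff:
  "card {w :: nat. w < n \<and> P w} \<le> card {w. w < n \<and> P w \<and> Q w} \<longleftrightarrow> (\<forall>w<n. P w \<longrightarrow> Q w)"
proof
  assume *: "card {w. w < n \<and> P w} \<le> card {w. w < n \<and> P w \<and> Q w}"
  have "{w. w < n \<and> P w \<and> Q w} = {w. w < n \<and> P w}"
    by (rule card_seteq) (use * in auto)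
  then show "\<forall>w<n. P w \<longrightarrow> Q w" by blast
next
  assume "\<forall>w<n. P w \<longrightarrow> Q w"
  then have "{w. w < n \<and> P w \<and> Q w} = {w. w < n \<and> P w}" by auto
  then show "card {w. w < n \<and> P w} \<le> card {w. w < n \<and> P w \<and> Q w}" by simp
qed

text \<open>Immerman--Szelepcsenyi: if \<open>c\<close> is the number of ends of walks of length \<open>j\<close>, then
  exhibiting \<open>c\<close> such ends that are not adjacent to \<open>u\<close> certifies that no walk of length
  \<open>j + 1\<close> ends in \<open>u\<close>.\<close>

definition count_step :: "inst \<Rightarrow> nat \<Rightarrow> nat \<Rightarrow> nat \<Rightarrow> nat \<Rightarrow> nat \<Rightarrow> bool" where
  "count_step g a j c j' c' \<longleftrightarrow> j' = Suc j \<and> (\<exists>n<lim g. n = gn g \<and>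
     c' \<le> card {u. u < n \<and> walk (gE g) j' a u} \<and>
     (\<exists>e<lim g. c' + e = n \<and> e \<le> card {u. u < n \<and>
        c \<le> card {w. w < n \<and> walk (gE g) j a w \<and> (w < gn g \<and> u < gn g \<and> \<not> gE g w u)}}))"

text \<open>Both the ends and the non-ends of walks of length \<open>Suc j\<close> admit certified
  lower bounds, given the correct count for \<open>j\<close>. Bounds \<open>c'\<close> and
  \<open>e\<close> with \<open>c' + e = gn g\<close> leave no slack, so \<open>c'\<close> is
  exact.\<close>

lemma count_step_iff:
  assumes "valid g" "a < gn g" "c = card (sphere g a j)"
  shows "count_step g a j c j' c' \<longleftrightarrow> j' = Suc j \<and> c' = card (sphere g a (Suc j))"
proof -
  let ?n = "gn g"
  have "c \<le> card {w. w < ?n \<and> walk (gE g) j a w \<and> (w < ?n \<and> u < ?n \<and> \<not> gE g w u)} \<longleftrightarrow>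
      \<not> walk (gE g) (Suc j) a u" if "u < ?n" for u
    unfolding assms(3) sphere_def card_filter_eq_iff walk_Suc'
    using that ord_graph_less[OF valid_graph[OF assms(1)]] by auto
  then have "{u. u < ?n \<and> c \<le> card {w. w < ?n \<and> walk (gE g) j a w \<and> (w < ?n \<and> u < ?n \<and> \<not> gE g w u)}}
      = {u. u < ?n \<and> \<not> walk (gE g) (Suc j) a u}" by auto
  then have "count_step g a j c j' c' \<longleftrightarrow> j' = Suc j \<and> c' \<le> card (sphere g a (Suc j)) \<and>
     (\<exists>e<lim g. c' + e = ?n \<and> e \<le> ?n - card (sphere g a (Suc j)))"
    unfolding count_step_def sphere_def card_compl_filter[symmetric] using gn_less[of g] by auto
  also have "(\<exists>e<lim g. c' + e = ?n \<and> e \<le> ?n - card (sphere g a (Suc j))) \<longleftrightarrow>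
      c' \<le> ?n \<and> card (sphere g a (Suc j)) \<le> c'"
  proof -
    have "card (sphere g a (Suc j)) \<le> ?n" unfolding sphere_def by (rule card_filter_le)
    then show ?thesis using gn_less[of g] by (auto intro!: exI[of _ "?n - c'"])
  qed
  also have "j' = Suc j \<and> c' \<le> card (sphere g a (Suc j)) \<and> c' \<le> ?n \<and> card (sphere g a (Suc j)) \<le> c' \<longleftrightarrow>
    j' = Suc j \<and> c' = card (sphere g a (Suc j))"
    using card_filter_le[of ?n "walk (gE g) (Suc j) a"] unfolding sphere_def by auto
  finally show ?thesis .
qed

lemma definable_count_step [dfn]:
  assumes "a < d" "j < d" "c < d" "j' < d" "c' < d" "2 \<le> d"
  shows "definable d (\<lambda>g \<rho>. count_step g (\<rho> a) (\<rho> j) (\<rho> c) (\<rho> j') (\<rho> c'))"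
  unfolding count_step_def
  using assms by (intro definable_ex' definable_atleast dfn) (auto simp: indep_def)

lemma definable_less_gn [dfn]:
  assumes "a < d" "2 \<le> d"
  shows "definable d (\<lambda>g \<rho>. \<rho> a < gn g)"
proof (rule definable_cong)
  show "definable d (\<lambda>g \<rho>. \<exists>n<lim g. n = gn g \<and> \<rho> a < n)"
    using assms by (intro definable_ex' dfn) (auto simp: indep_def)
qed (use gn_less in auto)

text \<open>Inductive counting as a chain of pairs of a length and a count. A correct pair has only
  correct successors, so no wrong count can be reached from the start.\<close>

lemma definable_count [dfn]:
  assumes "a < d" "r < d" "c < d" "2 \<le> d"
  shows "definable d (\<lambda>g \<rho>. \<rho> a < gn g \<and> \<rho> c = card (sphere g (\<rho> a) (\<rho> r)))"
proof (rule definable_cong)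
  let ?R = "\<lambda>g \<rho>. count_step g (\<rho> a)"
  \<comment> \<open>\<open>s1 = Suc s0\<close> expresses the constant 1 by an available atom: a walk
    of length 0 ends only where it starts.\<close>
  show "definable d (\<lambda>g \<rho>. \<exists>s0 s1 t0 t1. s0 < lim g \<and> s1 < lim g \<and> (\<rho> a < gn g \<and> s0 = 0 \<and> s1 = Suc s0) \<and>
    tcr (lim g) (?R g \<rho>) (s0, s1) (t0, t1) \<and> (t0 = \<rho> r \<and> t1 = \<rho> c))"
    using assms by (intro definable_tcr dfn) (auto simp: indep_def)
  fix g \<rho> assume g: "valid g" and ok: "ok g \<rho>"
  have *: "tcr (lim g) (?R g \<rho>) (0, 1) (\<rho> r, \<rho> c) \<longleftrightarrow> \<rho> c = card (sphere g (\<rho> a) (\<rho> r))" if a: "\<rho> a < gn g"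
  proof -
    have "sphere g (\<rho> a) 0 = {\<rho> a}" using a by (auto simp: sphere_def)
    then have card0: "card (sphere g (\<rho> a) 0) = 1" by simp
    have "tcr (lim g) (?R g \<rho>) (0, 1) (i, j) \<Longrightarrow> j = card (sphere g (\<rho> a) i)" for i j
      by (erule tcr_induct) (use count_step_iff[OF g a] card0 in auto)
    moreover have "i < lim g \<Longrightarrow> tcr (lim g) (?R g \<rho>) (0, 1) (i, card (sphere g (\<rho> a) i))" for i
    proof (induction i)
      case 0
      show ?case by (simp add: card0)
    next
      case (Suc i)
      then have "tcr (lim g) (?R g \<rho>) (0, 1) (i, card (sphere g (\<rho> a) i))" by simp
      moreover have "card (sphere g (\<rho> a) (Suc i)) < lim g"
        using card_filter_le[of "gn g"] gn_less[of g] unfolding sphere_def by (meson le_less_trans)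
      ultimately show ?case using count_step_iff[OF g a refl] Suc.prems by (auto intro: tcr_step)
    qed
    ultimately show ?thesis using ok_less[OF ok, of r] by metis
  qed
  have "1 < lim g" using seg_less(5)[of g] by (simp add: seg1_def)
  then have "(\<exists>s0 s1 t0 t1. s0 < lim g \<and> s1 < lim g \<and> (\<rho> a < gn g \<and> s0 = 0 \<and> s1 = Suc s0) \<and>
    tcr (lim g) (?R g \<rho>) (s0, s1) (t0, t1) \<and> (t0 = \<rho> r \<and> t1 = \<rho> c)) \<longleftrightarrow>
    \<rho> a < gn g \<and> tcr (lim g) (?R g \<rho>) (0, 1) (\<rho> r, \<rho> c)" by auto
  then show "(\<exists>s0 s1 t0 t1. s0 < lim g \<and> s1 < lim g \<and> (\<rho> a < gn g \<and> s0 = 0 \<and> s1 = Suc s0) \<and>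
    tcr (lim g) (?R g \<rho>) (s0, s1) (t0, t1) \<and> (t0 = \<rho> r \<and> t1 = \<rho> c)) \<longleftrightarrow>
    \<rho> a < gn g \<and> \<rho> c = card (sphere g (\<rho> a) (\<rho> r))" using * by blast
qed

text \<open>With the exact count \<open>c\<close> at hand, finding \<open>c\<close> ends of walks
  among the vertices other than \<open>\<rho> b\<close> shows that \<open>\<rho> b\<close> is not
  one.\<close>

lemma definable_nonwalk [dfn]:
  assumes "r < d" "a < d" "b < d" "2 \<le> d"
  shows "definable d (\<lambda>g \<rho>. \<rho> a < gn g \<and> \<rho> b < gn g \<and> \<not> walk (gE g) (\<rho> r) (\<rho> a) (\<rho> b))"
proof (rule definable_cong)
  let ?P = "\<lambda>g \<rho>. \<exists>n<lim g. \<exists>c<lim g. n = gn g \<and> \<rho> b < n \<and> (\<rho> a < gn g \<and> c = card (sphere g (\<rho> a)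
      (\<rho> r))) \<and>
    c \<le> card {w. w < n \<and> walk (gE g) (\<rho> r) (\<rho> a) w \<and> w \<noteq> \<rho> b}"
  show "definable d ?P"
    using assms by (intro definable_ex' definable_atleast dfn) (auto simp: indep_def)
  fix g :: inst and \<rho>
  have "card (sphere g (\<rho> a) (\<rho> r)) < lim g"
    using card_filter_le[of "gn g"] gn_less[of g] unfolding sphere_def by (meson le_less_trans)
  moreover have "card (sphere g (\<rho> a) (\<rho> r)) \<le> card {w. w < gn g \<and> walk (gE g) (\<rho> r) (\<rho> a) w \<and> w \<noteq> \<rho> b} \<longleftrightarrow>
    (\<forall>w<gn g. walk (gE g) (\<rho> r) (\<rho> a) w \<longrightarrow> w \<noteq> \<rho> b)"
    unfolding sphere_def by (rule card_filter_eq_iff)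
  ultimately show "?P g \<rho> \<longleftrightarrow> \<rho> a < gn g \<and> \<rho> b < gn g \<and> \<not> walk (gE g) (\<rho> r) (\<rho> a) (\<rho> b)"
    using gn_less[of g] by auto
qed


section \<open>The breadth-first order\<close>

definition conn :: "inst \<Rightarrow> nat \<Rightarrow> nat \<Rightarrow> bool" where
  "conn g a b \<longleftrightarrow> (\<exists>r. walk (gE g) r a b)"

text \<open>A shortest walk needs at most as many steps as there are ordered adjacent pairs, hence
  at most \<open>gn g * gn g\<close>. This crude bound is taken because \<open>seg1 g\<close> is
  already a definable number.\<close>

lemma conn_bounded:
  assumes "valid g" "conn g a b"
  shows "\<exists>r<seg1 g. walk (gE g) r a b"
proof -
  let ?R = "{(u, v). gE g u v}"
  have sub: "?R \<subseteq> {..<gn g} \<times> {..<gn g}"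
    using ord_graph_less[OF valid_graph[OF assms(1)]] by auto
  then have fin: "finite ?R" by (rule finite_subset) simp
  have card: "card ?R \<le> gn g * gn g" using card_mono[OF _ sub] by simp
  have eq: "(u, v) \<in> ?R ^^ k \<longleftrightarrow> walk (gE g) k u v" for k u v
    using fun_cong[OF fun_cong[OF relpowp_relpow_eq[of k ?R]], of u v] by (simp add: walk_def)
  from assms(2) obtain k where "(a, b) \<in> ?R ^^ k" unfolding conn_def eq by blast
  then have "(a, b) \<in> (\<Union>n\<in>{n. n \<le> card ?R}. ?R ^^ n)" using relpow_finite_bounded[OF fin] by blast
  then obtain n where "n \<le> card ?R" "walk (gE g) n a b" unfolding eq[symmetric] by blast
  with card show ?thesis unfolding seg1_def by (metis Suc_eq_plus1 le_trans less_Suc_eq_le)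
qed

lemma definable_conn [dfn]:
  assumes "a < d" "b < d" "2 \<le> d"
  shows "definable d (\<lambda>g \<rho>. conn g (\<rho> a) (\<rho> b))"
proof (rule definable_cong)
  let ?P = "\<lambda>g \<rho>. \<exists>s<lim g. \<exists>r<lim g. s = seg1 g \<and> r < s \<and> walk (gE g) r (\<rho> a) (\<rho> b)"
  show "definable d ?P"
    using assms by (intro definable_ex' dfn) (auto simp: indep_def)
  fix g \<rho> assume g: "valid g"
  show "?P g \<rho> \<longleftrightarrow> conn g (\<rho> a) (\<rho> b)"
  proof
    assume "conn g (\<rho> a) (\<rho> b)"
    from conn_bounded[OF g this] obtain r where "r < seg1 g" "walk (gE g) r (\<rho> a) (\<rho> b)" by blast
    with seg_less(5)[of g] show "?P g \<rho>"
      by (intro exI[of _ "seg1 g"] conjI exI[of _ r]) auto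
  qed (auto simp: conn_def)
qed

lemma definable_nonconn [dfn]:
  assumes "a < d" "b < d" "2 \<le> d"
  shows "definable d (\<lambda>g \<rho>. \<rho> a < gn g \<and> \<rho> b < gn g \<and> \<not> conn g (\<rho> a) (\<rho> b))"
proof (rule definable_cong)
  \<comment> \<open>The range conditions stand under the quantifier to match the form of
    \<open>definable_nonwalk\<close>; they are still implied, since \<open>seg1 g\<close> is
    positive.\<close>
  let ?P = "\<lambda>g \<rho>. \<exists>s<lim g. s = seg1 g \<and> (\<forall>r<s. \<rho> a < gn g \<and> \<rho> b < gn g \<and> \<not> walk (gE g) r (\<rho> a) (\<rho> b))"
  show "definable d ?P"
    using assms by (intro definable_ex' definable_all dfn) (auto simp: indep_def)
  fix g \<rho> assume "valid g"
  from conn_bounded[OF this, of "\<rho> a" "\<rho> b"] seg_less(5)[of g]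
  show "?P g \<rho> \<longleftrightarrow> \<rho> a < gn g \<and> \<rho> b < gn g \<and> \<not> conn g (\<rho> a) (\<rho> b)"
    unfolding conn_def by (auto simp: seg1_def)
qed

section \<open>Component minima, distances and least paths\<close>

lemma all_nat_iff: "(\<forall>i. P i) \<longleftrightarrow> P (0 :: nat) \<and> (\<forall>i. P (Suc i))"
  by (metis nat.exhaust)

lemma is_path_Cons:
  "is_path n E (a # p) u v \<longleftrightarrow> a = u \<and> u < n \<and> (if p = [] then u = v else E u (hd p) \<and> is_path n E p
      (hd p) v)"
proof (cases p)
  case (Cons b q)
  have "(\<forall>i. Suc i < length (a # p) \<longrightarrow> E ((a # p) ! i) ((a # p) ! Suc i)) \<longleftrightarrow>
    E a b \<and> (\<forall>i. Suc i < length p \<longrightarrow> E (p ! i) (p ! Suc i))"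
    unfolding Cons by (subst all_nat_iff) simp
  then show ?thesis unfolding is_path_def using Cons by auto
qed (auto simp: is_path_def)

lemma is_path_Nil: "\<not> is_path n E [] u v"
  by (simp add: is_path_def)

lemma is_path_imp_walk:
  "is_path n E p u v \<Longrightarrow> walk E (length p - 1) u v \<and> u < n \<and> v < n"
proof (induction p arbitrary: u)
  case (Cons a p)
  then show ?case
    by (cases p) (auto simp: is_path_Cons walk_Suc split: if_splits)
qed (simp add: is_path_Nil)

lemma walk_imp_is_path:
  assumes "ord_graph n E"
  shows "walk E r u v \<Longrightarrow> u < n \<Longrightarrow> \<exists>p. is_path n E p u v \<and> length p = Suc r"
proof (induction r arbitrary: u)
  case 0
  then show ?case by (intro exI[of _ "[u]"]) (simp add: is_path_Cons)
next
  case (Suc r)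
  then obtain c where c: "E u c" "walk E r c v" by (auto simp: walk_Suc)
  with Suc.IH[of c] ord_graph_less[OF assms c(1)] obtain p where p: "is_path n E p c v" "length p
      = Suc r" by blast
  then have "hd p = c" by (simp add: is_path_def)
  with p c Suc.prems show ?case by (intro exI[of _ "u # p"]) (auto simp: is_path_Cons)
qed

definition cmin :: "inst \<Rightarrow> nat \<Rightarrow> nat" where
  "cmin g v = comp_min (gn g) (gE g) v"

lemma cmin_eq_Min:
  assumes "valid g"
  shows "cmin g v = Min {u. u < gn g \<and> conn g u v}"
proof -
  have "(\<exists>p. is_path (gn g) (gE g) p u v) \<longleftrightarrow> conn g u v" if "u < gn g" for u
    using is_path_imp_walk walk_imp_is_path[OF valid_graph[OF assms]] that unfolding conn_def by blast
  then have "{u. u < gn g \<and> (\<exists>p. is_path (gn g) (gE g) p u v)} = {u. u < gn g \<and> conn g u v}" by blast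
  then show ?thesis unfolding cmin_def comp_min_def by simp
qed

text \<open>Replaces \<open>Min\<close> by conditions with a certificate each. The set is nonempty
  because \<open>v\<close> is connected to itself.\<close>

lemma cmin_iff:
  assumes "valid g" "v < gn g"
  shows "a = cmin g v \<longleftrightarrow> a < gn g \<and> conn g a v \<and> (\<forall>u<a. \<not> conn g u v)"
proof -
  let ?S = "{u. u < gn g \<and> conn g u v}"
  have "conn g v v" unfolding conn_def by (intro exI[of _ 0]) simp
  with assms(2) have "v \<in> ?S" by simp
  then have ne: "?S \<noteq> {}" by blast
  have "a = Min ?S \<longleftrightarrow> a \<in> ?S \<and> (\<forall>u\<in>?S. a \<le> u)"
    using Min_eq_iff[OF _ ne, of a] by auto
  also have "\<dots> \<longleftrightarrow> a < gn g \<and> conn g a v \<and> (\<forall>u<a. \<not> conn g u v)"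
  proof (intro iffI conjI allI impI ballI)
    fix u assume "a \<in> ?S \<and> (\<forall>u\<in>?S. a \<le> u)" "u < a"
    moreover from this have "u < gn g" by simp
    ultimately show "\<not> conn g u v" by (metis (mono_tags) CollectI not_le)
  next
    fix u assume "a < gn g \<and> conn g a v \<and> (\<forall>u<a. \<not> conn g u v)" "u \<in> ?S"
    then show "a \<le> u" by (metis (mono_tags) CollectD not_le)
  qed auto
  finally show ?thesis unfolding cmin_eq_Min[OF assms(1)] .
qed

lemma definable_cmin [dfn]:
  assumes "a < d" "v < d" "2 \<le> d"
  shows "definable d (\<lambda>g \<rho>. \<rho> v < gn g \<and> \<rho> a = cmin g (\<rho> v))"
proof (rule definable_cong)
  show "definable d (\<lambda>g \<rho>. \<rho> a < gn g \<and> \<rho> v < gn g \<and> conn g (\<rho> a) (\<rho> v) \<and>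
    (\<forall>u<\<rho> a. u < gn g \<and> \<rho> v < gn g \<and> \<not> conn g u (\<rho> v)))"
    using assms by (intro definable_all dfn) (auto simp: indep_def)
  fix g :: inst and \<rho> assume "valid g"
  from cmin_iff[OF this] show "\<rho> a < gn g \<and> \<rho> v < gn g \<and> conn g (\<rho> a) (\<rho> v) \<and>
    (\<forall>u<\<rho> a. u < gn g \<and> \<rho> v < gn g \<and> \<not> conn g u (\<rho> v)) \<longleftrightarrow> \<rho> v < gn g \<and> \<rho> a = cmin g (\<rho> v)"
    by (meson less_trans)
qed

text \<open>The range conditions accompany the negated walk because only that conjunction is
  available from \<open>definable_nonwalk\<close>.\<close>

definition is_dist :: "inst \<Rightarrow> nat \<Rightarrow> nat \<Rightarrow> nat \<Rightarrow> bool" where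
  "is_dist g a b r \<longleftrightarrow> walk (gE g) r a b \<and> (\<forall>u<r. a < gn g \<and> b < gn g \<and> \<not> walk (gE g) u a b)"

lemma definable_is_dist [dfn]:
  assumes "a < d" "b < d" "r < d" "2 \<le> d"
  shows "definable d (\<lambda>g \<rho>. is_dist g (\<rho> a) (\<rho> b) (\<rho> r))"
  unfolding is_dist_def using assms by (intro definable_all dfn) (auto simp: indep_def)

text \<open>The least neighbour of \<open>c\<close> from which \<open>v\<close> is \<open>r\<close>
  steps away. Minimality is written by De Morgan: each smaller \<open>u\<close> fails one of two
  conditions, and both failures appear in their certified form.\<close>

definition is_next :: "inst \<Rightarrow> nat \<Rightarrow> nat \<Rightarrow> nat \<Rightarrow> nat \<Rightarrow> bool" where
  "is_next g v r c a \<longleftrightarrow> gE g c a \<and> walk (gE g) r a v \<and>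
     (\<forall>u<a. (c < gn g \<and> u < gn g \<and> \<not> gE g c u) \<or> (u < gn g \<and> v < gn g \<and> \<not> walk (gE g) r u v))"

lemma definable_is_next [dfn]:
  assumes "v < d" "r < d" "c < d" "a < d" "2 \<le> d"
  shows "definable d (\<lambda>g \<rho>. is_next g (\<rho> v) (\<rho> r) (\<rho> c) (\<rho> a))"
  unfolding is_next_def using assms by (intro definable_all dfn) (auto simp: indep_def)

fun greedy :: "(nat \<Rightarrow> nat \<Rightarrow> bool) \<Rightarrow> nat \<Rightarrow> nat \<Rightarrow> nat \<Rightarrow> nat list" where
  "greedy E v 0 c = [c]"
| "greedy E v (Suc r) c = c # greedy E v r (LEAST a. E c a \<and> walk E r a v)"

lemma hd_greedy [simp]: "hd (greedy E v r c) = c" "greedy E v r c \<noteq> []" "length (greedy E v r c) = Suc r"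
  by (induction r arbitrary: c) auto

lemma least_next:
  assumes "walk E (Suc r) c v"
  shows "E c (LEAST a. E c a \<and> walk E r a v) \<and> walk E r (LEAST a. E c a \<and> walk E r a v) v"
  using assms unfolding walk_Suc by (rule LeastI_ex)

lemma is_next_iff:
  assumes "valid g" "walk (gE g) (Suc r) c v"
  shows "is_next g v r c a \<longleftrightarrow> a = (LEAST a. gE g c a \<and> walk (gE g) r a v)"
proof -
  let ?Q = "\<lambda>a. gE g c a \<and> walk (gE g) r a v"
  have E: "gE g x y \<Longrightarrow> x < gn g \<and> y < gn g" for x y
    using ord_graph_less[OF valid_graph[OF assms(1)]] .
  obtain b where "gE g c b" "walk (gE g) r b v" using assms(2) unfolding walk_Suc by blast
  with E walk_less[OF valid_graph[OF assms(1)]] have *: "c < gn g" "v < gn g" by blast+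
  then have "is_next g v r c a \<longleftrightarrow> ?Q a \<and> (\<forall>u<a. \<not> ?Q u)"
    unfolding is_next_def using E less_trans by blast
  also have "\<dots> \<longleftrightarrow> a = (LEAST a. ?Q a)"
    using LeastI[of ?Q] Least_equality[of ?Q a] least_next[OF assms(2)] not_less_Least[of _ ?Q]
    by (metis (no_types, lifting) not_less)
  finally show ?thesis .
qed

lemma less_star_Cons:
  "length p = length q \<Longrightarrow> less_star (a # p) (b # q) \<longleftrightarrow> a < b \<or> a = b \<and> less_star p q"
  by (auto simp: less_star_def Cons_lenlex_iff)

lemma less_star_length: "length p < length q \<Longrightarrow> less_star p q"
  by (simp add: less_star_def lenlex_conv)

lemma less_star_length_le: "less_star p q \<Longrightarrow> length p \<le> length q"
  by (auto simp: less_star_def dest: lenlex_length)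

text \<open>Provides the uniqueness behind \<open>THE\<close> in \<open>least_path\<close>.\<close>

lemma less_star_asym: "less_star p q \<Longrightarrow> \<not> less_star q p"
proof (induction p arbitrary: q)
  case Nil
  then show ?case by (auto simp: less_star_def)
next
  case (Cons a p)
  then obtain b p' where q: "q = b # p'" using less_star_length_le by (cases q) fastforce+
  then show ?case
    using Cons less_star_length_le[of "a # p" q] less_star_length_le[of q "a # p"] less_star_Cons[of p p' a b] less_star_Cons[of p' p b a]
    by (metis le_antisym length_Cons nat.inject not_less_iff_gr_or_eq)
qed

lemma greedy_is_path:
  assumes "ord_graph n E"
  shows "walk E r c v \<Longrightarrow> c < n \<Longrightarrow> is_path n E (greedy E v r c) c v"
proof (induction r arbitrary: c)
  case (Suc r)
  let ?a = "LEAST a. E c a \<and> walk E r a v"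
  from least_next[OF Suc.prems(1)] have a: "E c ?a" "walk E r ?a v" by auto
  then have "is_path n E (greedy E v r ?a) ?a v"
    using ord_graph_less[OF assms] by (intro Suc.IH) auto
  then show ?case using a Suc.prems(2) by (simp add: is_path_Cons)
qed (simp add: is_path_Cons)

text \<open>Among walks of one length the order compares first differences. The greedy second vertex
  is minimal among all candidates; if a competitor agrees there, the induction hypothesis decides on
  the tails.\<close>

lemma greedy_least:
  "is_path n E q c v \<Longrightarrow> length q = Suc r \<Longrightarrow> q = greedy E v r c \<or> less_star (greedy E v r c) q"
proof (induction r arbitrary: c q)
  case 0
  then show ?case by (cases q) (auto simp: is_path_Cons)
next
  case (Suc r)
  then obtain q' where q: "q = c # q'" by (cases q) (auto simp: is_path_Cons)
  with Suc.prems have q': "q' \<noteq> []" "E c (hd q')" "is_path n E q' (hd q') v" "length q' = Suc r"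
    by (auto simp: is_path_Cons split: if_splits)
  let ?a = "LEAST a. E c a \<and> walk E r a v"
  have "walk E r (hd q') v" using is_path_imp_walk[OF q'(3)] q'(4) by simp
  with q' have le: "?a \<le> hd q'" by (intro Least_le) simp
  show ?case
  proof (cases "?a = hd q'")
    case True
    with Suc.IH[OF q'(3,4)] q'(4) show ?thesis unfolding q by (auto simp: less_star_Cons)
  next
    case False
    with le have "?a < hd q'" by simp
    moreover obtain t where "greedy E v r ?a = ?a # t" "length t = r" by (cases r) auto
    moreover obtain t' where "q' = hd q' # t'" "length t' = r" using q'(1,4) by (cases q') auto
    ultimately have "less_star (greedy E v r ?a) q'" by (metis less_star_Cons)
    then show ?thesis unfolding q using q'(4) by (simp add: less_star_Cons)
  qed
qed

text \<open>Shorter paths are excluded by the distance, longer ones lose by length, and those of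
  equal length are handled by \<open>greedy_least\<close>.\<close>

lemma least_path_eq_greedy:
  assumes "valid g" "v < gn g" "is_dist g (cmin g v) v r"
  shows "least_path (gn g) (gE g) v = greedy (gE g) v r (cmin g v)"
proof -
  let ?n = "gn g" and ?E = "gE g" and ?s = "cmin g v"
  let ?P = "\<lambda>p. is_path ?n ?E p ?s v \<and> (\<forall>q. is_path ?n ?E q ?s v \<longrightarrow> q = p \<or> less_star p q)"
  have s: "?s < ?n" using cmin_iff[OF assms(1,2)] by blast
  have P: "?P (greedy ?E v r ?s)"
  proof (intro conjI allI impI)
    show "is_path ?n ?E (greedy ?E v r ?s) ?s v"
      using assms(3) s valid_graph[OF assms(1)] unfolding is_dist_def by (intro greedy_is_path) auto
    fix q assume q: "is_path ?n ?E q ?s v"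
    have "\<not> length q - 1 < r" using is_path_imp_walk[OF q] assms(3) unfolding is_dist_def by blast
    moreover have "q \<noteq> []" using q by (auto simp: is_path_Nil)
    ultimately consider "length q = Suc r" | "Suc r < length q" by (cases q) force+
    then show "q = greedy ?E v r ?s \<or> less_star (greedy ?E v r ?s) q"
      using greedy_least[OF q] less_star_length by cases auto
  qed
  moreover have "p = greedy ?E v r ?s" if "?P p" for p
    using that P less_star_asym by blast
  ultimately have "(THE p. ?P p) = greedy ?E v r ?s" by (rule the_equality)
  then show ?thesis unfolding least_path_def cmin_def .
qed

section \<open>Comparing the least paths of two vertices\<close>

lemma tcr_unfold:
  "tcr m R (a, b) t \<longleftrightarrow> t = (a, b) \<or> (\<exists>a' b'. a' < m \<and> b' < m \<and> R a b a' b' \<and> tcr m R (a', b') t)"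
proof
  assume "tcr m R (a, b) t"
  then show "t = (a, b) \<or> (\<exists>a' b'. a' < m \<and> b' < m \<and> R a b a' b' \<and> tcr m R (a', b') t)"
    unfolding tcr_def by (cases rule: converse_rtranclpE) auto
qed (auto intro: tcr_step')


definition lex_end :: "inst \<Rightarrow> nat \<Rightarrow> nat \<Rightarrow> nat \<Rightarrow> nat \<Rightarrow> bool" where
  "lex_end g v w c i \<longleftrightarrow> (\<exists>a<lim g. \<exists>b<lim g. \<exists>r<lim g. i = Suc r \<and> is_next g v r c a \<and>
      is_next g w r c b \<and> a < b)"

text \<open>While the two least paths coincide, one current vertex serves both. With the number of
  remaining steps it forms a pair, as the closure requires; \<open>lex_end\<close> confirms the
  first difference.\<close>

definition lex_step :: "inst \<Rightarrow> nat \<Rightarrow> nat \<Rightarrow> nat \<Rightarrow> nat \<Rightarrow> nat \<Rightarrow> nat \<Rightarrow> bool" where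
  "lex_step g v w c i c' i' \<longleftrightarrow> i = Suc i' \<and> is_next g v i' c c' \<and> is_next g w i' c c'"

definition lex_less :: "inst \<Rightarrow> nat \<Rightarrow> nat \<Rightarrow> nat \<Rightarrow> nat \<Rightarrow> bool" where
  "lex_less g v w c i \<longleftrightarrow> (\<exists>c' i'. tcr (lim g) (lex_step g v w) (c, i) (c', i') \<and> lex_end g v w c' i')"

lemma definable_lex_less [dfn]:
  assumes "v < d" "w < d" "c < d" "i < d" "2 \<le> d"
  shows "definable d (\<lambda>g \<rho>. lex_less g (\<rho> v) (\<rho> w) (\<rho> c) (\<rho> i))"
proof (rule definable_cong)
  show "definable d (\<lambda>g \<rho>. \<exists>s0 s1 t0 t1. s0 < lim g \<and> s1 < lim g \<and> (s0 = \<rho> c \<and> s1 = \<rho> i) \<and>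
    tcr (lim g) (lex_step g (\<rho> v) (\<rho> w)) (s0, s1) (t0, t1) \<and> lex_end g (\<rho> v) (\<rho> w) t0 t1)"
    unfolding lex_step_def lex_end_def
    using assms by (intro definable_tcr definable_ex' dfn) (auto simp: indep_def)
  show "(\<exists>s0 s1 t0 t1. s0 < lim g \<and> s1 < lim g \<and> (s0 = \<rho> c \<and> s1 = \<rho> i) \<and>
    tcr (lim g) (lex_step g (\<rho> v) (\<rho> w)) (s0, s1) (t0, t1) \<and> lex_end g (\<rho> v) (\<rho> w) t0 t1) \<longleftrightarrow>
    lex_less g (\<rho> v) (\<rho> w) (\<rho> c) (\<rho> i)" if "ok g \<rho>" for g \<rho>
    using ok_less[OF that, of c] ok_less[OF that, of i] unfolding lex_less_def by blast
qed

lemma lex_less_unfold: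
  "lex_less g v w c i \<longleftrightarrow> lex_end g v w c i \<or>
    (\<exists>c' i'. c' < lim g \<and> i' < lim g \<and> lex_step g v w c i c' i' \<and> lex_less g v w c' i')"
  unfolding lex_less_def by (subst tcr_unfold) auto

text \<open>Both walks must have the same remaining length \<open>i\<close>. The paths then agree in
  their lengths throughout, and the comparison unfolds in step with the recursion of
  \<open>greedy\<close>.\<close>

lemma lex_less_iff:
  assumes "valid g"
  shows "walk (gE g) i c v \<Longrightarrow> walk (gE g) i c w \<Longrightarrow> i < lim g \<Longrightarrow>
    lex_less g v w c i \<longleftrightarrow> less_star (greedy (gE g) v i c) (greedy (gE g) w i c)"
proof (induction i arbitrary: c)
  case 0
  show ?case
    by (subst lex_less_unfold) (auto simp: lex_end_def lex_step_def less_star_def lenlex_conv)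
next
  case (Suc i)
  define a where "a = (LEAST a. gE g c a \<and> walk (gE g) i a v)"
  define b where "b = (LEAST b. gE g c b \<and> walk (gE g) i b w)"
  from least_next[OF Suc.prems(1)] least_next[OF Suc.prems(2)]
  have ab: "gE g c a" "walk (gE g) i a v" "gE g c b" "walk (gE g) i b w" by (auto simp: a_def b_def)
  with ord_graph_less[OF valid_graph[OF assms]] gn_less[of g] have lims: "a < lim g" "b < lim g"
    by (meson less_trans)+
  have nx: "is_next g v i c u \<longleftrightarrow> u = a" "is_next g w i c u \<longleftrightarrow> u = b" for u
    using is_next_iff[OF assms Suc.prems(1)] is_next_iff[OF assms Suc.prems(2)] by (auto
        simp: a_def b_def)
  have "lex_less g v w c (Suc i) \<longleftrightarrow> a < b \<or> a = b \<and> lex_less g v w a i"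
    using lims Suc.prems(3)
    by (subst lex_less_unfold) (auto simp: lex_end_def lex_step_def nx)
  also have "\<dots> \<longleftrightarrow> a < b \<or> a = b \<and> less_star (greedy (gE g) v i a) (greedy (gE g) w i b)"
    using Suc.IH[of a] ab Suc.prems(3) by auto
  also have "\<dots> \<longleftrightarrow> less_star (greedy (gE g) v i a) (greedy (gE g) w i b)"
  proof -
    obtain p q where pq: "greedy (gE g) v i a = a # p" "greedy (gE g) w i b = b # q" by (cases i) auto
    then have "length p = length q" by (metis hd_greedy(3) length_Cons nat.inject)
    then show ?thesis unfolding pq by (auto simp: less_star_Cons)
  qed
  also have "\<dots> \<longleftrightarrow> less_star (greedy (gE g) v (Suc i) c) (greedy (gE g) w (Suc i) c)"
    by (simp add: less_star_Cons a_def b_def)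
  finally show ?case .
qed

text \<open>The component minima enter as parameters, since they are values already confirmed by the
  surrounding formula. A path with \<open>r\<close> steps has \<open>r + 1\<close> vertices, so
  comparing distances compares lengths.\<close>

definition bfs_less :: "inst \<Rightarrow> nat \<Rightarrow> nat \<Rightarrow> nat \<Rightarrow> nat \<Rightarrow> bool" where
  "bfs_less g v w s s' \<longleftrightarrow> s < s' \<or> s = s' \<and> (\<exists>r<lim g. \<exists>r'<lim g. is_dist g s v r \<and> is_dist g s w r' \<and>
     (r < r' \<or> r = r' \<and> lex_less g v w s r))"

lemma ex_dist:
  assumes "valid g" "v < gn g"
  shows "\<exists>r<lim g. is_dist g (cmin g v) v r"
proof -
  let ?s = "cmin g v" and ?Q = "\<lambda>r. walk (gE g) r (cmin g v) v"
  have s: "?s < gn g" "conn g ?s v" using cmin_iff[OF assms] by blast+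
  from conn_bounded[OF assms(1) s(2)] obtain r where r: "r < seg1 g" "?Q r" by blast
  have "?Q (LEAST r. ?Q r)" "(LEAST r. ?Q r) \<le> r" "\<forall>u<(LEAST r. ?Q r). \<not> ?Q u"
    using r LeastI[of ?Q r] Least_le[of ?Q r] not_less_Least[of _ ?Q] by auto
  with s(1) assms(2) r(1) seg_less(5)[of g] show ?thesis unfolding is_dist_def
    by (intro exI[of _ "LEAST r. ?Q r"]) auto
qed

lemma is_dist_unique: "is_dist g a b r \<Longrightarrow> is_dist g a b r' \<Longrightarrow> r = r'"
  unfolding is_dist_def by (metis not_less_iff_gr_or_eq)

lemma bfs_less_iff:
  assumes "valid g" "v < gn g" "w < gn g"
  shows "bfs_less g v w (cmin g v) (cmin g w) \<longleftrightarrow> precB (gn g) (gE g) v w"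
proof (cases "cmin g v = cmin g w")
  case False
  then show ?thesis by (auto simp: bfs_less_def precB_def cmin_def)
next
  case True
  obtain r where r: "r < lim g" "is_dist g (cmin g v) v r" using ex_dist[OF assms(1,2)] by blast
  obtain r' where r': "r' < lim g" "is_dist g (cmin g w) w r'" using ex_dist[OF assms(1,3)] by blast
  let ?p = "greedy (gE g) v r (cmin g v)" and ?q = "greedy (gE g) w r' (cmin g v)"
  have lp: "least_path (gn g) (gE g) v = ?p" "least_path (gn g) (gE g) w = ?q"
    using least_path_eq_greedy[OF assms(1,2) r(2)] least_path_eq_greedy[OF assms(1,3) r'(2)] True by auto
  have "bfs_less g v w (cmin g v) (cmin g w) \<longleftrightarrow> r < r' \<or> r = r' \<and> lex_less g v w (cmin g v) r"
    unfolding bfs_less_def True[symmetric] using r r'[folded True] is_dist_unique by blast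
  also have "\<dots> \<longleftrightarrow> less_star ?p ?q"
  proof (cases "r = r'")
    case True
    then show ?thesis
      using lex_less_iff[OF assms(1), of r "cmin g v" v w] r r' \<open>cmin g v = cmin g w\<close> by (auto
          simp: is_dist_def)
  next
    case False
    then show ?thesis
      using less_star_length[of ?p ?q] less_star_length_le[of ?p ?q] by auto
  qed
  also have "\<dots> \<longleftrightarrow> precB (gn g) (gE g) v w"
    unfolding precB_def lp using True by (simp add: cmin_def)
  finally show ?thesis .
qed

lemma definable_precB: "definable 2 (\<lambda>g \<rho>. precB (gn g) (gE g) (gv g) (gw g))"
proof (rule definable_cong)
  \<comment> \<open>The conjunctions in parentheses are grouped as in \<open>definable_cmin\<close>,
    which defines a component minimum only together with the range of its vertex.\<close>
  let ?P = "\<lambda>g \<rho>. \<exists>v<lim g. \<exists>w<lim g. \<exists>s<lim g. \<exists>s'<lim g. v = gv g \<and> w = gw g \<and>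
    (v < gn g \<and> s = cmin g v) \<and> (w < gn g \<and> s' = cmin g w) \<and> bfs_less g v w s s'"
  show "definable 2 ?P"
    unfolding bfs_less_def by (intro definable_ex' dfn) (auto simp: indep_def)
  fix g :: inst and \<rho> :: env assume g: "valid g"
  then have vw: "gv g < gn g" "gw g < gn g" by (auto simp: valid_def)
  have "cmin g u < gn g" if "u < gn g" for u
    using cmin_iff[OF g that] by blast
  from this[OF vw(1)] this[OF vw(2)] vw gn_less[of g]
  have "cmin g (gv g) < lim g" "cmin g (gw g) < lim g" "gv g < lim g" "gw g < lim g" by linarith+
  then show "?P g \<rho> \<longleftrightarrow> precB (gn g) (gE g) (gv g) (gw g)"
    using bfs_less_iff[OF g vw] vw by auto
qed

theorem theorem7:
  shows "\<exists>M. ntm_wf M \<and> logspace M \<and>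
    (\<forall>n E v w. ord_graph n E \<longrightarrow> v < n \<longrightarrow> w < n \<longrightarrow>
       (accepts M (enc_input n E v w) \<longleftrightarrow> precB n E v w))"
proof -
  from definable_precB obtain p where p: "decides 2 p (\<lambda>g \<rho>. precB (gn g) (gE g) (gv g) (gw g))"
    unfolding definable_def by blast
  obtain k where k: "2 \<le> k" "regs p \<subseteq> {..<k}"
  proof -
    obtain m where "\<forall>r\<in>regs p. r < m"
      using finite_regs[of p] finite_nat_set_iff_bounded by blast
    \<comment> \<open>At least two tracks are required even if \<open>p\<close> mentions fewer
      registers, because the counting phase writes register 1.\<close>
    then have "regs p \<subseteq> {..<max 2 m}" by force
    then show ?thesis using that[of "max 2 m"] by simp
  qed
  have "accepts (machine k p) (enc_input n E v w) \<longleftrightarrow> precB n E v w"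
    if "ord_graph n E" "v < n" "w < n" for n E v w
  proof -
    define g where "g = \<lparr>gn = n, gE = E, gv = v, gw = w\<rparr>"
    have g: "valid g" and x: "word g = enc_input n E v w" using that by (auto
        simp: g_def valid_def word_def)
    have "start_ok g (length (word g) + 1, env0 (length (word g) + 1))"
      using cap_gt[of "word g"] by (auto simp: start_ok_def ok_def env0_def)
    with p g have "(\<exists>s. sem (word g) p (length (word g) + 1, env0 (length (word g) + 1)) s) \<longleftrightarrow>
        precB n E v w"
      unfolding decides_def g_def by fastforce
    then show ?thesis using accepts_machine_iff[OF k, of "word g"] x by simp
  qed
  with ntm_wf_machine[OF k(1)] logspace_machine[OF k(1)] show ?thesis by blast
qed

end
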